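(* Let $f:\mathbb{C}\to\hat{\mathbb{C}}$ be a nonconstant meromorphic function which is not a linear map. Then \[ \dim_{\mathrm{hyp}}(f) = \dim_H(J_r(f)). \]
   Context: Distances, disks $\mathbb{D}_\delta(z_0)=\{z:\operatorname{dist}(z,z_0)<\delta\}$ and norms of derivatives are taken with respect to the spherical metric on $\hat{\mathbb{C}}$; "meromorphic" includes entire. The Fatou set $F(f)$ is the set of points having a neighbourhood on which all iterates $f^n$ are defined and form a normal family, and $J(f)=\hat{\mathbb{C}}\setminus F(f)$ is the Julia set. The radial Julia set $J_r(f)$ is the set of points $z\in J(f)$ such that all forward images $f^n(z)$ are defined and there is $\delta>0$ such that for infinitely many $n\in\mathbb{N}$, $f^n$ maps the connected component of $f^{-n}(\mathbb{D}_\delta(f^n(z)))$ containing $z$ conformally onto $\mathbb{D}_\delta(f^n(z))$. A hyperbolic set is a compact set $K$ contained in the domain of $f$ with $f(K)\subset K$ such that there are $n\ge1$ and $\lambda>1$ with $\|Df^n(z)\|>\lambda$ for all $z\in K$. The hyperbolic dimension $\dim_{\mathrm{hyp}}(f)$ is the supremum of the Hausdorff dimensions $\dim_H(K)$ over all hyperbolic sets $K$ of $f$. *)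

theory Defs
  imports "HOL-Complex_Analysis.Complex_Analysis"
begin

text \<open>The Riemann sphere is represented as complex option, None being infinity.
  A meromorphic function f : C -> Riemann sphere is represented by a complex function
  f with f nicely_meromorphic_on UNIV (library notion; value 0 at poles, which are
  detected by is_pole).\<close>

fun chordal :: "complex option \<Rightarrow> complex option \<Rightarrow> real" where
  "chordal (Some z) (Some w) = 2 * cmod (z - w) / sqrt ((1 + (cmod z)\<^sup>2) * (1 + (cmod w)\<^sup>2))"
| "chordal (Some z) None = 2 / sqrt (1 + (cmod z)\<^sup>2)"
| "chordal None (Some w) = 2 / sqrt (1 + (cmod w)\<^sup>2)"
| "chordal None None = 0"

definition ext_val :: "(complex \<Rightarrow> complex) \<Rightarrow> complex \<Rightarrow> complex option" where
  "ext_val f z = (if is_pole f z then None else Some (f z))"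

definition iter_dom :: "(complex \<Rightarrow> complex) \<Rightarrow> nat \<Rightarrow> complex set" where
  "iter_dom f n = {z. \<forall>k. Suc k < n \<longrightarrow> \<not> is_pole f ((f ^^ k) z)}"

text \<open>Value of the n-th iterate in the Riemann sphere (meaningful on iter_dom f n).\<close>
definition iter_val :: "(complex \<Rightarrow> complex) \<Rightarrow> nat \<Rightarrow> complex \<Rightarrow> complex option" where
  "iter_val f n z = (if n = 0 then Some z else ext_val f ((f ^^ (n - 1)) z))"

definition normal_family :: "complex set \<Rightarrow> (nat \<Rightarrow> complex \<Rightarrow> complex option) \<Rightarrow> bool" where
  "normal_family U F \<longleftrightarrow>
     (\<forall>\<nu>::nat \<Rightarrow> nat. \<exists>r g. strict_mono r \<and>
        (\<forall>K. compact K \<and> K \<subseteq> U \<longrightarrow>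
           (\<forall>\<epsilon>>0. eventually (\<lambda>j. \<forall>w\<in>K. chordal (F (\<nu> (r j)) w) (g w) < \<epsilon>) sequentially)))"

definition fatou_point :: "(complex \<Rightarrow> complex) \<Rightarrow> complex \<Rightarrow> bool" where
  "fatou_point f z \<longleftrightarrow>
     (\<exists>U. open U \<and> z \<in> U \<and> (\<forall>n. U \<subseteq> iter_dom f n) \<and> normal_family U (iter_val f))"

text \<open>Finite part of the Julia set (infinity plays no role in the statement).\<close>
definition julia :: "(complex \<Rightarrow> complex) \<Rightarrow> complex set" where
  "julia f = {z. \<not> fatou_point f z}"

fun inv_chart :: "complex option \<Rightarrow> complex" where
  "inv_chart None = 0"
| "inv_chart (Some a) = inverse a"

text \<open>f^n maps the component of f^{-n}(D_delta(f^n z)) containing z conformally onto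
  D_delta(f^n z): bijectively, with nonvanishing derivative (in the chart at infinity
  where the value is infinity).\<close>
definition conformal_pullback :: "(complex \<Rightarrow> complex) \<Rightarrow> nat \<Rightarrow> complex \<Rightarrow> real \<Rightarrow> bool" where
  "conformal_pullback f n z \<delta> \<longleftrightarrow>
     (let D = {q. chordal q (iter_val f n z) < \<delta>};
          V = connected_component_set {w \<in> iter_dom f n. iter_val f n w \<in> D} z
      in bij_betw (iter_val f n) V D \<and>
         (\<forall>w\<in>V. (iter_val f n w \<noteq> None \<longrightarrow>
                    (\<exists>d. d \<noteq> 0 \<and> ((f ^^ n) has_field_derivative d) (at w))) \<and>
                 (iter_val f n w = None \<longrightarrow>
                    (\<exists>d. d \<noteq> 0 \<and> ((\<lambda>u. inv_chart (iter_val f n u)) has_field_derivative d) (at w)))))"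

definition radial_julia :: "(complex \<Rightarrow> complex) \<Rightarrow> complex set" where
  "radial_julia f = {z \<in> julia f. (\<forall>n. z \<in> iter_dom f n) \<and>
                       (\<exists>\<delta>>0. \<exists>\<^sub>\<infinity>n. conformal_pullback f n z \<delta>)}"

definition sph_deriv :: "(complex \<Rightarrow> complex) \<Rightarrow> nat \<Rightarrow> complex \<Rightarrow> real" where
  "sph_deriv f n z = cmod (deriv (f ^^ n) z) * (1 + (cmod z)\<^sup>2) / (1 + (cmod ((f ^^ n) z))\<^sup>2)"

definition hyperbolic_set :: "(complex \<Rightarrow> complex) \<Rightarrow> complex set \<Rightarrow> bool" where
  "hyperbolic_set f K \<longleftrightarrow> compact K \<and> (\<forall>z\<in>K. \<not> is_pole f z \<and> f z \<in> K) \<and>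
     (\<exists>n\<ge>1. \<exists>lam>1. \<forall>z\<in>K. sph_deriv f n z > lam)"

definition sdiam :: "complex set \<Rightarrow> real" where
  "sdiam U = (if U = {} then 0 else Sup {chordal (Some x) (Some y) | x y. x \<in> U \<and> y \<in> U})"

definition hcost :: "real \<Rightarrow> complex set \<Rightarrow> real" where
  "hcost s U = (if U = {} then 0 else if sdiam U = 0 \<and> s = 0 then 1 else sdiam U powr s)"

definition hausdorff_pre :: "real \<Rightarrow> real \<Rightarrow> complex set \<Rightarrow> ennreal" where
  "hausdorff_pre s \<delta> A =
     (INF U \<in> {U :: nat \<Rightarrow> complex set. A \<subseteq> (\<Union>i. U i) \<and> (\<forall>i. sdiam (U i) \<le> \<delta>)}.
        \<Sum>i. ennreal (hcost s (U i)))"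

definition hausdorff_measure :: "real \<Rightarrow> complex set \<Rightarrow> ennreal" where
  "hausdorff_measure s A = (SUP \<delta> \<in> {0<..}. hausdorff_pre s \<delta> A)"

definition hausdorff_dim :: "complex set \<Rightarrow> ereal" where
  "hausdorff_dim A = Inf {ereal s | s. 0 \<le> s \<and> hausdorff_measure s A = 0}"

definition hyp_dim :: "(complex \<Rightarrow> complex) \<Rightarrow> ereal" where
  "hyp_dim f = (SUP K \<in> {K. hyperbolic_set f K}. hausdorff_dim K)"

end

theory Submission
  imports Defs
begin

text \<open>
  Expansion makes a hyperbolic set consist of radial Julia points. Conversely, let \<open>t < t'\<close> be below
  the dimension of the radial Julia set. At a radial point the inverse branches along the orbit shrink:
  otherwise all iterates are univalent on a fixed disk, and by Koebe's theorem either they are uniformly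
  Lipschitz for the chordal metric, so that the point is in the Fatou set, or their images contain
  arbitrarily large disks, so that \<open>f\<close> is entire and injective, hence affine. A countable decomposition,
  followed by transport under a univalent iterate, gives one disk \<open>D\<close> and a set in \<open>D\<close> of positive
  \<open>t'\<close>-dimensional measure, each point of which lies close to arbitrarily small images of \<open>D\<close> under
  inverse branches of iterates. By Vitali's covering lemma finitely many of these images are disjoint,
  lie in \<open>D\<close>, and have contraction ratios whose \<open>t\<close>-th powers sum to more than \<open>1\<close>. The forward orbit
  of the limit set of this iterated function system is hyperbolic and has dimension at least \<open>t\<close>.
\<close>

subsection \<open>Koebe distortion from Schottky's theorem\<close>

text \<open>Only the existence of absolute distortion constants matters, so Schottky's theorem can
  stand in for the sharp Koebe estimates. The gap between \<open>t\<close> and \<open>t'\<close> is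
  what produces a sum above \<open>1\<close>: the Vitali balls have a \<open>t'\<close>-sum bounded
  below, and since their radii may be taken arbitrarily small, their \<open>t\<close>-sum exceeds
  any prescribed number, in particular one that absorbs all distortion constants. No measure is
  constructed on the limit set; its covers are estimated directly. Two obstacles shape the
  construction. Orbits may approach infinity, so pullbacks are read in one of two charts and the
  single point over infinity is discarded, which is harmless for positive exponents. Moreover, the
  small images of a disk under inverse branches lie near the radial points, which need not lie in
  the disk; composing the branches with one fixed iterate \<open>f ^^ n\<close> moves these images
  into the disk, and only then can they be iterated. The base point is chosen so that each of its
  neighbourhoods meets the transported set in a non-null set, which leaves room to keep the images
  inside the disk.\<close>

definition koebe_const :: real where
  "koebe_const = 1 + (exp (pi * exp (pi * (2 + 2 * 1 + 12 * (2/3) / (1 - 2/3)))))\<^sup>2"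

lemma koebe_const_ge_1: "koebe_const \<ge> 1"
  unfolding koebe_const_def by simp

text \<open>The square root of \<open>1 - (F - F b) / (w - F b)\<close> never takes two opposite values, so it omits
  both \<open>0\<close> and \<open>-1\<close> and Schottky's theorem applies.\<close>
lemma univalent_omitting_bound:
  fixes F :: "complex \<Rightarrow> complex"
  assumes hol: "F holomorphic_on ball b R" and inj: "inj_on F (ball b R)" and R: "R > 0"
    and w: "w \<notin> F ` ball b R" and x: "dist b x \<le> R/2"
  shows "cmod (F x - F b) \<le> koebe_const * cmod (w - F b)"
proof -
  have bb: "b \<in> ball b R" using R by simp
  have wb: "w \<noteq> F b" using w bb by blast
  define H where "H = (\<lambda>z. 1 - (F z - F b) / (w - F b))"
  have holH: "H holomorphic_on ball b R"
    unfolding H_def using wb by (intro holomorphic_intros hol) auto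
  have Hnz: "H z \<noteq> 0" if "z \<in> ball b R" for z
  proof
    assume "H z = 0"
    then have "F z = w" unfolding H_def using wb by (simp add: field_simps)
    then show False using w that by blast
  qed
  have Hinj: "inj_on H (ball b R)"
    using inj wb unfolding H_def inj_on_def by (auto simp: field_simps)
  obtain G where holG: "G holomorphic_on ball b R" and G: "\<And>z. z \<in> ball b R \<Longrightarrow> H z = G z ^ 2"
    using contractible_imp_holomorphic_sqrt[OF holH convex_imp_contractible[OF convex_ball] Hnz] by metis
  have Gb: "(G b)\<^sup>2 = 1" using G[OF bb] by (simp add: H_def)
  \<comment> \<open>Since \<open>G b\<close> is a sign, the factor \<open>- G b\<close> gives
    \<open>g 0 = -1\<close>, and \<open>g\<close> would be \<open>1\<close> exactly where
    \<open>G = - G b\<close>, the excluded opposite value. The radius \<open>3 * R / 4\<close> keeps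
    the closed unit disk inside the domain and turns \<open>R / 2\<close> into
    \<open>2 / 3\<close>.\<close>
  define g where "g = (\<lambda>u. - G b * G (b + of_real (3*R/4) * u))"
  have aff: "b + of_real (3*R/4) * u \<in> ball b R" if "u \<in> cball 0 1" for u :: complex
  proof -
    have "cmod (of_real (3*R/4) * u) = 3*R/4 * cmod u" using R by (simp add: norm_mult)
    also have "\<dots> \<le> 3*R/4" using that R by (simp add: mult_left_le)
    also have "\<dots> < R" using R by simp
    finally show ?thesis by (simp add: dist_norm)
  qed
  have holg: "g holomorphic_on cball 0 1"
    unfolding g_def
    by (intro holomorphic_intros holomorphic_on_compose_gen[OF _ holG, unfolded o_def]) (use aff in auto)
  have g0: "g 0 = -1" using Gb by (simp add: g_def power2_eq_square)
  have not01: "\<not> (g u = 0 \<or> g u = 1)" if u: "u \<in> cball 0 1" for u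
  proof -
    let ?y = "b + of_real (3*R/4) * u"
    have y: "?y \<in> ball b R" using aff[OF u] .
    have "G ?y \<noteq> 0" using Hnz[OF y] G[OF y] by auto
    moreover have "G b \<noteq> 0" using Gb by auto
    moreover have "g u \<noteq> 1"
    proof
      assume g1: "g u = 1"
      then have e: "G b * G ?y = -1" by (simp add: g_def) (metis minus_minus)
      have "(G b * G ?y)\<^sup>2 = 1" using e by simp
      then have "H ?y = H b" using G[OF y] G[OF bb] Gb by (simp add: power_mult_distrib)
      then have "?y = b" using Hinj y bb by (auto dest: inj_onD)
      then have "(G b)\<^sup>2 = -1" using e by (metis power2_eq_square)
      then show False using Gb by simp
    qed
    ultimately show ?thesis by (simp add: g_def)
  qed
  define u where "u = (x - b) / of_real (3*R/4)"
  have u: "cmod u \<le> 2/3"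
  proof -
    have "cmod u = cmod (b - x) / (3*R/4)" 
      unfolding u_def norm_divide norm_of_real using R by (subst norm_minus_commute) simp
    also have "\<dots> \<le> (R/2) / (3*R/4)" using x R by (intro divide_right_mono) (auto simp: dist_norm)
    finally show ?thesis using R by simp
  qed
  have nz: "complex_of_real (3*R/4) \<noteq> 0" using R by simp
  have ub: "b + of_real (3*R/4) * u = x"
    unfolding u_def times_divide_eq_right nonzero_mult_div_cancel_left[OF nz] by simp
  \<comment> \<open>Schottky's bound for initial modulus at most \<open>1\<close> on the disk of
    radius \<open>2/3\<close>. \<open>koebe_const\<close> is one plus its square because
    \<open>H\<close> is the square of \<open>G\<close>.\<close>
  have "cmod (g u) \<le> exp (pi * exp (pi * (2 + 2 * 1 + 12 * (2/3) / (1 - 2/3))))"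
    by (rule Schottky[OF holg _ not01]) (use g0 u in auto)
  moreover have "cmod (g u) = cmod (G x)"
  proof -
    have "cmod (G b) ^ 2 = 1" using Gb by (metis norm_one norm_power)
    then have "cmod (G b) = 1" using norm_ge_zero[of "G b"] by (auto simp: power2_eq_1_iff)
    then show ?thesis unfolding g_def ub by (simp add: norm_mult)
  qed
  ultimately have "cmod (G x) \<le> exp (pi * exp (pi * (2 + 2 * 1 + 12 * (2/3) / (1 - 2/3))))" by simp
  then have Gx: "(cmod (G x))\<^sup>2 \<le> (exp (pi * exp (pi * (2 + 2 * 1 + 12 * (2/3) / (1 - 2/3)))))\<^sup>2"
    by (intro power_mono) auto
  have xin: "x \<in> ball b R" using x R by simp
  have "(F x - F b) / (w - F b) = 1 - (G x)\<^sup>2"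
    using G[OF xin] by (simp add: H_def algebra_simps)
  then have "cmod ((F x - F b) / (w - F b)) \<le> 1 + (cmod (G x))\<^sup>2"
    by (metis norm_one norm_power norm_triangle_ineq4)
  also have "\<dots> \<le> koebe_const" using Gx by (simp add: koebe_const_def)
  finally show ?thesis using wb by (simp add: norm_divide field_simps)
qed

section \<open>Distortion bounds for univalent maps\<close>

lemma deriv_bound_on_sphere:
  assumes hol: "F holomorphic_on cball a r" and r: "r > 0"
    and bound: "\<And>x. cmod (a - x) = r \<Longrightarrow> cmod (F x - c) \<le> M"
  shows "cmod (deriv F a) \<le> M / r"
proof -
  have holb: "F holomorphic_on ball a r" using hol ball_subset_cball holomorphic_on_subset by blast
  have "cmod ((deriv ^^ 1) (\<lambda>z. F z - c) a) \<le> fact 1 * M / r ^ 1"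
    by (rule Cauchy_inequality[OF _ _ r bound])
       (intro holomorphic_intros continuous_intros holomorphic_on_imp_continuous_on holb hol)+
  moreover have "F field_differentiable at a"
    using holb r by (intro holomorphic_on_imp_differentiable_at[of _ "ball a r"]) auto
  ultimately show ?thesis by (simp add: deriv_diff)
qed

text \<open>Cauchy's estimate on the circle of radius \<open>R/2\<close>, fed with the growth bound
  relative to the omitted value. Its contrapositive is a quarter theorem with a worse
  constant.\<close>

lemma univalent_omitting_deriv_bound:
  assumes hol: "F holomorphic_on ball b R" and inj: "inj_on F (ball b R)" and R: "R > 0"
    and w: "w \<notin> F ` ball b R"
  shows "cmod (deriv F b) * R \<le> 4 * koebe_const * cmod (w - F b)"
proof -
  let ?M = "koebe_const * cmod (w - F b)"
  have sub: "cball b (R/2) \<subseteq> ball b R" using R by auto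
  have "cmod (deriv F b) \<le> ?M / (R/2)"
  proof (rule deriv_bound_on_sphere)
    show "F holomorphic_on cball b (R/2)" by (rule holomorphic_on_subset[OF hol sub])
    show "0 < R/2" using R by simp
    show "cmod (F x - F b) \<le> ?M" if "cmod (b - x) = R/2" for x
      by (rule univalent_omitting_bound[OF hol inj R w]) (use that in \<open>simp add: dist_norm\<close>)
  qed
  then have "cmod (deriv F b) * R \<le> 2 * ?M" using R by (simp add: field_simps)
  moreover have "0 \<le> ?M" using koebe_const_ge_1 by simp
  ultimately show ?thesis by linarith
qed

theorem koebe_quarter_weak:
  assumes "F holomorphic_on ball b R" "inj_on F (ball b R)" "R > 0"
  shows "ball (F b) (cmod (deriv F b) * R / (4 * koebe_const)) \<subseteq> F ` ball b R"
proof
  fix w assume "w \<in> ball (F b) (cmod (deriv F b) * R / (4 * koebe_const))"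
  then have "4 * koebe_const * cmod (w - F b) < cmod (deriv F b) * R"
    using koebe_const_ge_1 by (simp add: dist_norm norm_minus_commute field_simps)
  then show "w \<in> F ` ball b R" using univalent_omitting_deriv_bound[OF assms] by force
qed

text \<open>The counterpart of the covering bound. If \<open>F\<close> covered the closed disk of
  radius \<open>2 * R * cmod (deriv F b)\<close> about \<open>F b\<close>, its inverse would map
  that disk into \<open>ball b R\<close>, and Cauchy's estimate would give the inverse a derivative
  at \<open>F b\<close> at most half as large as the chain rule requires.\<close>

lemma univalent_omits_nearby:
  assumes hol: "F holomorphic_on ball b R" and inj: "inj_on F (ball b R)" and R: "R > 0"
  shows "\<exists>w. w \<notin> F ` ball b R \<and> cmod (w - F b) \<le> 2 * R * cmod (deriv F b)"
proof (rule ccontr)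
  assume "\<not> ?thesis"
  then have all: "\<And>w. cmod (w - F b) \<le> 2 * R * cmod (deriv F b) \<Longrightarrow> w \<in> F ` ball b R" by blast
  let ?\<rho> = "2 * R * cmod (deriv F b)"
  obtain g where g: "g holomorphic_on (F ` ball b R)"
      and dg: "\<And>z. z \<in> ball b R \<Longrightarrow> deriv F z * deriv g (F z) = 1"
      and gF: "\<And>z. z \<in> ball b R \<Longrightarrow> g (F z) = z"
    using holomorphic_has_inverse[OF hol open_ball inj] by metis
  have d1: "deriv F b * deriv g (F b) = 1" using dg R by simp
  then have nz: "deriv F b \<noteq> 0" by auto
  have \<rho>: "?\<rho> > 0" using R nz by simp
  have sub: "cball (F b) ?\<rho> \<subseteq> F ` ball b R" using all by (auto simp: dist_norm norm_minus_commute)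
  have "cmod (deriv g (F b)) \<le> R / ?\<rho>"
  proof (rule deriv_bound_on_sphere[OF holomorphic_on_subset[OF g sub] \<rho>])
    show "cmod (g x - b) \<le> R" if "cmod (F b - x) = ?\<rho>" for x
    proof -
      have "x \<in> F ` ball b R" using sub that by (auto simp: dist_norm)
      then show ?thesis using gF by (auto simp: dist_norm norm_minus_commute intro!: less_imp_le)
    qed
  qed
  then have "cmod (deriv g (F b)) \<le> 1 / (2 * cmod (deriv F b))"
    using R by simp
  then have "cmod (deriv F b) * cmod (deriv g (F b)) \<le> 1/2"
    using nz by (simp add: field_simps)
  moreover have "cmod (deriv F b) * cmod (deriv g (F b)) = 1"
    using d1 by (metis norm_mult norm_one)
  ultimately show False by simp
qed

lemma univalent_growth:
  assumes "F holomorphic_on ball b R" "inj_on F (ball b R)" "R > 0" "dist b x \<le> R/2"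
  shows "cmod (F x - F b) \<le> 2 * koebe_const * R * cmod (deriv F b)"
proof -
  obtain w where w: "w \<notin> F ` ball b R" "cmod (w - F b) \<le> 2 * R * cmod (deriv F b)"
    using univalent_omits_nearby[OF assms(1-3)] by blast
  have "cmod (F x - F b) \<le> koebe_const * cmod (w - F b)"
    by (rule univalent_omitting_bound[OF assms(1-3) w(1) assms(4)])
  also have "\<dots> \<le> koebe_const * (2 * R * cmod (deriv F b))"
    using w(2) koebe_const_ge_1 by (intro mult_left_mono) auto
  finally show ?thesis by (simp add: mult_ac)
qed

text \<open>The product of the derivative distortion factor \<open>8 * koebe_const\<close> and the
  factor \<open>4 * koebe_const\<close> of the omitted-value bound, as they meet in
  \<open>univalent_lower_lipschitz\<close>. It also dominates the upper Lipschitz factor.\<close>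

definition dist_const :: real where "dist_const = 32 * koebe_const ^ 2"

lemma dist_const_ge: "dist_const \<ge> 8 * koebe_const" "dist_const \<ge> 1"
proof -
  have "koebe_const ^ 2 \<ge> koebe_const" using koebe_const_ge_1 by (simp add: power2_eq_square)
  then show "dist_const \<ge> 8 * koebe_const" "dist_const \<ge> 1"
    using koebe_const_ge_1 unfolding dist_const_def by linarith+
qed

lemma univalent_deriv_le:
  assumes hol: "F holomorphic_on ball b R" and inj: "inj_on F (ball b R)" and R: "R > 0"
    and x: "dist b x \<le> R/4"
  shows "cmod (deriv F x) \<le> 8 * koebe_const * cmod (deriv F b)"
proof -
  let ?M = "2 * koebe_const * R * cmod (deriv F b)"
  have sub: "cball x (R/4) \<subseteq> cball b (R/2)"
  proof
    fix y assume "y \<in> cball x (R/4)"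
    then show "y \<in> cball b (R/2)" using x dist_triangle[of b y x] by simp
  qed
  have sub2: "cball b (R/2) \<subseteq> ball b R" using R by auto
  have "cmod (deriv F x) \<le> ?M / (R/4)"
  proof (rule deriv_bound_on_sphere)
    show "F holomorphic_on cball x (R/4)" by (rule holomorphic_on_subset[OF hol order_trans[OF sub sub2]])
    show "0 < R/4" using R by simp
    show "cmod (F y - F b) \<le> ?M" if "cmod (x - y) = R/4" for y
    proof -
      have "y \<in> cball x (R/4)" using that by (simp add: dist_norm)
      then show ?thesis using sub by (intro univalent_growth[OF hol inj R]) auto
    qed
  qed
  then show ?thesis using R by (simp add: field_simps)
qed

text \<open>The upper bound with the roles of \<open>b\<close> and \<open>x\<close> exchanged:
  \<open>F\<close> is univalent on \<open>ball x (R/2)\<close>, and \<open>R/8\<close> is a quarter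
  of that radius.\<close>

lemma univalent_deriv_ge:
  assumes hol: "F holomorphic_on ball b R" and inj: "inj_on F (ball b R)" and R: "R > 0"
    and x: "dist b x \<le> R/8"
  shows "cmod (deriv F b) \<le> 8 * koebe_const * cmod (deriv F x)"
proof -
  have sub: "ball x (R/2) \<subseteq> ball b R"
  proof
    fix y assume "y \<in> ball x (R/2)"
    then show "y \<in> ball b R" using x R dist_triangle[of b y x] by simp
  qed
  show ?thesis
    by (rule univalent_deriv_le[of _ _ "R/2"])
       (use holomorphic_on_subset[OF hol sub] inj_on_subset[OF inj sub] R x in \<open>auto simp: dist_commute\<close>)
qed

lemma univalent_lipschitz:
  assumes hol: "F holomorphic_on ball b R" and inj: "inj_on F (ball b R)" and R: "R > 0"
    and x: "dist b x \<le> R/4" and y: "dist b y \<le> R/4"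
  shows "cmod (F x - F y) \<le> dist_const * cmod (deriv F b) * cmod (x - y)"
proof -
  have "cmod (F x - F y) \<le> (8 * koebe_const * cmod (deriv F b)) * cmod (x - y)"
  proof (rule field_differentiable_bound[OF convex_cball[of b "R/4"]])
    fix z assume z: "z \<in> cball b (R/4)"
    then have "z \<in> ball b R" using R by simp
    then have "F field_differentiable at z"
      using hol by (intro holomorphic_on_imp_differentiable_at[of _ "ball b R"]) auto
    then show "(F has_field_derivative deriv F z) (at z within cball b (R/4))"
      using DERIV_deriv_iff_field_differentiable has_field_derivative_at_within by blast
    show "cmod (deriv F z) \<le> 8 * koebe_const * cmod (deriv F b)"
      using univalent_deriv_le[OF hol inj R] z by simp
  qed (use x y in auto)
  also have "\<dots> \<le> dist_const * cmod (deriv F b) * cmod (x - y)"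
    using dist_const_ge by (intro mult_right_mono) auto
  finally show ?thesis .
qed

text \<open>By injectivity \<open>F y\<close> is omitted by \<open>F\<close> on the ball about
  \<open>x\<close> of radius \<open>cmod (x - y)\<close>, so the omitted-value bound at that scale
  is already the desired estimate, with the derivative at \<open>x\<close> in place of
  \<open>b\<close>.\<close>

lemma univalent_lower_lipschitz:
  assumes hol: "F holomorphic_on ball b R" and inj: "inj_on F (ball b R)" and R: "R > 0"
    and x: "dist b x \<le> R/8" and y: "dist b y \<le> R/8"
  shows "cmod (deriv F b) * cmod (x - y) \<le> dist_const * cmod (F x - F y)"
proof (cases "x = y")
  case False
  let ?\<rho> = "cmod (x - y)"
  have \<rho>: "?\<rho> > 0" using False by simp
  have "?\<rho> \<le> R/4" using x y norm_triangle_ineq4[of "x - b" "y - b"] by (simp add: dist_norm norm_minus_commute)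
  have sub: "ball x ?\<rho> \<subseteq> ball b R"
  proof
    fix z assume "z \<in> ball x ?\<rho>"
    then show "z \<in> ball b R" using x R \<open>?\<rho> \<le> R/4\<close> dist_triangle[of b z x] by simp
  qed
  have "F y \<notin> F ` ball x ?\<rho>"
  proof
    assume "F y \<in> F ` ball x ?\<rho>"
    then obtain z where z: "z \<in> ball x ?\<rho>" "F y = F z" by auto
    moreover have "y \<in> ball b R" using y R by simp
    ultimately have "y = z" using inj_onD[OF inj z(2)] sub by blast
    then show False using z by (simp add: dist_norm)
  qed
  from univalent_omitting_deriv_bound[OF holomorphic_on_subset[OF hol sub] inj_on_subset[OF inj sub] \<rho> this]
  have *: "cmod (deriv F x) * ?\<rho> \<le> 4 * koebe_const * cmod (F x - F y)" by (simp add: norm_minus_commute)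
  have "cmod (deriv F b) * ?\<rho> \<le> (8 * koebe_const) * (cmod (deriv F x) * ?\<rho>)"
    using univalent_deriv_ge[OF hol inj R x] \<rho> by (simp add: mult.assoc[symmetric])
  also have "\<dots> \<le> (8 * koebe_const) * (4 * koebe_const * cmod (F x - F y))"
    using * koebe_const_ge_1 by (intro mult_left_mono) auto
  also have "\<dots> \<le> dist_const * cmod (F x - F y)"
    by (simp add: dist_const_def power2_eq_square mult_right_mono)
  finally show ?thesis .
qed auto

text \<open>The distortion factor does not depend on the radius, so comparing the derivatives at
  \<open>z\<close> and \<open>0\<close> on ever larger disks bounds \<open>deriv f\<close> on the
  whole plane, and Liouville's theorem applies to it.\<close>

lemma injective_entire_affine:
  assumes hol: "f holomorphic_on UNIV" and inj: "inj f"
  shows "\<exists>a b. \<forall>z. f z = a * z + b"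
proof -
  have bd: "cmod (deriv f z) \<le> 8 * koebe_const * cmod (deriv f 0)" for z
    by (rule univalent_deriv_le[of _ _ "4 * cmod z + 1"])
       (use holomorphic_on_subset[OF hol] inj_on_subset[OF inj] in \<open>auto simp: dist_norm add_nonneg_pos\<close>)
  have "deriv f holomorphic_on UNIV" using hol by (intro holomorphic_deriv) auto
  then obtain a where a: "\<And>z. deriv f z = a"
    using Liouville_theorem[of "deriv f"] bd unfolding bounded_iff constant_on_def by (metis UNIV_I rangeE)
  have "((\<lambda>z. f z - a * z) has_field_derivative 0) (at z)" for z
  proof -
    have "(f has_field_derivative a) (at z)"
      using a hol by (metis UNIV_I holomorphic_derivI open_UNIV)
    from DERIV_diff[OF this DERIV_cmult[OF DERIV_ident, of a]] show ?thesis by simp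
  qed
  then have "\<exists>c. \<forall>z\<in>UNIV. f z - a * z = c"
    by (intro has_field_derivative_zero_constant) auto
  then obtain c where "\<And>z. f z - a * z = c" by auto
  then have "\<forall>z. f z = a * z + c" by (simp add: algebra_simps)
  then show ?thesis by blast
qed

subsection \<open>The chordal metric and iterates\<close>

text \<open>Stereographic projection to the unit sphere of \<open>complex \<times> real\<close>. It
  turns \<open>chordal\<close> into a Euclidean distance, from which the triangle inequality,
  continuity and Arzela-Ascoli are inherited.\<close>

fun stereo :: "complex option \<Rightarrow> complex \<times> real" where
  "stereo (Some z) = (2 * z / of_real (1 + (cmod z)\<^sup>2), ((cmod z)\<^sup>2 - 1) / (1 + (cmod z)\<^sup>2))"
| "stereo None = (0, 1)"

lemma one_plus_cmod_sq_pos: "1 + (cmod z)\<^sup>2 > 0" "1 + (cmod z)\<^sup>2 \<noteq> 0"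
  by (smt (verit) zero_le_power2)+

lemma continuous_on_stereo_Some: "continuous_on S (\<lambda>u. stereo (Some u))"
proof -
  have "complex_of_real (1 + (cmod x)\<^sup>2) \<noteq> 0" for x
    by (metis of_real_eq_0_iff one_plus_cmod_sq_pos(2))
  then show ?thesis
    unfolding stereo.simps by (intro continuous_intros ballI one_plus_cmod_sq_pos(2))
qed

lemma isCont_stereo_Some: "isCont (\<lambda>u. stereo (Some u)) z"
  using continuous_on_stereo_Some[of UNIV] continuous_on_eq_continuous_at[of UNIV] by auto

lemma chordal_eq_dist_Some:
  "chordal (Some z) (Some w) = dist (stereo (Some z)) (stereo (Some w))"
proof -
  define A where "A = 1 + (cmod z)\<^sup>2"
  define B where "B = 1 + (cmod w)\<^sup>2"
  have A: "A > 0" and B: "B > 0" using one_plus_cmod_sq_pos unfolding A_def B_def by auto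
  \<comment> \<open>After the denominators \<open>A\<close> and \<open>B\<close> are cleared, the
    squared Euclidean distance of the projections is four times the left side over
    \<open>(A * B)\<close> squared; the identity cancels one factor \<open>A * B\<close>.\<close>
  have key: "(Re z * B - Re w * A)\<^sup>2 + (Im z * B - Im w * A)\<^sup>2 + (B - A)\<^sup>2
      = (cmod (z - w))\<^sup>2 * (A * B)"
    unfolding A_def B_def cmod_power2 minus_complex.sel by algebra
  have s: "(cmod z)\<^sup>2 - 1 = A - 2" "(cmod w)\<^sup>2 - 1 = B - 2" unfolding A_def B_def by auto
  have d1: "2 * z / of_real A - 2 * w / of_real B = (2 / of_real (A * B)) * (z * of_real B - w * of_real A)"
    using A B by (simp add: field_simps)
  have "(cmod (2 * z / of_real A - 2 * w / of_real B))\<^sup>2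
      = 4 * ((Re z * B - Re w * A)\<^sup>2 + (Im z * B - Im w * A)\<^sup>2) / (A*B)\<^sup>2"
    unfolding d1 norm_mult power_mult_distrib cmod_power2[of "z * _ - _"]
    using A B by (simp add: norm_divide power_divide norm_mult power_mult_distrib)
  moreover have "(A - 2) / A - (B - 2) / B = 2 * (A - B) / (A * B)"
    using A B by (simp add: field_simps)
  then have "((A - 2) / A - (B - 2) / B)\<^sup>2 = 4 * (B - A)\<^sup>2 / (A*B)\<^sup>2"
    by (simp only: power_divide power_mult_distrib power2_commute[of A B]) simp
  ultimately have "(dist (stereo (Some z)) (stereo (Some w)))\<^sup>2
      = 4 * ((Re z * B - Re w * A)\<^sup>2 + (Im z * B - Im w * A)\<^sup>2 + (B - A)\<^sup>2) / (A*B)\<^sup>2"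
    by (simp add: dist_prod_def dist_norm s flip: A_def B_def)
       (simp add: add_divide_distrib ring_distribs)
  also have "\<dots> = 4 * (cmod (z - w))\<^sup>2 / (A * B)"
    unfolding key using A B by (simp add: power2_eq_square)
  also have "\<dots> = (chordal (Some z) (Some w))\<^sup>2"
    using A B by (simp add: power_divide power_mult_distrib flip: A_def B_def)
  finally show ?thesis
    using A B by (metis A_def B_def chordal.simps(1) power2_eq_iff_nonneg zero_le_dist divide_nonneg_nonneg
        mult_nonneg_nonneg norm_ge_zero real_sqrt_ge_zero less_imp_le zero_le_numeral)
qed

lemma chordal_eq_dist_None: "chordal (Some z) None = dist (stereo (Some z)) (stereo None)"
proof -
  define A where "A = 1 + (cmod z)\<^sup>2"
  have A: "A > 0" using one_plus_cmod_sq_pos unfolding A_def by auto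
  have s: "(cmod z)\<^sup>2 - 1 = A - 2" unfolding A_def by auto
  have "(cmod (2 * z / of_real A))\<^sup>2 = 4 * (A - 1) / A\<^sup>2"
    using A unfolding norm_divide norm_mult power_divide power_mult_distrib norm_of_real by (simp add: A_def)
  moreover have "((A - 2) / A - 1)\<^sup>2 = 4 / A\<^sup>2"
  proof -
    have "(A - 2) / A - 1 = - 2 / A" using A by (simp add: field_simps)
    then show ?thesis by (simp add: power_divide)
  qed
  moreover have "(dist (stereo (Some z)) (stereo None))\<^sup>2
      = (cmod (2 * z / of_real A))\<^sup>2 + ((A - 2) / A - 1)\<^sup>2"
    unfolding stereo.simps A_def[symmetric] s dist_prod_def fst_conv snd_conv dist_norm
    by (subst real_sqrt_pow2) auto
  ultimately have "(dist (stereo (Some z)) (stereo None))\<^sup>2 = 4 * (A - 1) / A\<^sup>2 + 4 / A\<^sup>2" by simp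
  also have "\<dots> = 4 / A" using A by (simp add: field_simps power2_eq_square)
  also have "\<dots> = (chordal (Some z) None)\<^sup>2"
    using A by (simp add: power_divide flip: A_def)
  finally show ?thesis
    using A by (metis A_def chordal.simps(2) power2_eq_iff_nonneg zero_le_dist divide_nonneg_nonneg
        real_sqrt_ge_zero less_imp_le zero_le_numeral)
qed

theorem chordal_eq_dist: "chordal p q = dist (stereo p) (stereo q)"
proof (cases p; cases q)
  fix z assume "p = None" "q = Some z"
  then show ?thesis using chordal_eq_dist_None[of z] by (simp only: chordal.simps dist_commute)
qed (simp_all only: chordal_eq_dist_Some chordal_eq_dist_None chordal.simps dist_self)

lemma chordal_commute: "chordal p q = chordal q p"
  and chordal_nonneg: "chordal p q \<ge> 0"
  and chordal_triangle: "chordal p r \<le> chordal p q + chordal q r"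
  and chordal_self: "chordal p p = 0"
  unfolding chordal_eq_dist by (auto simp: dist_commute dist_triangle)

lemma norm_stereo: "norm (stereo p) = 1"
proof (cases p)
  case (Some z)
  define A where "A = 1 + (cmod z)\<^sup>2"
  have A: "A > 0" using one_plus_cmod_sq_pos unfolding A_def by auto
  have s: "(cmod z)\<^sup>2 = A - 1" unfolding A_def by auto
  have "(cmod (2 * z / of_real A))\<^sup>2 = 4 * (A - 1) / A\<^sup>2"
    using A unfolding norm_divide norm_mult power_divide power_mult_distrib norm_of_real by (simp add: A_def)
  moreover have "(norm (stereo p))\<^sup>2 = (cmod (2 * z / of_real A))\<^sup>2 + ((A - 2) / A)\<^sup>2"
    by (simp add: Some norm_prod_def s power_divide flip: A_def)
  ultimately have "(norm (stereo p))\<^sup>2 = 4 * (A - 1) / A\<^sup>2 + ((A - 2) / A)\<^sup>2" by simp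
  also have "\<dots> = 1" using A by (simp add: field_simps power2_eq_square)
  finally show ?thesis using norm_ge_zero[of "stereo p"] by (auto simp: power2_eq_1_iff)
qed (simp add: norm_Pair)

lemma chordal_le_2: "chordal p q \<le> 2"
  unfolding chordal_eq_dist dist_norm
  using norm_triangle_ineq4[of "stereo p" "stereo q"] by (simp add: norm_stereo)

text \<open>Lets a limit of sphere-valued maps, found in the ambient space, be read again as a map
  into the Riemann sphere.\<close>

lemma stereo_surj:
  assumes "norm p = 1" shows "\<exists>q. stereo q = p"
proof -
  obtain c s where p: "p = (c, s)" by (cases p)
  have 1: "(cmod c)\<^sup>2 = 1 - s\<^sup>2"
  proof -
    have "(norm p)\<^sup>2 = (cmod c)\<^sup>2 + s\<^sup>2" by (simp add: p norm_Pair)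
    then show ?thesis using assms by simp
  qed
  show ?thesis
  proof (cases "s = 1")
    case True
    then show ?thesis using 1 p by (intro exI[of _ None]) simp
  next
    case False
    have "s\<^sup>2 \<le> 1" using 1 by (smt (verit) zero_le_power2)
    then have s: "1 - s > 0" using False by (simp add: abs_square_le_1)
    let ?z = "c / of_real (1 - s)"
    have "(cmod ?z)\<^sup>2 = (1 - s\<^sup>2) / (1 - s)\<^sup>2"
      unfolding norm_divide power_divide 1 norm_of_real by simp
    also have "1 - s\<^sup>2 = (1 + s) * (1 - s)" by (simp add: algebra_simps power2_eq_square)
    also have "(1 + s) * (1 - s) / (1 - s)\<^sup>2 = (1 + s) / (1 - s)" using s by (simp add: power2_eq_square)
    finally have z: "(cmod ?z)\<^sup>2 = (1 + s) / (1 - s)" .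
    have z1: "1 + (cmod ?z)\<^sup>2 = 2 / (1 - s)" unfolding z using s by (simp add: field_simps)
    have nz: "complex_of_real (1 - s) \<noteq> 0" using s by (metis of_real_eq_0_iff less_irrefl)
    have "2 * ?z / of_real (2 / (1 - s)) = c"
      unfolding of_real_divide using nz by simp
    moreover have "((cmod ?z)\<^sup>2 - 1) / (2 / (1 - s)) = s" unfolding z using s by (simp add: field_simps)
    ultimately have "stereo (Some ?z) = p" unfolding stereo.simps z1 p by simp
    then show ?thesis by blast
  qed
qed

lemma chordal_Some_le: "chordal (Some z) (Some w) \<le> 2 * cmod (z - w)"
proof -
  have "(1 + (cmod z)\<^sup>2) * (1 + (cmod w)\<^sup>2) \<ge> 1 * 1" by (intro mult_mono) auto
  then have "sqrt ((1 + (cmod z)\<^sup>2) * (1 + (cmod w)\<^sup>2)) \<ge> 1" by simp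
  then show ?thesis
    unfolding chordal.simps using mult_right_mono[of 1 "sqrt ((1 + (cmod z)\<^sup>2) * (1 + (cmod w)\<^sup>2))" "2 * cmod (z - w)"]
    by (subst pos_divide_le_eq) (auto simp: mult.commute)
qed

lemma cmod_diff_le_chordal:
  assumes "cmod z \<le> M" "cmod w \<le> M"
  shows "2 * cmod (z - w) \<le> (1 + M\<^sup>2) * chordal (Some z) (Some w)"
proof -
  let ?s = "sqrt ((1 + (cmod z)\<^sup>2) * (1 + (cmod w)\<^sup>2))"
  have s0: "?s > 0" using one_plus_cmod_sq_pos by simp
  have "(1 + (cmod z)\<^sup>2) * (1 + (cmod w)\<^sup>2) \<le> (1 + M\<^sup>2) * (1 + M\<^sup>2)"
    using assms by (intro mult_mono add_mono power_mono) auto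
  then have "?s \<le> 1 + M\<^sup>2"
    by (intro real_le_lsqrt) (auto simp: power2_eq_square add_nonneg_nonneg)
  then have "chordal (Some z) (Some w) * ?s \<le> chordal (Some z) (Some w) * (1 + M\<^sup>2)"
    by (intro mult_left_mono chordal_nonneg)
  moreover have "chordal (Some z) (Some w) * ?s = 2 * cmod (z - w)"
    unfolding chordal.simps using s0 by (subst times_divide_eq_left) (rule nonzero_mult_div_cancel_right, use s0 in linarith)
  ultimately show ?thesis by (simp add: mult.commute)
qed

text \<open>Arzela-Ascoli after \<open>stereo\<close>: the maps have norm \<open>1\<close> and a
  common Lipschitz constant. The bound on the closed ball gives one convergent subsequence that
  serves all compact subsets of the open ball.\<close>

lemma normal_family_of_lipschitz:
  assumes "\<And>n x y. \<lbrakk>x \<in> cball z r; y \<in> cball z r\<rbrakk> \<Longrightarrow> chordal (F n x) (F n y) \<le> L * cmod (x - y)"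
  shows "normal_family (ball z r) F"
  unfolding normal_family_def
proof
  fix \<nu> :: "nat \<Rightarrow> nat"
  define G where "G = (\<lambda>j x. stereo (F (\<nu> j) x))"
  have lip: "norm (G n x - G n y) \<le> (\<bar>L\<bar> + 1) * cmod (x - y)" if "x \<in> cball z r" "y \<in> cball z r" for n x y
  proof -
    have "norm (G n x - G n y) \<le> L * cmod (x - y)"
      using assms[OF that, of "\<nu> n"] unfolding G_def chordal_eq_dist dist_norm .
    also have "\<dots> \<le> (\<bar>L\<bar> + 1) * cmod (x - y)" by (intro mult_right_mono) auto
    finally show ?thesis .
  qed
  obtain g0 k where k: "strict_mono (k :: nat \<Rightarrow> nat)"
    and conv: "\<And>e. 0 < e \<Longrightarrow> \<exists>N. \<forall>n x. n \<ge> N \<and> x \<in> cball z r \<longrightarrow> norm (G (k n) x - g0 x) < e"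
  proof (rule Arzela_Ascoli[of "cball z r" G 1])
    show "norm (G n x) \<le> 1" for n x by (simp add: G_def norm_stereo)
    fix x e assume x: "x \<in> cball z r" and e: "(0::real) < e"
    show "\<exists>d. 0 < d \<and> (\<forall>n y. y \<in> cball z r \<and> norm (x - y) < d \<longrightarrow> norm (G n x - G n y) < e)"
    proof (intro exI[of _ "e / (\<bar>L\<bar> + 1)"] conjI allI impI)
      show "0 < e / (\<bar>L\<bar> + 1)" using e by (simp add: add_nonneg_pos)
      fix n y assume y: "y \<in> cball z r \<and> norm (x - y) < e / (\<bar>L\<bar> + 1)"
      then have "norm (x - y) * (\<bar>L\<bar> + 1) < e" by (subst (asm) pos_less_divide_eq) auto
      then show "norm (G n x - G n y) < e" using lip[OF x, of y n] y by (simp add: mult.commute)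
    qed
  qed auto
  have "norm (g0 x) = 1" if x: "x \<in> cball z r" for x
  proof -
    have "(\<lambda>n. G (k n) x) \<longlonglongrightarrow> g0 x"
      unfolding LIMSEQ_iff using conv x by meson
    from tendsto_norm[OF this] show ?thesis by (simp add: G_def norm_stereo LIMSEQ_const_iff)
  qed
  then obtain g where g: "\<And>x. x \<in> cball z r \<Longrightarrow> stereo (g x) = g0 x"
    using stereo_surj[of "g0 _"] by (metis (no_types, lifting))
  have "\<forall>\<^sub>F j in sequentially. \<forall>w\<in>K. chordal (F (\<nu> (k j)) w) (g w) < \<epsilon>"
    if K: "compact K \<and> K \<subseteq> ball z r" and "\<epsilon> > 0" for K \<epsilon>
  proof -
    obtain N where N: "\<And>n x. n \<ge> N \<Longrightarrow> x \<in> cball z r \<Longrightarrow> norm (G (k n) x - g0 x) < \<epsilon>"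
      using conv[OF \<open>\<epsilon> > 0\<close>] by blast
    have "\<forall>w\<in>K. chordal (F (\<nu> (k j)) w) (g w) < \<epsilon>" if "j \<ge> N" for j
    proof
      fix w assume "w \<in> K"
      then have w: "w \<in> cball z r" using K ball_subset_cball by blast
      show "chordal (F (\<nu> (k j)) w) (g w) < \<epsilon>"
        using N[OF that w] unfolding chordal_eq_dist dist_norm g[OF w] G_def .
    qed
    then show ?thesis unfolding eventually_sequentially by blast
  qed
  then show "\<exists>r' g. strict_mono r' \<and> (\<forall>K. compact K \<and> K \<subseteq> ball z r \<longrightarrow>
      (\<forall>\<epsilon>>0. \<forall>\<^sub>F j in sequentially. \<forall>w\<in>K. chordal (F (\<nu> (r' j)) w) (g w) < \<epsilon>))"
    using k by blast
qed

text \<open>Unlike \<open>iter_dom f n\<close>, which allows the last value to be infinity, this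
  also excludes a pole at time \<open>n - 1\<close>. Because \<open>f\<close> has the default value
  \<open>0\<close> at poles, \<open>f ^^ n\<close> is the true iterate only on this set, and there
  it is holomorphic.\<close>

definition regular_upto :: "(complex \<Rightarrow> complex) \<Rightarrow> nat \<Rightarrow> complex \<Rightarrow> bool" where
  "regular_upto f n z \<longleftrightarrow> (\<forall>k<n. \<not> is_pole f ((f ^^ k) z))"

lemma iter_dom_iff: "z \<in> iter_dom f (Suc n) \<longleftrightarrow> regular_upto f n z"
  by (auto simp: iter_dom_def regular_upto_def)

lemma iter_dom_0 [simp]: "iter_dom f 0 = UNIV" by (simp add: iter_dom_def)

lemma regular_upto_mono: "regular_upto f n z \<Longrightarrow> m \<le> n \<Longrightarrow> regular_upto f m z"
  by (simp add: regular_upto_def)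

lemma regular_upto_add: "regular_upto f (m + n) z \<longleftrightarrow> regular_upto f m z \<and> regular_upto f n ((f ^^ m) z)"
proof -
  have "(f ^^ k) ((f ^^ m) z) = (f ^^ (m + k)) z" for k
    by (simp add: funpow_add[of k m] add.commute[of m k])
  moreover have "(\<forall>k<m + n. P k) \<longleftrightarrow> (\<forall>k<m. P k) \<and> (\<forall>k<n. P (m + k))" for P
    by (metis add_diff_inverse_nat nat_add_left_cancel_less not_less trans_less_add1)
  ultimately show ?thesis unfolding regular_upto_def by simp
qed

lemma iter_val_regular: "regular_upto f n z \<Longrightarrow> iter_val f n z = Some ((f ^^ n) z)"
  by (cases n) (auto simp: iter_val_def ext_val_def regular_upto_def)

lemma regular_of_iter_val:
  assumes "z \<in> iter_dom f n" "iter_val f n z = Some w"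
  shows "regular_upto f n z \<and> (f ^^ n) z = w"
proof (cases n)
  case (Suc m)
  have "regular_upto f m z" using assms(1) by (simp add: Suc iter_dom_iff)
  moreover have "\<not> is_pole f ((f ^^ m) z)" "f ((f ^^ m) z) = w"
    using assms(2) by (auto simp: Suc iter_val_def ext_val_def split: if_splits)
  ultimately show ?thesis by (auto simp: Suc regular_upto_def less_Suc_eq)
qed (use assms in \<open>auto simp: iter_val_def regular_upto_def\<close>)

section \<open>Holomorphy and chain rule for iterates away from poles\<close>

locale meromorphic_map =
  fixes f :: "complex \<Rightarrow> complex"
  assumes nicely_meromorphic: "f nicely_meromorphic_on UNIV"
begin

lemma analytic_off_poles: "\<not> is_pole f z \<Longrightarrow> f analytic_on {z}"
  by (rule nicely_meromorphic_on_imp_analytic_at[OF nicely_meromorphic]) auto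

lemma open_nonpoles: "open {z. \<not> is_pole f z}"
proof (subst open_contains_ball, safe)
  fix z assume "\<not> is_pole f z"
  then obtain e where e: "e > 0" "f holomorphic_on ball z e"
    using analytic_off_poles analytic_at_ball by blast
  have "ball z e \<subseteq> {z. \<not> is_pole f z}"
    using e not_is_pole_holomorphic[OF open_ball _ e(2)] by blast
  then show "\<exists>e>0. ball z e \<subseteq> {z. \<not> is_pole f z}" using e by blast
qed

lemma analytic_at_regular: "regular_upto f n z \<Longrightarrow> (f ^^ n) analytic_on {z}"
proof (induction n)
  case 0
  then show ?case by (simp add: id_def)
next
  case (Suc n)
  then have "(f ^^ n) analytic_on {z}" and "\<not> is_pole f ((f ^^ n) z)"
    by (auto simp: regular_upto_def)
  then have "f \<circ> (f ^^ n) analytic_on {z}"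
    using analytic_off_poles by (intro analytic_on_compose) auto
  then show ?case by (simp add: o_def)
qed

lemma open_regular: "open {z. regular_upto f n z}"
proof (induction n)
  case 0
  then show ?case by (simp add: regular_upto_def)
next
  case (Suc n)
  let ?S = "{z. regular_upto f n z}"
  have cont: "continuous_on ?S (f ^^ n)"
    by (intro holomorphic_on_imp_continuous_on analytic_imp_holomorphic)
       (subst analytic_on_analytic_at, use analytic_at_regular in auto)
  have "open (?S \<inter> (f ^^ n) -` {z. \<not> is_pole f z})"
    by (rule continuous_open_preimage[OF cont Suc open_nonpoles])
  also have "?S \<inter> (f ^^ n) -` {z. \<not> is_pole f z} = {z. regular_upto f (Suc n) z}"
    by (auto simp: regular_upto_def less_Suc_eq)
  finally show ?case .
qed

lemma holomorphic_regular:
  "(\<And>z. z \<in> S \<Longrightarrow> regular_upto f n z) \<Longrightarrow> (f ^^ n) holomorphic_on S"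
  by (intro analytic_imp_holomorphic) (subst analytic_on_analytic_at, use analytic_at_regular in auto)

lemma differentiable_regular:
  "regular_upto f n z \<Longrightarrow> ((f ^^ n) has_field_derivative deriv (f ^^ n) z) (at z)"
  using analytic_at_regular analytic_on_imp_differentiable_at DERIV_deriv_iff_field_differentiable by blast

lemma deriv_funpow_add:
  assumes "regular_upto f (m + n) z"
  shows "deriv (f ^^ (m + n)) z = deriv (f ^^ n) ((f ^^ m) z) * deriv (f ^^ m) z"
proof -
  have r: "regular_upto f m z" "regular_upto f n ((f ^^ m) z)" using assms regular_upto_add by auto
  have "((f ^^ n) \<circ> (f ^^ m) has_field_derivative deriv (f ^^ n) ((f ^^ m) z) * deriv (f ^^ m) z) (at z)"
    by (rule DERIV_chain[OF differentiable_regular[OF r(2)] differentiable_regular[OF r(1)]])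
  moreover have "(f ^^ n) \<circ> (f ^^ m) = f ^^ (m + n)" by (simp add: funpow_add[symmetric] add.commute)
  ultimately show ?thesis using DERIV_imp_deriv by metis
qed

text \<open>If the images of all iterates omit a point of a fixed disk, the Koebe bound makes the iterates
  uniformly Lipschitz for the chordal metric; otherwise \<open>f\<close> is injective on every disk.\<close>
lemma univalent_iterates_imp_fatou:
  assumes R: "R > 0" and reg: "\<And>n w. w \<in> ball z R \<Longrightarrow> regular_upto f n w"
    and inj: "\<And>n. inj_on (f ^^ n) (ball z R)"
    and nonlin: "\<not> (\<exists>a b. \<forall>z. f z = a * z + b)"
  shows "fatou_point f z"
proof -
  have hol: "(f ^^ n) holomorphic_on ball z R" for n
    by (rule holomorphic_regular) (rule reg)
  have "\<exists>\<rho>>0. \<forall>n. \<exists>w\<in>ball 0 \<rho>. w \<notin> (f ^^ n) ` ball z R"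
  proof (rule ccontr)
    assume "\<not> ?thesis"
    then have big: "\<And>\<rho>. \<rho> > 0 \<Longrightarrow> \<exists>n. ball 0 \<rho> \<subseteq> (f ^^ n) ` ball z R" by blast
    \<comment> \<open>Some iterate covers a disk containing \<open>w\<close>, and a preimage of
      \<open>w\<close> in \<open>ball z R\<close> stays regular for one more step.\<close>
    have "\<not> is_pole f w" for w
    proof -
      obtain n where "ball 0 (cmod w + 1) \<subseteq> (f ^^ n) ` ball z R"
        using big[of "cmod w + 1"] by (auto simp: add_nonneg_pos)
      moreover have "w \<in> ball 0 (cmod w + 1)" by simp
      ultimately obtain u where u: "u \<in> ball z R" "(f ^^ n) u = w" by blast
      then show ?thesis using reg[OF u(1), of "Suc n"] by (auto simp: regular_upto_def)
    qed
    then have "f analytic_on UNIV" using analytic_off_poles analytic_on_analytic_at by blast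
    then have entire: "f holomorphic_on UNIV" by (rule analytic_imp_holomorphic)
    \<comment> \<open>Injectivity of \<open>f ^^ Suc n\<close> on the disk passes to
      \<open>f\<close> on the image of \<open>f ^^ n\<close>, which contains both points for a
      suitable \<open>n\<close>.\<close>
    have "inj f"
    proof (rule injI)
      fix x y assume xy: "f x = f y"
      obtain n where n: "ball 0 (cmod x + cmod y + 1) \<subseteq> (f ^^ n) ` ball z R"
        using big[of "cmod x + cmod y + 1"] by (auto simp: add_nonneg_pos)
      have "x \<in> ball 0 (cmod x + cmod y + 1)" "y \<in> ball 0 (cmod x + cmod y + 1)"
        by (auto simp: add_nonneg_pos add.commute add_pos_nonneg)
      then obtain u v where uv: "u \<in> ball z R" "(f ^^ n) u = x" "v \<in> ball z R" "(f ^^ n) v = y"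
        using n by blast
      then have "(f ^^ Suc n) u = (f ^^ Suc n) v" using xy by simp
      then have "u = v" using inj[of "Suc n"] uv by (meson inj_onD)
      then show "x = y" using uv by simp
    qed
    then show False using injective_entire_affine[OF entire] nonlin by blast
  qed
  then obtain \<rho> where \<rho>: "\<rho> > 0" and omit: "\<And>n. \<exists>w\<in>ball 0 \<rho>. w \<notin> (f ^^ n) ` ball z R" by blast
  define D where "D = 8 * koebe_const / R"
  have D: "D \<ge> 0" using R koebe_const_ge_1 by (simp add: D_def)
  \<comment> \<open>Two points of \<open>cball z (R/16)\<close> are at distance at most
    \<open>R/8\<close>, the range in which \<open>univalent_lipschitz\<close> works on
    \<open>ball x (R/2)\<close>.\<close>
  have lip: "chordal (iter_val f n x) (iter_val f n y) \<le> (2 * dist_const * D * (\<rho> + 1)) * cmod (x - y)"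
    if x: "x \<in> cball z (R/16)" and y: "y \<in> cball z (R/16)" for n x y
  proof -
    let ?F = "f ^^ n"
    have sub: "ball x (R/2) \<subseteq> ball z R"
    proof
      fix u assume "u \<in> ball x (R/2)"
      then show "u \<in> ball z R" using x R dist_triangle[of z u x] by simp
    qed
    have R2: "R/2 > 0" using R by simp
    have hx: "?F holomorphic_on ball x (R/2)" and ix: "inj_on ?F (ball x (R/2))"
      using holomorphic_on_subset[OF hol sub] inj_on_subset[OF inj sub] by auto
    obtain w where w: "cmod w < \<rho>" "w \<notin> ?F ` ball z R" using omit[of n] by auto
    have "cmod (deriv ?F x) * (R/2) \<le> 4 * koebe_const * cmod (w - ?F x)"
      by (rule univalent_omitting_deriv_bound[OF hx ix R2]) (use w sub in blast)
    also have "\<dots> \<le> 4 * koebe_const * (\<rho> + cmod (?F x))"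
      using w norm_triangle_ineq4[of w "?F x"] koebe_const_ge_1 by (intro mult_left_mono) auto
    finally have dF: "cmod (deriv ?F x) \<le> D * (\<rho> + cmod (?F x))"
      using R by (simp add: D_def field_simps)
    have "dist x y \<le> R/8" using x y dist_triangle[of x y z] by (simp add: dist_commute)
    then have "cmod (?F x - ?F y) \<le> dist_const * cmod (deriv ?F x) * cmod (x - y)"
      using R by (intro univalent_lipschitz[OF hx ix R2]) auto
    also have "\<dots> \<le> dist_const * (D * (\<rho> + cmod (?F x))) * cmod (x - y)"
      using dF dist_const_ge by (intro mult_right_mono mult_left_mono) auto
    finally have F: "cmod (?F x - ?F y) \<le> dist_const * (D * (\<rho> + cmod (?F x))) * cmod (x - y)" .
    \<comment> \<open>The derivative bound grows with \<open>cmod (?F x)\<close>, but the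
      denominator \<open>?s * ?t\<close> of the chordal distance absorbs this growth; hence the
      constant does not depend on \<open>n\<close>.\<close>
    let ?s = "sqrt (1 + (cmod (?F x))\<^sup>2)" and ?t = "sqrt (1 + (cmod (?F y))\<^sup>2)"
    have s1: "1 \<le> ?s" "cmod (?F x) \<le> ?s" and t1: "1 \<le> ?t"
      by (auto simp: real_le_rsqrt)
    have "\<rho> + cmod (?F x) \<le> (\<rho> + 1) * ?s"
      using s1(2) \<rho> mult_left_mono[OF s1(1), of \<rho>] unfolding distrib_right by linarith
    also have "\<dots> \<le> (\<rho> + 1) * (?s * ?t)"
      using mult_left_mono[OF t1, of ?s] s1 \<rho> by (intro mult_left_mono) linarith+
    finally have st: "\<rho> + cmod (?F x) \<le> (\<rho> + 1) * (?s * ?t)" .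
    have "2 * cmod (?F x - ?F y) \<le> 2 * (dist_const * (D * ((\<rho> + 1) * (?s * ?t))) * cmod (x - y))"
      using F st D dist_const_ge
      by (intro mult_left_mono order_trans[OF F] mult_right_mono) auto
    also have "\<dots> = (2 * dist_const * D * (\<rho> + 1)) * cmod (x - y) * (?s * ?t)"
      by (simp add: mult_ac)
    finally have "2 * cmod (?F x - ?F y) / (?s * ?t) \<le> (2 * dist_const * D * (\<rho> + 1)) * cmod (x - y)"
      using mult_pos_pos[of ?s ?t] s1 t1 by (subst pos_divide_le_eq) linarith+
    moreover have "regular_upto f n x" "regular_upto f n y" using reg x y R by auto
    ultimately show ?thesis by (simp add: iter_val_regular real_sqrt_mult)
  qed
  have "ball z (R/16) \<subseteq> iter_dom f n" for n
  proof (cases n)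
    case (Suc m)
    have "ball z (R/16) \<subseteq> ball z R" using R by auto
    then show ?thesis using reg unfolding Suc by (auto simp: iter_dom_iff)
  qed auto
  moreover have "normal_family (ball z (R/16)) (iter_val f)"
    by (rule normal_family_of_lipschitz[OF lip])
  ultimately show ?thesis unfolding fatou_point_def using R
    by (intro exI[of _ "ball z (R/16)"]) auto
qed

end

declare chordal.simps [simp del]

subsection \<open>Hausdorff null sets\<close>

lemma chordal_le_sdiam: "x \<in> U \<Longrightarrow> y \<in> U \<Longrightarrow> chordal (Some x) (Some y) \<le> sdiam U"
  unfolding sdiam_def
  by (auto intro!: cSup_upper bdd_aboveI[of _ 2] simp: chordal_le_2)

lemma sdiam_le:
  assumes "\<And>x y. x \<in> U \<Longrightarrow> y \<in> U \<Longrightarrow> chordal (Some x) (Some y) \<le> d" "0 \<le> d"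
  shows "sdiam U \<le> d"
proof (cases "U = {}")
  case False
  then show ?thesis unfolding sdiam_def using assms(1) by (simp, intro cSup_least) blast+
qed (simp add: sdiam_def assms(2))

lemma sdiam_nonneg: "sdiam U \<ge> 0"
proof (cases "U = {}")
  case False
  then obtain x where "x \<in> U" by blast
  then show ?thesis using chordal_le_sdiam[of x U x] chordal_self by metis
qed (simp add: sdiam_def)

lemma hcost_pos: "s > 0 \<Longrightarrow> hcost s U = sdiam U powr s"
  by (simp add: hcost_def sdiam_def)

lemma hcost_nonneg: "hcost s U \<ge> 0"
  by (simp add: hcost_def)

section \<open>Covers, countable unions and Lipschitz images of null sets\<close>

lemma hausdorff_measure_mono:
  assumes "A \<subseteq> B" shows "hausdorff_measure s A \<le> hausdorff_measure s B"
  unfolding hausdorff_measure_def hausdorff_pre_def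
  by (intro SUP_mono' INF_superset_mono order_refl) (use assms in blast)

lemma hausdorff_null_mono:
  "A \<subseteq> B \<Longrightarrow> hausdorff_measure s B = 0 \<Longrightarrow> hausdorff_measure s A = 0"
  using hausdorff_measure_mono[of A B s] by simp

lemma hausdorff_null_cover:
  assumes "hausdorff_measure s A = 0" "0 < \<epsilon>"
  shows "\<exists>U :: nat \<Rightarrow> complex set. A \<subseteq> (\<Union>i. U i) \<and> (\<Sum>i. ennreal (hcost s (U i))) < \<epsilon>"
proof -
  have "hausdorff_pre s 1 A \<le> hausdorff_measure s A"
    unfolding hausdorff_measure_def by (rule SUP_upper) simp
  then have "hausdorff_pre s 1 A < \<epsilon>" using assms by simp
  then show ?thesis unfolding hausdorff_pre_def INF_less_iff by (elim bexE) auto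
qed

lemma ennreal_le_suminf: "f i \<le> (\<Sum>i. f i)" for f :: "nat \<Rightarrow> ennreal"
  using sum_le_suminf[of f "{i}"] by simp

text \<open>The diameter restriction comes for free: if the total cost is below
  \<open>\<delta> powr s\<close>, each single diameter is at most \<open>\<delta>\<close>. So
  nullity can be tested with unrestricted covers.\<close>

lemma hausdorff_nullI:
  fixes A :: "complex set"
  assumes s: "s > 0"
    and cov: "\<And>\<epsilon>::real. \<epsilon> > 0 \<Longrightarrow> \<exists>U :: nat \<Rightarrow> complex set. A \<subseteq> (\<Union>i. U i) \<and> (\<Sum>i. ennreal (hcost s (U i))) < ennreal \<epsilon>"
  shows "hausdorff_measure s A = 0"
proof -
  have "hausdorff_pre s \<delta> A = 0" if \<delta>: "\<delta> > 0" for \<delta>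
  proof -
    have le: "hausdorff_pre s \<delta> A \<le> ennreal \<epsilon>" if \<epsilon>: "\<epsilon> > 0" for \<epsilon>
    proof -
      have "min \<epsilon> (\<delta> powr s) > 0" using \<epsilon> \<delta> by simp
      from cov[OF this] obtain U where U: "A \<subseteq> (\<Union>i. U i)"
        and sum: "(\<Sum>i. ennreal (hcost s (U i))) < ennreal (min \<epsilon> (\<delta> powr s))"
        by (elim exE conjE)
      have "sdiam (U i) \<le> \<delta>" for i
      proof -
        have "ennreal (hcost s (U i)) \<le> (\<Sum>i. ennreal (hcost s (U i)))"
          by (rule ennreal_le_suminf)
        also note sum
        also have "ennreal (min \<epsilon> (\<delta> powr s)) \<le> ennreal (\<delta> powr s)" by (rule ennreal_leI) simp
        finally have "ennreal (hcost s (U i)) < ennreal (\<delta> powr s)" .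
        then have "sdiam (U i) powr s < \<delta> powr s"
          using \<delta> by (simp add: hcost_pos[OF s] ennreal_less_iff)
        then show ?thesis
          using powr_mono2[of s \<delta> "sdiam (U i)"] s \<delta> by linarith
      qed
      then have "hausdorff_pre s \<delta> A \<le> (\<Sum>i. ennreal (hcost s (U i)))"
        unfolding hausdorff_pre_def using U by (intro INF_lower) auto
      also note less_imp_le[OF sum]
      also have "ennreal (min \<epsilon> (\<delta> powr s)) \<le> ennreal \<epsilon>" by (rule ennreal_leI) simp
      finally show ?thesis .
    qed
    have "hausdorff_pre s \<delta> A \<le> 0"
      by (rule ennreal_le_epsilon) (simp add: le)
    then show ?thesis by simp
  qed
  then have "hausdorff_measure s A \<le> 0" unfolding hausdorff_measure_def by (intro SUP_least) simp
  then show ?thesis by simp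
qed

lemma hausdorff_null_UN:
  assumes s: "s > 0" and null: "\<And>i::nat. hausdorff_measure s (A i) = 0"
  shows "hausdorff_measure s (\<Union>i. A i) = 0"
proof (rule hausdorff_nullI[OF s])
  fix \<epsilon> :: real assume \<epsilon>: "\<epsilon> > 0"
  have "\<forall>i. \<exists>U :: nat \<Rightarrow> complex set. A i \<subseteq> (\<Union>j. U j) \<and> (\<Sum>j. ennreal (hcost s (U j))) < ennreal (\<epsilon>/2 * (1/2) ^ Suc i)"
    using \<epsilon> by (intro allI hausdorff_null_cover null) simp
  from choice[OF this] obtain U where
      *: "\<forall>i. A i \<subseteq> (\<Union>j. U i j) \<and> (\<Sum>j. ennreal (hcost s (U i j))) < ennreal (\<epsilon>/2 * (1/2) ^ Suc i)"
    by (elim exE)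
  have U: "\<And>i. A i \<subseteq> (\<Union>j. U i j)"
    and sum: "\<And>i. (\<Sum>j. ennreal (hcost s (U i j))) < ennreal (\<epsilon>/2 * (1/2) ^ Suc i)"
    using * by auto
  define W where "W = (\<lambda>n. case prod_decode n of (i, j) \<Rightarrow> U i j)"
  have "(\<Union>i. A i) \<subseteq> (\<Union>n. W n)"
  proof
    fix x assume "x \<in> (\<Union>i. A i)"
    then obtain i j where "x \<in> U i j" using U by blast
    then have "x \<in> W (prod_encode (i, j))" by (simp add: W_def)
    then show "x \<in> (\<Union>n. W n)" by blast
  qed
  moreover have "(\<Sum>n. ennreal (hcost s (W n))) < ennreal \<epsilon>"
  proof -
    have "(\<Sum>n. ennreal (hcost s (W n))) = (\<Sum>n. (\<lambda>(i, j). ennreal (hcost s (U i j))) (prod_decode n))"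
      by (simp add: W_def case_prod_unfold)
    also have "\<dots> = (\<Sum>i. \<Sum>j. ennreal (hcost s (U i j)))"
      by (rule suminf_ennreal_2dimen) auto
    also have "\<dots> \<le> (\<Sum>i. ennreal (\<epsilon>/2 * (1/2) ^ Suc i))"
      by (intro suminf_le less_imp_le[OF sum]) auto
    also have "\<dots> = ennreal (\<epsilon>/2 * 1)"
      by (rule suminf_ennreal_eq, use \<epsilon> in simp) (rule sums_mult[OF power_half_series])
    also have "\<dots> < ennreal \<epsilon>" using \<epsilon> by (intro ennreal_lessI) auto
    finally show ?thesis .
  qed
  ultimately show "\<exists>U :: nat \<Rightarrow> complex set. (\<Union>i. A i) \<subseteq> (\<Union>i. U i) \<and> (\<Sum>i. ennreal (hcost s (U i))) < ennreal \<epsilon>"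
    by (intro exI[of _ W] conjI)
qed

lemma hausdorff_null_empty: "s > 0 \<Longrightarrow> hausdorff_measure s {} = 0"
  by (rule hausdorff_nullI) (auto intro!: exI[of _ "\<lambda>_. {}"] simp: hcost_def)

lemma hausdorff_null_singleton:
  assumes "s > 0" shows "hausdorff_measure s {x} = 0"
proof (rule hausdorff_nullI[OF assms])
  fix \<epsilon> :: real assume \<epsilon>: "\<epsilon> > 0"
  have "sdiam {x} = 0" by (simp add: sdiam_def chordal_self)
  then show "\<exists>U :: nat \<Rightarrow> complex set. {x} \<subseteq> (\<Union>i. U i) \<and> (\<Sum>i. ennreal (hcost s (U i))) < ennreal \<epsilon>"
    using assms \<epsilon> by (intro exI[of _ "\<lambda>_. {x}"]) (simp add: hcost_pos)
qed

lemma hausdorff_null_countable_UN: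
  assumes s: "s > 0" and I: "countable I" and null: "\<And>i. i \<in> I \<Longrightarrow> hausdorff_measure s (A i) = 0"
  shows "hausdorff_measure s (\<Union>i\<in>I. A i) = 0"
proof (cases "I = {}")
  case False
  then have "(\<Union>i\<in>I. A i) = (\<Union>n. A (from_nat_into I n))"
    using I range_from_nat_into[of I] by (metis image_image)
  moreover have "hausdorff_measure s (\<Union>n. A (from_nat_into I n)) = 0"
    by (rule hausdorff_null_UN[OF s]) (rule null, rule from_nat_into[OF False])
  ultimately show ?thesis by simp
qed (simp add: hausdorff_null_empty[OF s])

lemma hausdorff_null_Un:
  assumes "s > 0" "hausdorff_measure s A = 0" "hausdorff_measure s B = 0"
  shows "hausdorff_measure s (A \<union> B) = 0"
proof -
  have "hausdorff_measure s (\<Union>S\<in>{A, B}. S) = 0"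
    by (rule hausdorff_null_countable_UN[OF assms(1)]) (use assms(2,3) in blast)+
  then show ?thesis by simp
qed

text \<open>Boundedness of \<open>S\<close> makes Euclidean distances in the source controlled by
  chordal ones. In the target, chordal distance is at most twice the Euclidean one everywhere, so
  the image is unrestricted.\<close>

lemma hausdorff_null_lipschitz:
  assumes s: "s > 0" and null: "hausdorff_measure s S = 0"
    and lip: "\<And>x y. x \<in> S \<Longrightarrow> y \<in> S \<Longrightarrow> cmod (g x - g y) \<le> L * cmod (x - y)"
    and bd: "bounded S"
  shows "hausdorff_measure s (g ` S) = 0"
proof -
  obtain M where M: "\<And>x. x \<in> S \<Longrightarrow> cmod x \<le> M" using bd bounded_iff by blast
  define C where "C = (\<bar>L\<bar> + 1) * (1 + M\<^sup>2)"
  have C: "C > 0" unfolding C_def by (intro mult_pos_pos) (auto simp: add_nonneg_pos add_pos_nonneg)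
  have ch: "chordal (Some (g x)) (Some (g y)) \<le> C * chordal (Some x) (Some y)" if "x \<in> S" "y \<in> S" for x y
  proof -
    have "chordal (Some (g x)) (Some (g y)) \<le> 2 * cmod (g x - g y)" by (rule chordal_Some_le)
    also have "\<dots> \<le> 2 * (L * cmod (x - y))" using lip[OF that] by simp
    also have "\<dots> \<le> (\<bar>L\<bar> + 1) * (2 * cmod (x - y))"
      using mult_right_mono[of L "\<bar>L\<bar> + 1" "2 * cmod (x - y)"] by (simp add: mult_ac)
    also have "\<dots> \<le> (\<bar>L\<bar> + 1) * ((1 + M\<^sup>2) * chordal (Some x) (Some y))"
      using M that by (intro mult_left_mono cmod_diff_le_chordal) auto
    finally show ?thesis by (simp add: C_def mult.assoc)
  qed
  show ?thesis
  proof (rule hausdorff_nullI[OF s])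
    fix \<epsilon> :: real assume \<epsilon>: "\<epsilon> > 0"
    have "0 < ennreal (\<epsilon> / C powr s)" using \<epsilon> C by simp
    from hausdorff_null_cover[OF null this] obtain U where U: "S \<subseteq> (\<Union>i. U i)"
      and sum: "(\<Sum>i. ennreal (hcost s (U i))) < ennreal (\<epsilon> / C powr s)" by (elim exE conjE)
    let ?V = "\<lambda>i. g ` (U i \<inter> S)"
    have "sdiam (?V i) \<le> C * sdiam (U i)" for i
    proof (rule sdiam_le)
      fix x y assume "x \<in> ?V i" "y \<in> ?V i"
      then obtain x' y' where xy: "x' \<in> U i" "x' \<in> S" "y' \<in> U i" "y' \<in> S" "x = g x'" "y = g y'" by blast
      then have "chordal (Some x) (Some y) \<le> C * chordal (Some x') (Some y')" using ch by simp
      also have "\<dots> \<le> C * sdiam (U i)" using C xy by (intro mult_left_mono chordal_le_sdiam) auto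
      finally show "chordal (Some x) (Some y) \<le> C * sdiam (U i)" .
    qed (use C sdiam_nonneg in auto)
    then have "hcost s (?V i) \<le> C powr s * hcost s (U i)" for i
      unfolding hcost_pos[OF s] using C s sdiam_nonneg
      by (subst powr_mult[symmetric]) (auto intro!: powr_mono2)
    then have "(\<Sum>i. ennreal (hcost s (?V i))) \<le> (\<Sum>i. ennreal (C powr s) * ennreal (hcost s (U i)))"
      by (intro suminf_le) (auto simp: ennreal_mult'[symmetric] hcost_nonneg intro!: ennreal_leI)
    also have "\<dots> = ennreal (C powr s) * (\<Sum>i. ennreal (hcost s (U i)))"
      by (rule ennreal_suminf_cmult)
    also have "\<dots> < ennreal (C powr s) * ennreal (\<epsilon> / C powr s)"
      using sum C by (intro ennreal_mult_strict_left_mono) auto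
    also have "\<dots> = ennreal \<epsilon>" using C \<epsilon> by (simp add: ennreal_mult'[symmetric])
    finally show "\<exists>U :: nat \<Rightarrow> complex set. g ` S \<subseteq> (\<Union>i. U i) \<and> (\<Sum>i. ennreal (hcost s (U i))) < ennreal \<epsilon>"
      using U by (intro exI[of _ ?V] conjI) blast
  qed
qed

section \<open>Comparison of exponents and localization of non-null sets\<close>

lemma hausdorff_dim_mono: "A \<subseteq> B \<Longrightarrow> hausdorff_dim A \<le> hausdorff_dim B"
  unfolding hausdorff_dim_def by (rule Inf_superset_mono) (auto dest: hausdorff_null_mono)

lemma hausdorff_dim_nonneg: "0 \<le> hausdorff_dim A"
  unfolding hausdorff_dim_def by (rule Inf_greatest) auto

lemma not_null_below_dim: "0 \<le> t \<Longrightarrow> ereal t < hausdorff_dim A \<Longrightarrow> hausdorff_measure t A \<noteq> 0"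
proof
  assume "0 \<le> t" "ereal t < hausdorff_dim A" "hausdorff_measure t A = 0"
  moreover from this have "hausdorff_dim A \<le> ereal t"
    unfolding hausdorff_dim_def by (intro Inf_lower CollectI exI[of _ t]) auto
  ultimately show False by simp
qed

text \<open>If the set were null for some \<open>s < t\<close>, a cover of total cost below
  \<open>1\<close> would consist of sets of diameter at most \<open>1\<close>, for which raising the
  exponent lowers the cost; the set would be null for \<open>t\<close> too.\<close>

lemma hausdorff_dim_geI:
  assumes t: "t > 0" and nn: "hausdorff_measure t A \<noteq> 0"
  shows "ereal t \<le> hausdorff_dim A"
  unfolding hausdorff_dim_def
proof (rule Inf_greatest)
  fix x assume "x \<in> {ereal s |s. 0 \<le> s \<and> hausdorff_measure s A = 0}"
  then obtain s where x: "x = ereal s" and s: "0 \<le> s" "hausdorff_measure s A = 0"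
    by (elim CollectE exE conjE)
  have "t \<le> s"
  proof (rule ccontr)
    assume "\<not> t \<le> s"
    have le: "hcost t U \<le> hcost s U" if "hcost s U < 1" for U
    proof (cases "s = 0")
      \<comment> \<open>At exponent \<open>0\<close> every nonempty set costs exactly
        \<open>1\<close>, so a cost below \<open>1\<close> leaves only the empty set.\<close>
      case True
      then have "U = {}" using that by (auto simp: hcost_def split: if_splits)
      then show ?thesis by (simp add: hcost_def)
    next
      case False
      then have s0: "s > 0" using s by simp
      have "sdiam U \<le> 1"
      proof (rule ccontr)
        assume "\<not> sdiam U \<le> 1"
        then have "1 \<le> sdiam U powr s" using s0 by (intro ge_one_powr_ge_zero) auto
        then show False using that by (simp add: hcost_pos[OF s0])
      qed
      then show ?thesis using \<open>\<not> t \<le> s\<close> sdiam_nonneg[of U]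
        by (cases "sdiam U = 0") (auto simp: hcost_pos[OF s0] hcost_pos[OF t] intro!: powr_mono')
    qed
    have "hausdorff_measure t A = 0"
    proof (rule hausdorff_nullI[OF t])
      fix \<epsilon> :: real assume \<epsilon>: "\<epsilon> > 0"
      then have "0 < ennreal (min \<epsilon> 1)" by simp
      from hausdorff_null_cover[OF s(2) this] obtain U where U: "A \<subseteq> (\<Union>i. U i)"
        and sum: "(\<Sum>i. ennreal (hcost s (U i))) < ennreal (min \<epsilon> 1)" by (elim exE conjE)
      have "hcost s (U i) < 1" for i
      proof -
        have "ennreal (hcost s (U i)) \<le> (\<Sum>i. ennreal (hcost s (U i)))"
          by (rule ennreal_le_suminf)
        also have "\<dots> < ennreal (min \<epsilon> 1)" by (rule sum)
        finally show ?thesis using \<epsilon> by (simp add: ennreal_less_iff hcost_nonneg)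
      qed
      then have "(\<Sum>i. ennreal (hcost t (U i))) \<le> (\<Sum>i. ennreal (hcost s (U i)))"
        by (intro suminf_le ennreal_leI le) auto
      also have "\<dots> < ennreal \<epsilon>"
        by (rule less_le_trans[OF sum]) (auto intro: ennreal_leI)
      finally show "\<exists>U :: nat \<Rightarrow> complex set. A \<subseteq> (\<Union>i. U i) \<and> (\<Sum>i. ennreal (hcost t (U i))) < ennreal \<epsilon>"
        using U by (intro exI[of _ U] conjI)
    qed
    then show False using nn by simp
  qed
  then show "ereal t \<le> x" by (simp add: x)
qed

text \<open>Otherwise every point has a ball meeting \<open>A\<close> in a null set, and by Lindelof
  countably many such balls cover \<open>A\<close>.\<close>

lemma non_null_at_point:
  assumes s: "s > 0" and nn: "hausdorff_measure s A \<noteq> 0"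
  shows "\<exists>z\<in>A. \<forall>\<eta>>0. hausdorff_measure s (A \<inter> ball z \<eta>) \<noteq> 0"
proof (rule ccontr)
  assume "\<not> ?thesis"
  then have "\<forall>z\<in>A. \<exists>\<eta>. \<eta> > 0 \<and> hausdorff_measure s (A \<inter> ball z \<eta>) = 0" by simp
  from bchoice[OF this] obtain \<eta> where
    \<eta>: "\<forall>z\<in>A. \<eta> z > 0 \<and> hausdorff_measure s (A \<inter> ball z (\<eta> z)) = 0"
    by (elim exE)
  obtain \<F>' where F: "\<F>' \<subseteq> (\<lambda>z. ball z (\<eta> z)) ` A" "countable \<F>'" "\<Union>\<F>' = (\<Union>z\<in>A. ball z (\<eta> z))"
    by (rule Lindelof[of "(\<lambda>z. ball z (\<eta> z)) ` A"]) auto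
  have "A \<subseteq> \<Union>\<F>'" unfolding F(3) using \<eta> by force
  then have "A = (\<Union>B\<in>\<F>'. A \<inter> B)" by blast
  moreover have "hausdorff_measure s (\<Union>B\<in>\<F>'. A \<inter> B) = 0"
    by (rule hausdorff_null_countable_UN[OF s F(2)]) (use F(1) \<eta> in blast)
  ultimately show False using nn by simp
qed

subsection \<open>Hyperbolic sets are radial\<close>

lemma chordal_None_ge:
  assumes "cmod c \<le> M" shows "chordal None (Some c) \<ge> 2 / sqrt (1 + M\<^sup>2)"
proof -
  have "sqrt (1 + (cmod c)\<^sup>2) \<le> sqrt (1 + M\<^sup>2)" using assms by (simp add: power_mono)
  moreover have "sqrt (1 + (cmod c)\<^sup>2) > 0" using one_plus_cmod_sq_pos by simp
  ultimately show ?thesis by (simp add: chordal.simps frac_le)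
qed

text \<open>A point of modulus at most \<open>M\<close> has chordal distance at least
  \<open>2 / sqrt (1 + M\<^sup>2)\<close> from infinity. Within half of that distance, the other
  half remains as a lower bound for the distance from infinity.\<close>

lemma chordal_near_finite:
  assumes "cmod c \<le> M" and q: "chordal q (Some c) < 1 / sqrt (1 + M\<^sup>2)"
  shows "\<exists>u. q = Some u \<and> cmod u \<le> 2 * sqrt (1 + M\<^sup>2)"
proof -
  let ?t = "sqrt (1 + M\<^sup>2)"
  have t: "?t > 0" by (simp add: add_pos_nonneg)
  have far: "2 / ?t \<le> chordal None (Some c)" using chordal_None_ge assms(1) .
  have split: "2 / ?t = 1 / ?t + 1 / ?t" and t1: "1 / ?t > 0" using t by auto
  have "q \<noteq> None"
  proof
    assume "q = None"
    then have "chordal None (Some c) < 1 / ?t" using q by (simp only:)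
    then show False using far split t1 by linarith
  qed
  then obtain u where u: "q = Some u" by blast
  have tri: "chordal None (Some c) \<le> chordal None (Some u) + chordal (Some u) (Some c)"
    by (rule chordal_triangle)
  have "1 / ?t \<le> chordal None (Some u)"
    using far tri q split unfolding u by linarith
  then have "1 / ?t \<le> 2 / sqrt (1 + (cmod u)\<^sup>2)" by (simp only: chordal.simps)
  moreover have su: "sqrt (1 + (cmod u)\<^sup>2) > 0" using one_plus_cmod_sq_pos by simp
  moreover have "b \<le> 2 * a" if "a > 0" "b > 0" "1 / a \<le> 2 / b" for a b :: real
    using that by (simp add: field_simps)
  ultimately have "sqrt (1 + (cmod u)\<^sup>2) \<le> 2 * ?t" using t by blast
  moreover have "cmod u \<le> sqrt (1 + (cmod u)\<^sup>2)" by (simp add: real_le_rsqrt)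
  ultimately show ?thesis using u by auto
qed

text \<open>The hypothesis \<open>small\<close> says that infinity is farther than
  \<open>\<delta>\<close> from \<open>c\<close>. A chordal disk that keeps away from infinity is a
  Euclidean disk, with a shifted centre.\<close>

lemma connected_chordal_disk:
  assumes "\<delta> > 0" and small: "\<delta>\<^sup>2 * (1 + (cmod c)\<^sup>2) < 4"
  shows "connected {u. chordal (Some u) (Some c) < \<delta>}"
proof -
  \<comment> \<open>Squared, the condition reads
    \<open>4 * (cmod (u - c))\<^sup>2 < a * (1 + (cmod u)\<^sup>2)\<close>. Completing the square
    yields the centre \<open>c'\<close> and the squared radius \<open>T\<close>.\<close>
  define a where "a = \<delta>\<^sup>2 * (1 + (cmod c)\<^sup>2)"
  define \<kappa> where "\<kappa> = 4 - a"
  have \<kappa>: "\<kappa> > 0" using small by (simp add: \<kappa>_def a_def)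
  define c' where "c' = (4 / \<kappa>) *\<^sub>R c"
  define T where "T = (16 * (cmod c)\<^sup>2 / \<kappa> - 4 * (cmod c)\<^sup>2 + a) / \<kappa>"
  have "chordal (Some u) (Some c) < \<delta> \<longleftrightarrow> u \<in> ball c' (sqrt T)" for u
  proof -
    let ?s = "sqrt ((1 + (cmod u)\<^sup>2) * (1 + (cmod c)\<^sup>2))"
    have P: "(1 + (cmod u)\<^sup>2) * (1 + (cmod c)\<^sup>2) > 0" using one_plus_cmod_sq_pos by simp
    then have s: "?s > 0" by simp
    have "chordal (Some u) (Some c) < \<delta> \<longleftrightarrow> 2 * cmod (u - c) < \<delta> * ?s"
      using s by (simp only: chordal.simps pos_divide_less_eq)
    also have "\<dots> \<longleftrightarrow> (2 * cmod (u - c))\<^sup>2 < (\<delta> * ?s)\<^sup>2"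
    proof
      assume "2 * cmod (u - c) < \<delta> * ?s"
      then show "(2 * cmod (u - c))\<^sup>2 < (\<delta> * ?s)\<^sup>2" by (rule power_strict_mono) auto
    next
      assume "(2 * cmod (u - c))\<^sup>2 < (\<delta> * ?s)\<^sup>2"
      then show "2 * cmod (u - c) < \<delta> * ?s"
        by (rule power2_less_imp_less) (use s assms(1) in \<open>simp add: mult_nonneg_nonneg\<close>)
    qed
    also have "(\<delta> * ?s)\<^sup>2 = a * (1 + (cmod u)\<^sup>2)"
      using P by (simp add: power_mult_distrib a_def)
    also have "(2 * cmod (u - c))\<^sup>2 < a * (1 + (cmod u)\<^sup>2) \<longleftrightarrow> (cmod (u - c'))\<^sup>2 < T"
    proof -
      have eq: "\<kappa> * (cmod (u - c'))\<^sup>2 - \<kappa> * T = (2 * cmod (u - c))\<^sup>2 - a * (1 + (cmod u)\<^sup>2)"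
      proof -
        have "\<kappa> * T = 16 * (cmod c)\<^sup>2 / \<kappa> - 4 * (cmod c)\<^sup>2 + a" using \<kappa> by (simp add: T_def)
        moreover have "\<kappa> * (cmod (u - c'))\<^sup>2 = \<kappa> * (cmod u)\<^sup>2 - 8 * (Re u * Re c + Im u * Im c) + 16 * (cmod c)\<^sup>2 / \<kappa>"
          using \<kappa> unfolding cmod_power2 c'_def by (simp add: field_simps power2_eq_square)
        moreover have "(2 * cmod (u - c))\<^sup>2 = 4 * (cmod u)\<^sup>2 - 8 * (Re u * Re c + Im u * Im c) + 4 * (cmod c)\<^sup>2"
          unfolding power_mult_distrib cmod_power2 by (simp add: field_simps power2_eq_square)
        ultimately show ?thesis by (simp add: \<kappa>_def algebra_simps)
      qed
      have "(2 * cmod (u - c))\<^sup>2 < a * (1 + (cmod u)\<^sup>2) \<longleftrightarrow> \<kappa> * (cmod (u - c'))\<^sup>2 < \<kappa> * T" using eq by linarith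
      then show ?thesis using \<kappa> by simp
    qed
    also have "\<dots> \<longleftrightarrow> cmod (u - c') < sqrt T"
      using real_sqrt_less_iff[of "(cmod (u - c'))\<^sup>2" T] by simp
    finally show ?thesis by (simp add: dist_norm norm_minus_commute)
  qed
  then have "{u. chordal (Some u) (Some c) < \<delta>} = ball c' (sqrt T)" by blast
  then show ?thesis by (simp add: convex_connected)
qed

section \<open>Conformal pullbacks from holomorphic sections of an iterate\<close>

context meromorphic_map
begin

lemma deriv_section:
  assumes "\<psi> holomorphic_on S" "open S" "u \<in> S" "regular_upto f n (\<psi> u)"
    and sec: "\<And>u. u \<in> S \<Longrightarrow> (f ^^ n) (\<psi> u) = u"
  shows "deriv (f ^^ n) (\<psi> u) * deriv \<psi> u = 1"
proof -
  have "((f ^^ n) \<circ> \<psi> has_field_derivative deriv (f ^^ n) (\<psi> u) * deriv \<psi> u) (at u)"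
    by (rule DERIV_chain[OF differentiable_regular[OF assms(4)] holomorphic_derivI[OF assms(1-3)]])
  then have "((\<lambda>u. u) has_field_derivative deriv (f ^^ n) (\<psi> u) * deriv \<psi> u) (at u)"
    by (rule has_field_derivative_transform_within_open[OF _ assms(2,3)]) (simp add: sec)
  then show ?thesis using DERIV_unique DERIV_ident by blast
qed

text \<open>The work is to identify the component \<open>V\<close> with \<open>\<psi>\<close>
  applied to \<open>D'\<close>. That image \<open>Q\<close> is open by the open mapping theorem, and
  closed in \<open>V\<close> as the set where the section inverts \<open>f ^^ n\<close> exactly;
  connectedness of \<open>V\<close> leaves no other points.\<close>

lemma conformal_pullbackI:
  assumes \<rho>: "\<rho> > 0" and reg: "\<And>u. u \<in> ball c \<rho> \<Longrightarrow> regular_upto f n (\<psi> u)"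
    and sec: "\<And>u. u \<in> ball c \<rho> \<Longrightarrow> (f ^^ n) (\<psi> u) = u"
    and hol: "\<psi> holomorphic_on ball c \<rho>" and \<psi>c: "\<psi> c = z"
    and D: "{q. chordal q (Some c) < \<delta>} = Some ` D'" "D' \<subseteq> ball c \<rho>" "connected D'" "open D'" "c \<in> D'"
  shows "conformal_pullback f n z \<delta>"
proof -
  have regz: "regular_upto f n z" and fz: "(f ^^ n) z = c" using reg[of c] sec[of c] \<rho> \<psi>c by auto
  have ivz: "iter_val f n z = Some c" using iter_val_regular[OF regz] fz by simp
  define S where "S = {w \<in> iter_dom f n. iter_val f n w \<in> Some ` D'}"
  define V where "V = connected_component_set S z"
  define Q where "Q = \<psi> ` D'"
  have regdom: "w \<in> iter_dom f n" if "regular_upto f n w" for w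
    using that by (cases n) (auto simp: iter_dom_iff intro: regular_upto_mono)
  have S: "S = {w. regular_upto f n w \<and> (f ^^ n) w \<in> D'}"
  proof (rule set_eqI, rule iffI)
    fix w assume "w \<in> S"
    then obtain u where "w \<in> iter_dom f n" "u \<in> D'" "iter_val f n w = Some u" unfolding S_def by auto
    then show "w \<in> {w. regular_upto f n w \<and> (f ^^ n) w \<in> D'}" using regular_of_iter_val by blast
  next
    fix w assume "w \<in> {w. regular_upto f n w \<and> (f ^^ n) w \<in> D'}"
    then show "w \<in> S" unfolding S_def using regdom iter_val_regular by auto
  qed
  have QS: "Q \<subseteq> S" unfolding Q_def S using reg sec D(2) by (auto simp: subset_iff)
  have contQ: "continuous_on D' \<psi>"
    using hol D(2) holomorphic_on_imp_continuous_on continuous_on_subset by blast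
  have QV: "Q \<subseteq> V" unfolding V_def
  proof (rule connected_component_maximal)
    show "z \<in> Q" using D(5) \<psi>c by (auto simp: Q_def)
    show "connected Q" unfolding Q_def by (rule connected_continuous_image[OF contQ D(3)])
  qed (rule QS)
  have VS: "V \<subseteq> S" unfolding V_def by (rule connected_component_subset)
  have inj\<psi>: "inj_on \<psi> D'" using sec D(2) by (intro inj_on_inverseI[where g = "f ^^ n"]) blast
  have "open Q" unfolding Q_def
    by (rule open_mapping_thm3[OF holomorphic_on_subset[OF hol D(2)] D(4) inj\<psi>])
  have contF: "continuous_on S (f ^^ n)"
    by (intro holomorphic_on_imp_continuous_on holomorphic_regular) (auto simp: S)
  have Qeq: "Q = {w \<in> V. \<psi> ((f ^^ n) w) - w = 0}"
    using QV VS sec D(2) unfolding Q_def S by (auto simp: subset_iff) (metis image_eqI)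
  have "closedin (top_of_set V) Q" unfolding Qeq
  proof (rule continuous_closedin_preimage_constant)
    have "continuous_on V (\<lambda>w. \<psi> ((f ^^ n) w))"
      by (rule continuous_on_compose2[OF contQ continuous_on_subset[OF contF VS]]) (use VS S in auto)
    then show "continuous_on V (\<lambda>w. \<psi> ((f ^^ n) w) - w)" by (intro continuous_intros)
  qed
  moreover have "openin (top_of_set V) Q" 
    using openin_open_Int[OF \<open>open Q\<close>, of V] QV by (simp add: Int_absorb1)
  moreover have "connected V" by (simp add: V_def connected_connected_component)
  moreover have "Q \<noteq> {}" using D(5) by (auto simp: Q_def)
  ultimately have VQ: "V = Q" unfolding connected_clopen by blast
  have "bij_betw (iter_val f n) V (Some ` D')"
    unfolding bij_betw_def
  proof
    have iv: "iter_val f n (\<psi> u) = Some u" if "u \<in> D'" for u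
      using iter_val_regular[OF reg] sec D(2) that by auto
    show "inj_on (iter_val f n) V" unfolding VQ Q_def inj_on_def using iv by auto
    show "iter_val f n ` V = Some ` D'" unfolding VQ Q_def using iv by (force simp: image_iff)
  qed
  moreover have "\<exists>d. d \<noteq> 0 \<and> ((f ^^ n) has_field_derivative d) (at w)" if "w \<in> V" for w
  proof -
    obtain u where u: "u \<in> D'" "w = \<psi> u" using \<open>w \<in> V\<close> VQ Q_def by blast
    have uball: "u \<in> ball c \<rho>" using u D(2) by blast
    have dF: "((f ^^ n) has_field_derivative deriv (f ^^ n) w) (at w)"
      using differentiable_regular reg[OF uball] u by simp
    have "deriv (f ^^ n) w * deriv \<psi> u = 1"
      using deriv_section[OF hol open_ball uball reg[OF uball] sec] u by simp
    then have "deriv (f ^^ n) w \<noteq> 0" by auto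
    then show ?thesis using dF by blast
  qed
  moreover have "iter_val f n w \<noteq> None" if "w \<in> V" for w
  proof -
    have "regular_upto f n w" using that VS unfolding S by blast
    then show ?thesis using iter_val_regular by simp
  qed
  ultimately show ?thesis
    unfolding conformal_pullback_def Let_def ivz D(1) S_def[symmetric] V_def[symmetric] by blast
qed

section \<open>Expansion on invariant sets\<close>

definition invariant_set :: "complex set \<Rightarrow> bool" where
  "invariant_set K \<longleftrightarrow> (\<forall>z\<in>K. \<not> is_pole f z \<and> f z \<in> K)"

lemma invariant_funpow: "invariant_set K \<Longrightarrow> z \<in> K \<Longrightarrow> (f ^^ n) z \<in> K"
  by (induction n) (auto simp: invariant_set_def)

lemma invariant_regular: "invariant_set K \<Longrightarrow> z \<in> K \<Longrightarrow> regular_upto f n z"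
  using invariant_funpow unfolding regular_upto_def invariant_set_def by blast

lemma sph_deriv_nonneg: "sph_deriv f n z \<ge> 0"
  unfolding sph_deriv_def by (intro divide_nonneg_nonneg mult_nonneg_nonneg) auto

lemma sph_deriv_add:
  assumes "regular_upto f (m + n) z"
  shows "sph_deriv f (m + n) z = sph_deriv f n ((f ^^ m) z) * sph_deriv f m z"
proof -
  have "(f ^^ n) ((f ^^ m) z) = (f ^^ (m + n)) z"
    by (simp add: funpow_add[of n m] add.commute[of m n])
  moreover have "1 + (cmod ((f ^^ m) z))\<^sup>2 \<noteq> 0" by (rule one_plus_cmod_sq_pos)
  ultimately show ?thesis unfolding sph_deriv_def deriv_funpow_add[OF assms] norm_mult by simp
qed

text \<open>On a bounded set, spherical and Euclidean derivatives differ by a factor at most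
  \<open>1 + M\<^sup>2\<close>, which a high power of \<open>lam\<close> beats. The value
  \<open>4\<close> leaves an expansion factor \<open>3\<close> after an error of \<open>1\<close> in
  \<open>expanding_local_inverse\<close>.\<close>

lemma hyperbolic_deriv_growth:
  assumes "hyperbolic_set f K"
  shows "\<exists>N\<ge>1. \<forall>z\<in>K. cmod (deriv (f ^^ N) z) \<ge> 4"
proof -
  have inv: "invariant_set K" and cpt: "compact K" using assms by (auto simp: hyperbolic_set_def invariant_set_def)
  obtain n lam where n: "n \<ge> 1" "lam > 1" and exp: "\<And>z. z \<in> K \<Longrightarrow> sph_deriv f n z > lam"
    using assms by (auto simp: hyperbolic_set_def)
  obtain M where M: "\<And>z. z \<in> K \<Longrightarrow> cmod z \<le> M"
    using compact_imp_bounded[OF cpt] bounded_iff by blast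
  have pow: "sph_deriv f (n * k) z \<ge> lam ^ k" if "z \<in> K" for k z
    using that
  proof (induction k arbitrary: z)
    case 0
    have "1 + (cmod z)\<^sup>2 \<noteq> 0" by (rule one_plus_cmod_sq_pos)
    then show ?case by (simp add: sph_deriv_def id_def)
  next
    case (Suc k)
    have "sph_deriv f (n + n * k) z = sph_deriv f (n * k) ((f ^^ n) z) * sph_deriv f n z"
      by (rule sph_deriv_add) (rule invariant_regular[OF inv Suc.prems])
    moreover have "lam ^ k * lam \<le> sph_deriv f (n * k) ((f ^^ n) z) * sph_deriv f n z"
      using Suc.IH[OF invariant_funpow[OF inv Suc.prems]] exp[OF Suc.prems] n
      by (intro mult_mono) (auto simp: sph_deriv_nonneg)
    ultimately show ?case by (simp add: mult.commute)
  qed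
  obtain k' where k': "lam ^ k' > 4 * (1 + M\<^sup>2)" using real_arch_pow n by blast
  \<comment> \<open>The successor ensures a positive number of iterations, since \<open>k'\<close>
    could be \<open>0\<close>.\<close>
  define k where "k = Suc k'"
  have "lam ^ k' \<le> lam ^ k" unfolding k_def using n by (intro power_increasing) auto
  then have k: "lam ^ k > 4 * (1 + M\<^sup>2)" using k' by (rule less_le_trans[rotated])
  have "cmod (deriv (f ^^ (n * k)) z) \<ge> 4" if z: "z \<in> K" for z
  proof -
    let ?w = "(f ^^ (n * k)) z" and ?d = "cmod (deriv (f ^^ (n * k)) z)"
    have "4 * (1 + M\<^sup>2) \<le> ?d * (1 + (cmod z)\<^sup>2) / (1 + (cmod ?w)\<^sup>2)"
      using pow[OF z, of k] k unfolding sph_deriv_def by linarith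
    also have "\<dots> \<le> ?d * (1 + (cmod z)\<^sup>2) / 1"
      by (intro divide_left_mono mult_nonneg_nonneg mult_pos_pos) (auto simp: one_plus_cmod_sq_pos)
    also have "\<dots> \<le> ?d * (1 + M\<^sup>2)"
      unfolding div_by_1 using M[OF z] by (intro mult_left_mono add_left_mono power_mono) auto
    finally show ?thesis
      by (rule mult_right_le_imp_le) (simp add: add_pos_nonneg)
  qed
  moreover have "n * k \<ge> 1" using n by (simp add: k_def)
  ultimately show ?thesis by blast
qed

lemma deriv_power_growth:
  assumes inv: "invariant_set K" and exp: "\<And>z. z \<in> K \<Longrightarrow> cmod (deriv (f ^^ N) z) \<ge> a" and "a \<ge> 0" "z \<in> K"
  shows "cmod (deriv (f ^^ (N * k)) z) \<ge> a ^ k"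
  using \<open>z \<in> K\<close>
proof (induction k arbitrary: z)
  case (Suc k)
  have "deriv (f ^^ (N + N * k)) z = deriv (f ^^ (N * k)) ((f ^^ N) z) * deriv (f ^^ N) z"
    by (rule deriv_funpow_add) (rule invariant_regular[OF inv Suc.prems])
  moreover have "a ^ k * a \<le> cmod (deriv (f ^^ (N * k)) ((f ^^ N) z)) * cmod (deriv (f ^^ N) z)"
    using Suc.IH[OF invariant_funpow[OF inv Suc.prems]] exp[OF Suc.prems] \<open>a \<ge> 0\<close> by (intro mult_mono) auto
  ultimately show ?case by (simp add: mult.commute norm_mult)
qed (simp add: id_def)

text \<open>Along a convergent subsequence the iterates stay uniformly close to one another near
  \<open>z\<close>, hence bounded there, because the orbit of \<open>z\<close> is bounded. Cauchy's
  estimate then bounds their derivatives at \<open>z\<close>, against exponential growth.\<close>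

lemma hyperbolic_not_fatou:
  assumes hyp: "hyperbolic_set f K" and z: "z \<in> K"
  shows "\<not> fatou_point f z"
proof
  assume "fatou_point f z"
  then obtain U where U: "open U" "z \<in> U" "\<And>n. U \<subseteq> iter_dom f n" and nf: "normal_family U (iter_val f)"
    by (auto simp: fatou_point_def)
  have inv: "invariant_set K" and cpt: "compact K" using hyp by (auto simp: hyperbolic_set_def invariant_set_def)
  obtain M where M: "\<And>z. z \<in> K \<Longrightarrow> cmod z \<le> M"
    using compact_imp_bounded[OF cpt] bounded_iff by blast
  obtain N where N: "N \<ge> 1" "\<And>z. z \<in> K \<Longrightarrow> cmod (deriv (f ^^ N) z) \<ge> 4"
    using hyperbolic_deriv_growth[OF hyp] by blast
  obtain e where e: "e > 0" "cball z e \<subseteq> U" using U open_contains_cball by blast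
  have reg: "regular_upto f n w" if "w \<in> U" for n w
    using U(3)[of "Suc n"] that iter_dom_iff by blast
  from nf[unfolded normal_family_def, THEN spec, of "\<lambda>j. N * j"] obtain r g where r: "strict_mono r"
    and conv: "\<forall>L. compact L \<and> L \<subseteq> U \<longrightarrow>
      (\<forall>\<epsilon>>0. eventually (\<lambda>j. \<forall>w\<in>L. chordal (iter_val f (N * r j) w) (g w) < \<epsilon>) sequentially)"
    by (elim exE conjE)
  have unif: "eventually (\<lambda>j. \<forall>w\<in>cball z e. chordal (iter_val f (N * r j) w) (g w) < \<epsilon>) sequentially"
    if "\<epsilon> > 0" for \<epsilon>
    using conv e(2) that compact_cball by blast
  define \<eta> where "\<eta> = 1 / sqrt (1 + M\<^sup>2)"
  have \<eta>: "\<eta> > 0" by (simp add: \<eta>_def add_pos_nonneg)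
  have "\<eta>/8 > 0" using \<eta> by simp
  from unif[OF this, unfolded eventually_sequentially] obtain J where
    J: "\<forall>j\<ge>J. \<forall>w\<in>cball z e. chordal (iter_val f (N * r j) w) (g w) < \<eta>/8" by (elim exE)
  let ?F = "\<lambda>j. f ^^ (N * r j)"
  \<comment> \<open>Continuity of this single iterate fixes the disk for all later ones. The limit
    \<open>g\<close> only serves as a common comparison value at each point, so its continuity is
    not invoked.\<close>
  have "isCont (?F J) z" using analytic_at_regular[OF reg[OF U(2)]] analytic_at_imp_isCont by blast
  then obtain d where d: "d > 0" "\<And>w. dist w z < d \<Longrightarrow> dist (?F J w) (?F J z) < \<eta>/16"
    unfolding continuous_at_eps_delta using \<eta> by (metis (no_types, lifting) divide_pos_pos zero_less_numeral)
  define d' where "d' = min (d/2) e"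
  have d': "d' > 0" "d' < d" "d' \<le> e" using d e by (auto simp: d'_def)
  define B where "B = 2 * sqrt (1 + M\<^sup>2)"
  have bound: "cmod (?F j w) \<le> B" if j: "j \<ge> J" and w: "w \<in> cball z d'" for j w
  proof -
    have we: "w \<in> cball z e" using w d' by auto
    have wU: "w \<in> U" using we e by blast
    have "chordal (Some (?F J w)) (Some (?F J z)) \<le> 2 * cmod (?F J w - ?F J z)" by (rule chordal_Some_le)
    also have "\<dots> < \<eta>/8" using d(2)[of w] w d' by (simp add: dist_norm norm_minus_commute)
    finally have 1: "chordal (Some (?F J w)) (Some (?F J z)) < \<eta>/8" .
    have 2: "chordal (Some (?F j w)) (g w) < \<eta>/8" "chordal (Some (?F J w)) (g w) < \<eta>/8"
      using J[rule_format, OF j we] J[rule_format, OF order_refl we]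
      by (simp_all only: iter_val_regular reg wU)
    have "chordal (Some (?F j w)) (Some (?F J z)) < \<eta>"
      using 1 2 chordal_triangle[of "Some (?F j w)" "Some (?F J z)" "g w"]
        chordal_triangle[of "g w" "Some (?F J z)" "Some (?F J w)"] chordal_commute[of "g w" "Some (?F J w)"] \<eta>
      by linarith
    moreover have "cmod (?F J z) \<le> M" by (intro M invariant_funpow[OF inv z])
    ultimately show ?thesis using chordal_near_finite[of "?F J z" M] unfolding \<eta>_def B_def by fastforce
  qed
  have "cmod (deriv (?F j) z) \<le> B / d'" if j: "j \<ge> J" for j
  proof -
    have hol: "?F j holomorphic_on cball z d'"
      using d' e by (intro holomorphic_regular reg) auto
    show ?thesis
    proof (rule deriv_bound_on_sphere[OF hol d'(1), of 0])
      show "cmod (?F j x - 0) \<le> B" if "cmod (z - x) = d'" for x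
        using bound[OF j, of x] that by (simp add: dist_norm)
    qed
  qed
  moreover obtain k where k: "4 ^ k > B / d'" using real_arch_pow[of 4] by auto
  define j where "j = max J k"
  have "4 ^ r j \<le> cmod (deriv (?F j) z)"
    by (rule deriv_power_growth[OF inv N(2) _ z]) auto
  moreover have "(4::real) ^ k \<le> 4 ^ r j"
    using seq_suble[OF r, of j] by (intro power_increasing) (auto simp: j_def)
  ultimately show False using k by (smt (verit) j_def max.cobounded1)
qed

text \<open>Where the derivative of \<open>f ^^ N\<close> varies by less than \<open>1\<close>,
  subtracting the linear part leaves a \<open>1\<close>-Lipschitz map, so \<open>f ^^ N\<close>
  expands distances by at least \<open>4 - 1 = 3\<close>. Uniform continuity of the derivative on a
  compact neighbourhood \<open>Ke\<close> makes \<open>\<rho>\<close> independent of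
  \<open>z\<close>.\<close>

lemma expanding_local_inverse:
  assumes cpt: "compact K" and inv: "invariant_set K"
    and exp: "\<And>z. z \<in> K \<Longrightarrow> cmod (deriv (f ^^ N) z) \<ge> 4"
  shows "\<exists>\<rho>>0. \<forall>z\<in>K. \<exists>g. g holomorphic_on ball ((f ^^ N) z) \<rho> \<and>
    (\<forall>u\<in>ball ((f ^^ N) z) \<rho>. regular_upto f N (g u) \<and> (f ^^ N) (g u) = u \<and> cmod (g u - z) \<le> cmod (u - (f ^^ N) z))"
proof -
  let ?F = "f ^^ N" and ?O = "{w. regular_upto f N w}"
  have KO: "K \<subseteq> ?O" using invariant_regular[OF inv] by blast
  obtain e where e: "e > 0" "(\<Union>x\<in>K. cball x e) \<subseteq> ?O"
    using compact_subset_open_imp_cball_epsilon_subset[OF cpt open_regular KO] by metis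
  define Ke where "Ke = (\<Union>x\<in>K. cball x e)"
  have "Ke = {x + y |x y. x \<in> K \<and> y \<in> cball 0 e}"
    unfolding Ke_def by (auto simp: dist_norm) (metis add_diff_cancel_left' diff_add_cancel norm_minus_commute add.commute)
  then have cptKe: "compact Ke" using compact_sums[OF cpt compact_cball, of 0 e] by simp
  have hol: "?F holomorphic_on ?O" by (rule holomorphic_regular) auto
  have "continuous_on Ke (deriv ?F)"
    using e by (intro holomorphic_on_imp_continuous_on holomorphic_on_subset[OF holomorphic_deriv[OF hol open_regular]])
      (auto simp: Ke_def)
  then have "uniformly_continuous_on Ke (deriv ?F)" using cptKe compact_uniformly_continuous by blast
  then obtain d where d: "d > 0" "\<And>x y. x \<in> Ke \<Longrightarrow> y \<in> Ke \<Longrightarrow> dist y x < d \<Longrightarrow> dist (deriv ?F y) (deriv ?F x) < 1"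
    unfolding uniformly_continuous_on_def by (metis zero_less_one)
  define \<rho> where "\<rho> = min (d/2) e"
  have \<rho>: "\<rho> > 0" "\<rho> < d" "\<rho> \<le> e" using d e by (auto simp: \<rho>_def)
  have "\<exists>g. g holomorphic_on ball (?F z) \<rho> \<and>
    (\<forall>u\<in>ball (?F z) \<rho>. regular_upto f N (g u) \<and> ?F (g u) = u \<and> cmod (g u - z) \<le> cmod (u - ?F z))"
    if z: "z \<in> K" for z
  proof -
    have sub: "cball z \<rho> \<subseteq> Ke" unfolding Ke_def using z \<rho> by (auto intro!: bexI[of _ z])
    have subO: "cball z \<rho> \<subseteq> ?O" using sub e unfolding Ke_def by blast
    have expand: "cmod (?F x - ?F y) \<ge> 3 * cmod (x - y)" if "x \<in> cball z \<rho>" "y \<in> cball z \<rho>" for x y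
    proof -
      have "cmod ((?F x - deriv ?F z * x) - (?F y - deriv ?F z * y)) \<le> 1 * cmod (x - y)"
      proof (rule field_differentiable_bound[OF convex_cball[of z \<rho>]])
        fix w assume w: "w \<in> cball z \<rho>"
        have "(?F has_field_derivative deriv ?F w) (at w)"
          using subO w by (intro differentiable_regular) auto
        from DERIV_diff[OF this DERIV_cmult[OF DERIV_ident, of "deriv ?F z"]]
        show "((\<lambda>x. ?F x - deriv ?F z * x) has_field_derivative deriv ?F w - deriv ?F z) (at w within cball z \<rho>)"
          by (auto intro: has_field_derivative_at_within)
        have "dist (deriv ?F w) (deriv ?F z) < 1"
          using sub w \<rho> by (intro d(2)) (auto simp: dist_commute)
        then show "cmod (deriv ?F w - deriv ?F z) \<le> 1" by (simp add: dist_norm)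
      qed (use that in auto)
      moreover have "cmod (deriv ?F z * (x - y)) \<ge> 4 * cmod (x - y)"
        using exp[OF z] by (simp add: norm_mult mult_right_mono)
      moreover have "cmod (deriv ?F z * (x - y)) \<le> cmod (?F x - ?F y) + cmod ((?F x - deriv ?F z * x) - (?F y - deriv ?F z * y))"
        using norm_triangle_ineq4[of "?F x - ?F y" "(?F x - deriv ?F z * x) - (?F y - deriv ?F z * y)"]
        by (simp add: algebra_simps)
      ultimately show ?thesis by linarith
    qed
    have inj: "inj_on ?F (cball z \<rho>)"
    proof (rule inj_onI)
      fix x y assume "x \<in> cball z \<rho>" "y \<in> cball z \<rho>" "?F x = ?F y"
      then show "x = y" using expand[of x y] by simp
    qed
    have holb: "?F holomorphic_on ball z \<rho>" and injb: "inj_on ?F (ball z \<rho>)"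
      using hol subO inj ball_subset_cball[of z \<rho>] by (meson holomorphic_on_subset inj_on_subset order_trans)+
    obtain g where g: "g holomorphic_on ?F ` ball z \<rho>" "\<And>w. w \<in> ball z \<rho> \<Longrightarrow> g (?F w) = w"
      using holomorphic_has_inverse[OF holb open_ball injb] by metis
    have img: "ball (?F z) \<rho> \<subseteq> ?F ` ball z \<rho>"
    proof (rule ball_subset_open_map_image)
      have "closure (ball z \<rho>) = cball z \<rho>" using \<rho> by simp
      then show "continuous_on (closure (ball z \<rho>)) ?F"
        using holomorphic_on_imp_continuous_on[OF holomorphic_on_subset[OF hol subO]] by simp
      show "open (?F ` interior (ball z \<rho>))"
        using open_mapping_thm3[OF holb open_ball injb] by (simp add: interior_open)
      show "\<rho> \<le> cmod (?F x - ?F z)" if "x \<in> frontier (ball z \<rho>)" for x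
      proof -
        have "dist z x = \<rho>" using that \<rho> by (simp add: frontier_ball)
        then show ?thesis using expand[of x z] \<rho> by (simp add: dist_norm norm_minus_commute)
      qed
    qed (use \<rho> in auto)
    have "regular_upto f N (g u) \<and> ?F (g u) = u \<and> cmod (g u - z) \<le> cmod (u - ?F z)"
      if u: "u \<in> ball (?F z) \<rho>" for u
    proof -
      obtain w where w: "w \<in> ball z \<rho>" "u = ?F w" using img u by blast
      have "3 * cmod (w - z) \<le> cmod (u - ?F z)" using expand[of w z] w \<rho> by auto
      then have "cmod (w - z) \<le> cmod (u - ?F z)" using norm_ge_zero[of "w - z"] by linarith
      moreover have "regular_upto f N w" using subO w(1) ball_subset_cball by blast
      ultimately show ?thesis using w(2) g(2)[OF w(1)] by simp
    qed
    then show ?thesis using holomorphic_on_subset[OF g(1) img] by blast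
  qed
  then show ?thesis using \<rho> by blast
qed

text \<open>The local inverses do not increase the distance to the base point, so each maps a ball
  of radius \<open>\<rho>\<close> into the ball needed by the next one, and they compose along the
  whole orbit without loss of radius.\<close>

lemma hyperbolic_subset_radial:
  assumes hyp: "hyperbolic_set f K"
  shows "K \<subseteq> radial_julia f"
proof
  fix z assume z: "z \<in> K"
  have inv: "invariant_set K" and cpt: "compact K" using hyp by (auto simp: hyperbolic_set_def invariant_set_def)
  obtain M where M: "\<And>z. z \<in> K \<Longrightarrow> cmod z \<le> M"
    using compact_imp_bounded[OF cpt] bounded_iff by blast
  obtain N where N: "N \<ge> 1" "\<And>z. z \<in> K \<Longrightarrow> cmod (deriv (f ^^ N) z) \<ge> 4"
    using hyperbolic_deriv_growth[OF hyp] by blast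
  obtain \<rho> where \<rho>: "\<rho> > 0" and loc: "\<And>z. z \<in> K \<Longrightarrow> \<exists>g. g holomorphic_on ball ((f ^^ N) z) \<rho> \<and>
    (\<forall>u\<in>ball ((f ^^ N) z) \<rho>. regular_upto f N (g u) \<and> (f ^^ N) (g u) = u \<and> cmod (g u - z) \<le> cmod (u - (f ^^ N) z))"
    using expanding_local_inverse[OF cpt inv N(2)] by blast
  have branch: "\<exists>g. g holomorphic_on ball ((f ^^ (N * k)) z) \<rho> \<and>
    (\<forall>u\<in>ball ((f ^^ (N * k)) z) \<rho>. regular_upto f (N * k) (g u) \<and> (f ^^ (N * k)) (g u) = u \<and>
       cmod (g u - z) \<le> cmod (u - (f ^^ (N * k)) z))" if "z \<in> K" for z k
    using that
  proof (induction k arbitrary: z)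
    case 0
    show ?case by (rule exI[of _ "\<lambda>u. u"]) (auto simp: regular_upto_def)
  next
    case (Suc k)
    let ?z = "(f ^^ N) z" and ?w = "(f ^^ (N * Suc k)) z"
    have w: "?w = (f ^^ (N * k)) ?z" by (simp add: funpow_add[symmetric, THEN fun_cong, unfolded o_def] add.commute)
    obtain h where h: "h holomorphic_on ball ?w \<rho>" "\<And>u. u \<in> ball ?w \<rho> \<Longrightarrow>
        regular_upto f (N * k) (h u) \<and> (f ^^ (N * k)) (h u) = u \<and> cmod (h u - ?z) \<le> cmod (u - ?w)"
      using Suc.IH[OF invariant_funpow[OF inv Suc.prems, of N]] unfolding w by blast
    obtain g where g: "g holomorphic_on ball ?z \<rho>" "\<And>u. u \<in> ball ?z \<rho> \<Longrightarrow>
        regular_upto f N (g u) \<and> (f ^^ N) (g u) = u \<and> cmod (g u - z) \<le> cmod (u - ?z)"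
      using loc[OF Suc.prems] by blast
    have hb: "h u \<in> ball ?z \<rho>" if "u \<in> ball ?w \<rho>" for u
      using h(2)[OF that] that by (simp add: dist_norm norm_minus_commute)
    have "regular_upto f (N * Suc k) (g (h u)) \<and> (f ^^ (N * Suc k)) (g (h u)) = u \<and> cmod (g (h u) - z) \<le> cmod (u - ?w)"
      if u: "u \<in> ball ?w \<rho>" for u
    proof -
      have "(f ^^ (N * Suc k)) (g (h u)) = (f ^^ (N * k)) ((f ^^ N) (g (h u)))"
        by (simp add: funpow_add[symmetric, THEN fun_cong, unfolded o_def] add.commute)
      then show ?thesis using h(2)[OF u] g(2)[OF hb[OF u]] by (simp add: regular_upto_add)
    qed
    moreover have "g \<circ> h holomorphic_on ball ?w \<rho>"
      by (rule holomorphic_on_compose_gen[OF h(1) g(1)]) (use hb in auto)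
    ultimately show ?case unfolding o_def by (intro exI[of _ "\<lambda>u. g (h u)"]) auto
  qed
  define \<eta> where "\<eta> = 1 / sqrt (1 + M\<^sup>2)"
  define B where "B = 2 * sqrt (1 + M\<^sup>2)"
  have \<eta>: "\<eta> > 0" by (simp add: \<eta>_def add_pos_nonneg)
  have "sqrt (1 + M\<^sup>2) \<ge> \<bar>M\<bar>" by (rule real_le_rsqrt) simp
  then have B: "M \<le> B" "B \<ge> 0" unfolding B_def by auto
  have B2: "1 + B\<^sup>2 > 0" by (simp add: add_pos_nonneg)
  \<comment> \<open>The first term keeps the chordal disk away from infinity and its points below
    modulus \<open>B\<close>; the second then puts it into the Euclidean ball of radius
    \<open>\<rho>\<close>.\<close>
  define \<delta> where "\<delta> = min \<eta> (\<rho> / (1 + B\<^sup>2))"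
  have \<delta>: "\<delta> > 0" "\<delta> \<le> \<eta>" "(1 + B\<^sup>2) * \<delta> \<le> \<rho>"
  proof -
    show "\<delta> > 0" using \<eta> \<rho> B2 by (simp add: \<delta>_def)
    show "\<delta> \<le> \<eta>" by (simp add: \<delta>_def)
    have "\<delta> \<le> \<rho> / (1 + B\<^sup>2)" by (simp add: \<delta>_def)
    then show "(1 + B\<^sup>2) * \<delta> \<le> \<rho>" using B2 by (simp add: pos_le_divide_eq mult.commute)
  qed
  have "conformal_pullback f (N * k) z \<delta>" for k
  proof -
    let ?c = "(f ^^ (N * k)) z"
    let ?D = "{u. chordal (Some u) (Some ?c) < \<delta>}"
    have c: "cmod ?c \<le> M" by (intro M invariant_funpow[OF inv z])
    obtain g where g: "g holomorphic_on ball ?c \<rho>" "\<And>u. u \<in> ball ?c \<rho> \<Longrightarrow>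
        regular_upto f (N * k) (g u) \<and> (f ^^ (N * k)) (g u) = u \<and> cmod (g u - z) \<le> cmod (u - ?c)"
      using branch[OF z] by blast
    have near: "\<exists>u. q = Some u \<and> cmod u \<le> B" if "chordal q (Some ?c) < \<delta>" for q
      using chordal_near_finite[OF c, of q] that \<delta>(2) unfolding \<eta>_def B_def by auto
    show ?thesis
    proof (rule conformal_pullbackI[OF \<rho>, of ?c _ g])
      show "g ?c = z" using g(2)[of ?c] \<rho> by simp
      show "{q. chordal q (Some ?c) < \<delta>} = Some ` ?D" using near by auto
      show "?D \<subseteq> ball ?c \<rho>"
      proof
        fix u assume u: "u \<in> ?D"
        then have "cmod u \<le> B" using near[of "Some u"] by simp
        then have "2 * cmod (u - ?c) \<le> (1 + B\<^sup>2) * chordal (Some u) (Some ?c)"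
          using c B by (intro cmod_diff_le_chordal) auto
        also have "\<dots> < (1 + B\<^sup>2) * \<delta>" using u B2 by (intro mult_strict_left_mono) auto
        finally have "cmod (u - ?c) < \<rho>" using \<delta>(3) norm_ge_zero[of "u - ?c"] by linarith
        then show "u \<in> ball ?c \<rho>" by (simp add: dist_norm norm_minus_commute)
      qed
      show "connected ?D"
      proof (rule connected_chordal_disk[OF \<delta>(1)])
        have M1: "1 + M\<^sup>2 > 0" by (simp add: add_pos_nonneg)
        have "\<delta>\<^sup>2 * (1 + (cmod ?c)\<^sup>2) \<le> \<eta>\<^sup>2 * (1 + M\<^sup>2)"
          using \<delta> c by (intro mult_mono power_mono add_mono) auto
        also have "\<dots> = 1" using M1 by (simp add: \<eta>_def power_divide)
        finally show "\<delta>\<^sup>2 * (1 + (cmod ?c)\<^sup>2) < 4" by simp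
      qed
      have "open {u. dist (stereo (Some u)) (stereo (Some ?c)) < \<delta>}"
        by (intro open_Collect_less continuous_intros continuous_on_stereo_Some)
      then show "open ?D" by (simp only: chordal_eq_dist)
      show "?c \<in> ?D" using \<delta> chordal_self by simp
    qed (use g in auto)
  qed
  then have "\<exists>\<^sub>\<infinity>n. conformal_pullback f n z \<delta>"
    unfolding INFM_nat_le using N(1) by (metis le_square mult.commute mult_le_mono2 nat_mult_1_right)
  moreover have "z \<in> iter_dom f n" for n
    using invariant_regular[OF inv z, of "n - 1"] by (cases n) (auto simp: iter_dom_iff)
  ultimately show "z \<in> radial_julia f"
    unfolding radial_julia_def julia_def using hyperbolic_not_fatou[OF hyp z] \<delta>(1) by blast
qed

end

subsection \<open>Iterated function systems\<close>

text \<open>Induction on the number of covering sets: a set meeting two of the pieces has diameter at least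
  the gap, and otherwise the sets covering one piece are pulled back to a smaller cover of \<open>K\<close>.\<close>
lemma ifs_finite_cover_bound:
  fixes \<phi> :: "'i \<Rightarrow> complex \<Rightarrow> complex" and K :: "complex set"
  assumes fin: "finite I" and two: "2 \<le> card I" and K: "K \<noteq> {}" "K = (\<Union>i\<in>I. \<phi> i ` K)"
    and sep: "\<And>i j x y. \<lbrakk>i \<in> I; j \<in> I; i \<noteq> j; x \<in> \<phi> i ` K; y \<in> \<phi> j ` K\<rbrakk> \<Longrightarrow> d \<le> cmod (x - y)"
    and rat: "\<And>i. i \<in> I \<Longrightarrow> rat i > 0"
    and low: "\<And>i x y. \<lbrakk>i \<in> I; x \<in> K; y \<in> K\<rbrakk> \<Longrightarrow> rat i * cmod (x - y) \<le> cmod (\<phi> i x - \<phi> i y)"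
    and d: "d > 0" and t: "t > 0" and sum: "(\<Sum>i\<in>I. rat i powr t) \<ge> 1"
    and J: "finite (J :: nat set)" "K \<subseteq> (\<Union>j\<in>J. U j)"
    and D: "\<And>j x y. \<lbrakk>j \<in> J; x \<in> U j; y \<in> U j; x \<in> K; y \<in> K\<rbrakk> \<Longrightarrow> cmod (x - y) \<le> D j"
    and D0: "\<And>j. j \<in> J \<Longrightarrow> 0 \<le> D j"
  shows "d powr t \<le> (\<Sum>j\<in>J. D j powr t)"
  using J D D0
proof (induction "card J" arbitrary: J U D rule: less_induct)
  case less
  show ?case
  proof (cases "\<exists>j\<in>J. d \<le> D j")
    case True
    then obtain j where j: "j \<in> J" "d \<le> D j" by blast
    have "d powr t \<le> D j powr t" using j d t by (intro powr_mono2) auto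
    also have "\<dots> \<le> (\<Sum>j\<in>J. D j powr t)" using j less.prems(1) by (intro member_le_sum) auto
    finally show ?thesis .
  next
    case False
    define P where "P = (\<lambda>i. {j \<in> J. U j \<inter> \<phi> i ` K \<noteq> {}})"
    have sub: "\<phi> i ` K \<subseteq> K" if "i \<in> I" for i using K(2) that by blast
    have disj: "P i \<inter> P k = {}" if "i \<in> I" "k \<in> I" "i \<noteq> k" for i k
    proof (rule ccontr)
      assume "P i \<inter> P k \<noteq> {}"
      then obtain j x y where j: "j \<in> J" "x \<in> U j" "x \<in> \<phi> i ` K" "y \<in> U j" "y \<in> \<phi> k ` K"
        unfolding P_def by blast
      then have "cmod (x - y) \<le> D j" using sub that by (intro less.prems(3)) auto
      moreover have "d \<le> cmod (x - y)" using sep that j by blast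
      ultimately show False using False j(1) by force
    qed
    have ne: "P i \<noteq> {}" if "i \<in> I" for i
    proof -
      obtain x where "x \<in> K" using K(1) by blast
      then have "\<phi> i x \<in> K" using sub[OF that] by blast
      then obtain j where "j \<in> J" "\<phi> i x \<in> U j" using less.prems(2) by blast
      then show ?thesis unfolding P_def using \<open>x \<in> K\<close> by blast
    qed
    have finP: "finite (P i)" for i unfolding P_def using less.prems(1) by simp
    have part: "rat i powr t * d powr t \<le> (\<Sum>j\<in>P i. D j powr t)" if i: "i \<in> I" for i
    proof -
      \<comment> \<open>A second piece uses covering sets that do not meet the first, so
        \<open>P i\<close> is strictly smaller than \<open>J\<close> and the induction
        applies.\<close>
      have "\<exists>k\<in>I. k \<noteq> i"
      proof (rule ccontr)
        assume "\<not> ?thesis"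
        then have "I \<subseteq> {i}" by blast
        then have "card I \<le> 1" using card_mono[of "{i}" I] by simp
        then show False using two by simp
      qed
      then obtain k where k: "k \<in> I" "k \<noteq> i" by blast
      obtain j where "j \<in> P k" using ne[OF k(1)] by blast
      then have "j \<notin> P i" "j \<in> J" using disj[OF i k(1)] k(2) by (auto simp: P_def)
      moreover have "P i \<subseteq> J" by (simp add: P_def)
      ultimately have "P i \<subset> J" by blast
      then have cd: "card (P i) < card J" using less.prems(1) by (intro psubset_card_mono)
      let ?U = "\<lambda>j. \<phi> i -` U j"
      have "d powr t \<le> (\<Sum>j\<in>P i. (D j / rat i) powr t)"
      proof (rule less.hyps[OF cd finP, of ?U])
        show "K \<subseteq> (\<Union>j\<in>P i. ?U j)"
        proof
          fix x assume x: "x \<in> K"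
          then have "\<phi> i x \<in> K" using sub[OF i] by blast
          then obtain j where "j \<in> J" "\<phi> i x \<in> U j" using less.prems(2) by blast
          then show "x \<in> (\<Union>j\<in>P i. ?U j)" unfolding P_def using x by blast
        qed
        show "cmod (x - y) \<le> D j / rat i"
          if "j \<in> P i" "x \<in> ?U j" "y \<in> ?U j" "x \<in> K" "y \<in> K" for j x y
        proof -
          have "cmod (\<phi> i x - \<phi> i y) \<le> D j"
            using that sub[OF i] by (intro less.prems(3)) (auto simp: P_def)
          then have "rat i * cmod (x - y) \<le> D j" using low[OF i that(4,5)] by linarith
          then show ?thesis using rat[OF i] by (simp add: pos_le_divide_eq mult.commute)
        qed
        show "0 \<le> D j / rat i" if "j \<in> P i" for j
          using that less.prems(4)[of j] rat[OF i] by (auto simp: P_def)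
      qed
      then have "rat i powr t * d powr t \<le> rat i powr t * (\<Sum>j\<in>P i. (D j / rat i) powr t)"
        by (rule mult_left_mono) simp
      also have "\<dots> = (\<Sum>j\<in>P i. D j powr t)"
        unfolding sum_distrib_left
      proof (rule sum.cong)
        fix j assume "j \<in> P i"
        then have "D j \<ge> 0" using less.prems(4) by (auto simp: P_def)
        then show "rat i powr t * (D j / rat i) powr t = D j powr t"
          using rat[OF i] by (simp add: powr_mult[symmetric])
      qed simp
      finally show ?thesis .
    qed
    have "d powr t * 1 \<le> d powr t * (\<Sum>i\<in>I. rat i powr t)" using sum by (intro mult_left_mono) auto
    also have "\<dots> = (\<Sum>i\<in>I. rat i powr t * d powr t)" by (simp add: sum_distrib_left mult.commute)
    also have "\<dots> \<le> (\<Sum>i\<in>I. \<Sum>j\<in>P i. D j powr t)" by (intro sum_mono part)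
    also have "\<dots> = (\<Sum>j\<in>(\<Union>i\<in>I. P i). D j powr t)"
      by (rule sum.UNION_disjoint[symmetric]) (use fin finP disj in auto)
    also have "\<dots> \<le> (\<Sum>j\<in>J. D j powr t)"
      using less.prems(1) by (intro sum_mono2) (auto simp: P_def)
    finally show ?thesis by simp
  qed
qed

text \<open>Compactness reduces a countable cover to a finite one, to which the combinatorial bound
  \<open>d powr t\<close> applies; this contradicts arbitrarily small total cost.\<close>

lemma ifs_not_hausdorff_null:
  fixes \<phi> :: "'i \<Rightarrow> complex \<Rightarrow> complex" and K :: "complex set"
  assumes cpt: "compact K"
    and fin: "finite I" and two: "2 \<le> card I" and K: "K \<noteq> {}" "K = (\<Union>i\<in>I. \<phi> i ` K)"
    and sep: "\<And>i j x y. \<lbrakk>i \<in> I; j \<in> I; i \<noteq> j; x \<in> \<phi> i ` K; y \<in> \<phi> j ` K\<rbrakk> \<Longrightarrow> d \<le> cmod (x - y)"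
    and rat: "\<And>i. i \<in> I \<Longrightarrow> rat i > 0"
    and low: "\<And>i x y. \<lbrakk>i \<in> I; x \<in> K; y \<in> K\<rbrakk> \<Longrightarrow> rat i * cmod (x - y) \<le> cmod (\<phi> i x - \<phi> i y)"
    and d: "d > 0" and t: "t > 0" and sum: "(\<Sum>i\<in>I. rat i powr t) \<ge> 1"
  shows "hausdorff_measure t K \<noteq> 0"
proof
  assume null: "hausdorff_measure t K = 0"
  obtain M where M: "\<And>x. x \<in> K \<Longrightarrow> cmod x \<le> M" using compact_imp_bounded[OF cpt] bounded_iff by blast
  define C where "C = 1 + M\<^sup>2"
  have C: "C > 0" unfolding C_def by (simp add: add_pos_nonneg)
  \<comment> \<open>Chosen so that the final estimate of the cover sum is
    \<open>d powr t / 4\<close>. The factor \<open>2 powr t\<close> comes from bounding a sum by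
    twice the maximum before taking powers.\<close>
  define \<epsilon> where "\<epsilon> = d powr t / (4 * 2 powr t * (C powr t + 1))"
  have den: "4 * 2 powr t * (C powr t + 1) > 0" by (intro mult_pos_pos add_nonneg_pos) auto
  have \<epsilon>: "\<epsilon> > 0" unfolding \<epsilon>_def using d den by (intro divide_pos_pos) auto
  have "0 < ennreal \<epsilon>" using \<epsilon> by simp
  from hausdorff_null_cover[OF null this] obtain U where U: "K \<subseteq> (\<Union>i. U i)"
    and sumU: "(\<Sum>i. ennreal (hcost t (U i))) < ennreal \<epsilon>" by (elim exE conjE)
  define \<beta> where "\<beta> = (\<lambda>j::nat. (\<epsilon> * (1/2) ^ Suc j) powr (1/t))"
  have \<beta>: "\<beta> j > 0" "\<beta> j powr t = \<epsilon> * (1/2) ^ Suc j" for j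
    using \<epsilon> t by (simp_all add: \<beta>_def powr_powr)
  \<comment> \<open>The covering sets are fattened to open sets; the increase
    \<open>\<beta> j\<close> in diameter has summable \<open>t\<close>-th powers with total at most
    \<open>\<epsilon>\<close>.\<close>
  define V where "V = (\<lambda>j. \<Union>u\<in>U j \<inter> K. ball u (\<beta> j / 2))"
  define D where "D = (\<lambda>j. C * sdiam (U j) + \<beta> j)"
  have "K \<subseteq> (\<Union>j. V j)"
  proof
    fix x assume x: "x \<in> K"
    then obtain j where "x \<in> U j" using U by blast
    moreover have "x \<in> ball x (\<beta> j / 2)" using \<beta>(1)[of j] by simp
    ultimately show "x \<in> (\<Union>j. V j)" unfolding V_def using x by blast
  qed
  moreover have "open (V j)" for j unfolding V_def by auto
  ultimately obtain J where J: "finite J" "K \<subseteq> (\<Union>j\<in>J. V j)"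
    using compactE_image[OF cpt, of UNIV V] by auto
  have "d powr t \<le> (\<Sum>j\<in>J. D j powr t)"
  proof (rule ifs_finite_cover_bound[OF fin two K sep rat low d t sum J])
    show "0 \<le> D j" for j unfolding D_def using C sdiam_nonneg[of "U j"] \<beta>(1)[of j] by (simp add: add_nonneg_nonneg)
    show "cmod (x - y) \<le> D j" if xy: "x \<in> V j" "y \<in> V j" for j x y
    proof -
      obtain u v where uv: "u \<in> U j" "u \<in> K" "v \<in> U j" "v \<in> K" "cmod (x - u) < \<beta> j / 2" "cmod (y - v) < \<beta> j / 2"
        using xy by (auto simp: V_def dist_norm norm_minus_commute)
      have "2 * cmod (u - v) \<le> C * chordal (Some u) (Some v)"
        unfolding C_def using M uv by (intro cmod_diff_le_chordal) auto
      also have "\<dots> \<le> C * sdiam (U j)" using C uv by (intro mult_left_mono chordal_le_sdiam) auto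
      finally have "cmod (u - v) \<le> C * sdiam (U j)" using norm_ge_zero[of "u - v"] by linarith
      moreover have "cmod (x - y) \<le> cmod (x - u) + cmod (u - v) + cmod (y - v)"
        using norm_triangle_ineq[of "x - u" "u - y"] norm_triangle_ineq4[of "u - v" "y - v"] by simp
      ultimately show ?thesis unfolding D_def using uv by linarith
    qed
  qed
  also have "\<dots> \<le> (\<Sum>j\<in>J. 2 powr t * (C powr t * hcost t (U j) + \<epsilon> * (1/2) ^ Suc j))"
  proof (rule sum_mono)
    fix j
    have nn: "C * sdiam (U j) \<ge> 0" using C sdiam_nonneg by simp
    have "D j \<le> 2 * max (C * sdiam (U j)) (\<beta> j)" unfolding D_def by simp
    then have "D j powr t \<le> (2 * max (C * sdiam (U j)) (\<beta> j)) powr t"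
      using nn \<beta>(1)[of j] t unfolding D_def by (intro powr_mono2) auto
    also have "\<dots> = 2 powr t * max (C * sdiam (U j)) (\<beta> j) powr t"
      using nn by (subst powr_mult) auto
    also have "max (C * sdiam (U j)) (\<beta> j) powr t \<le> (C * sdiam (U j)) powr t + \<beta> j powr t"
      unfolding max_def by auto
    also have "(C * sdiam (U j)) powr t = C powr t * hcost t (U j)"
      using C sdiam_nonneg by (simp add: powr_mult hcost_pos[OF t])
    finally show "D j powr t \<le> 2 powr t * (C powr t * hcost t (U j) + \<epsilon> * (1/2) ^ Suc j)"
      by (simp add: \<beta>(2))
  qed
  also have "\<dots> = 2 powr t * (C powr t * (\<Sum>j\<in>J. hcost t (U j)) + \<epsilon> * (\<Sum>j\<in>J. (1/2) ^ Suc j))"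
    by (simp only: sum_distrib_left sum.distrib ring_distribs)
  also have "\<dots> \<le> 2 powr t * (C powr t * \<epsilon> + \<epsilon> * 1)"
  proof (intro mult_left_mono add_mono)
    have "ennreal (\<Sum>j\<in>J. hcost t (U j)) = (\<Sum>j\<in>J. ennreal (hcost t (U j)))"
      by (simp add: hcost_nonneg sum_ennreal)
    also have "\<dots> \<le> (\<Sum>i. ennreal (hcost t (U i)))" using J by (intro sum_le_suminf) auto
    also note less_imp_le[OF sumU]
    finally show "(\<Sum>j\<in>J. hcost t (U j)) \<le> \<epsilon>" using \<epsilon> by (simp add: ennreal_le_iff)
    have "(\<Sum>j\<in>J. (1/2) ^ Suc j) \<le> (\<Sum>j. (1/2) ^ Suc j :: real)"
      using J power_half_series by (intro sum_le_suminf) (auto simp: sums_iff)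
    then show "(\<Sum>j\<in>J. (1/2) ^ Suc j) \<le> (1::real)" using power_half_series by (simp add: sums_iff)
  qed (use \<epsilon> in auto)
  also have "\<dots> = 2 powr t * (C powr t + 1) * \<epsilon>" by (simp add: algebra_simps)
  also have "\<dots> = d powr t / 4" unfolding \<epsilon>_def using den by (simp add: field_simps)
  finally have "d powr t \<le> d powr t / 4" .
  moreover have "d powr t > 0" using d by simp
  ultimately show False by linarith
qed

text \<open>The limit set is the nested intersection of the images of \<open>X\<close>. No
  contraction enters: injectivity and disjointness of the pieces make the preimage of a point of
  \<open>K\<close> unique, so the same preimage lies in every stage.\<close>

lemma ifs_limit_set:
  fixes \<phi> :: "'i \<Rightarrow> complex \<Rightarrow> complex"
  assumes X: "compact X" "X \<noteq> {}" and I: "finite I" "I \<noteq> {}"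
    and cont: "\<And>i. i \<in> I \<Longrightarrow> continuous_on X (\<phi> i)" and inj: "\<And>i. i \<in> I \<Longrightarrow> inj_on (\<phi> i) X"
    and sub: "\<And>i. i \<in> I \<Longrightarrow> \<phi> i ` X \<subseteq> X"
    and disj: "\<And>i j. \<lbrakk>i \<in> I; j \<in> I; i \<noteq> j\<rbrakk> \<Longrightarrow> \<phi> i ` X \<inter> \<phi> j ` X = {}"
  shows "\<exists>K. compact K \<and> K \<noteq> {} \<and> K \<subseteq> X \<and> K = (\<Union>i\<in>I. \<phi> i ` K)"
proof -
  define T where "T = (\<lambda>S. \<Union>i\<in>I. \<phi> i ` S)"
  define F where "F = (\<lambda>n. (T ^^ n) X)"
  have F0: "F 0 = X" and FS: "F (Suc n) = T (F n)" for n by (simp_all add: F_def)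
  have mono: "S \<subseteq> S' \<Longrightarrow> T S \<subseteq> T S'" for S S' unfolding T_def by blast
  have dec: "F (Suc n) \<subseteq> F n" for n
  proof (induction n)
    case 0 show ?case using sub unfolding FS F0 T_def by blast
  next
    case (Suc n) then show ?case using mono FS by metis
  qed
  have FX: "F n \<subseteq> X" for n
    using lift_Suc_antimono_le[of F, OF dec, of 0 n] F0 by simp
  have cpt: "compact (F n)" for n
  proof (induction n)
    case (Suc n)
    show ?case unfolding FS T_def
      by (intro compact_UN I compact_continuous_image continuous_on_subset[OF cont FX] Suc)
  qed (simp add: F0 X)
  have ne: "F n \<noteq> {}" for n
  proof (induction n)
    case (Suc n) then show ?case using I unfolding FS T_def by blast
  qed (simp add: F0 X)
  define K where "K = (\<Inter>n. F n)"
  have "K \<noteq> {}" unfolding K_def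
    by (rule compact_nest[OF cpt ne]) (rule lift_Suc_antimono_le[of F, OF dec])
  moreover have "compact K" unfolding K_def by (rule compact_Inter) (use cpt in auto)
  moreover have KX: "K \<subseteq> X" unfolding K_def using FX by blast
  moreover have "K = (\<Union>i\<in>I. \<phi> i ` K)"
  proof
    show "(\<Union>i\<in>I. \<phi> i ` K) \<subseteq> K"
    proof
      fix x assume "x \<in> (\<Union>i\<in>I. \<phi> i ` K)"
      then have "x \<in> F (Suc n)" for n unfolding FS T_def K_def by blast
      then show "x \<in> K" unfolding K_def using dec by blast
    qed
    show "K \<subseteq> (\<Union>i\<in>I. \<phi> i ` K)"
    proof
      fix x assume x: "x \<in> K"
      then have "x \<in> F (Suc 0)" unfolding K_def by blast
      then obtain i y where i: "i \<in> I" "y \<in> X" "x = \<phi> i y" unfolding FS F0 T_def by blast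
      have "y \<in> F n" for n
      proof -
        have "x \<in> F (Suc n)" using x unfolding K_def by blast
        then obtain j y' where j: "j \<in> I" "y' \<in> F n" "x = \<phi> j y'" unfolding FS T_def by blast
        have y'X: "y' \<in> X" using j FX by blast
        have "j = i" using disj[OF i(1) j(1)] i j y'X by blast
        then have "y = y'" using inj[OF i(1)] i j y'X by (auto dest: inj_onD)
        then show ?thesis using j by simp
      qed
      then have "y \<in> K" unfolding K_def by blast
      then show "x \<in> (\<Union>i\<in>I. \<phi> i ` K)" using i by blast
    qed
  qed
  ultimately show ?thesis by blast
qed

subsection \<open>Hyperbolic sets from inverse branches\<close>

text \<open>The fivefold enlargements of a disjoint subfamily cover \<open>S\<close>, so finitely
  many radii have a \<open>t'\<close>-sum bounded below by the content of \<open>S\<close>. As all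
  radii are at most \<open>\<epsilon>\<close>, passing to the smaller exponent \<open>t\<close>
  multiplies each term by at least \<open>1 / q\<close>, which can be made as large as
  desired.\<close>

lemma vitali_finite_subfamily:
  fixes S :: "complex set"
  assumes t: "0 < t" "t < t'" and nn: "hausdorff_measure t' S \<noteq> 0" and M: "M > 0"
  shows "\<exists>\<epsilon>>0. \<forall>(a :: complex \<Rightarrow> complex) r. (\<forall>x\<in>S. 0 < r x \<and> r x \<le> \<epsilon> \<and> x \<in> cball (a x) (r x)) \<longrightarrow>
    (\<exists>F\<subseteq>S. finite F \<and> pairwise (\<lambda>i j. disjnt (cball (a i) (r i)) (cball (a j) (r j))) F \<and>
       M < (\<Sum>x\<in>F. r x powr t))"
proof -
  have t': "t' > 0" using t by simp
  have "\<exists>\<delta>>0. hausdorff_pre t' \<delta> S \<noteq> 0"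
  proof (rule ccontr)
    assume "\<not> ?thesis"
    then have "hausdorff_measure t' S \<le> 0" unfolding hausdorff_measure_def by (intro SUP_least) simp
    then show False using nn by simp
  qed
  then obtain \<delta> where \<delta>: "\<delta> > 0" and pre: "hausdorff_pre t' \<delta> S \<noteq> 0" by blast
  \<comment> \<open>The truncation at \<open>1\<close> keeps \<open>c\<close> finite even if the
    content of \<open>S\<close> is infinite.\<close>
  define c where "c = enn2real (min 1 (hausdorff_pre t' \<delta> S))"
  have ec: "ennreal c = min 1 (hausdorff_pre t' \<delta> S)"
    unfolding c_def by (rule ennreal_enn2real) (simp add: min_less_iff_disj)
  have c: "c > 0"
  proof (rule ccontr)
    assume "\<not> c > 0"
    then have "ennreal c = 0" by (simp add: ennreal_neg)
    then show False using ec pre by (simp add: min_def split: if_splits)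
  qed
  have cpre: "ennreal c \<le> hausdorff_pre t' \<delta> S" unfolding ec by simp
  \<comment> \<open>The factor \<open>20\<close> is \<open>5\<close> from Vitali, \<open>2\<close>
    from radius to diameter, and \<open>2\<close> from Euclidean to chordal distance.\<close>
  define q where "q = c / (2 * 20 powr t' * M)"
  have q: "q > 0" unfolding q_def using c M by simp
  define \<epsilon> where "\<epsilon> = min (\<delta>/20) (q powr (1 / (t' - t)))"
  have \<epsilon>: "\<epsilon> > 0" "\<epsilon> \<le> \<delta>/20" unfolding \<epsilon>_def using \<delta> q by auto
  have \<epsilon>q: "\<epsilon> powr (t' - t) \<le> q"
  proof -
    have "\<epsilon> powr (t' - t) \<le> (q powr (1 / (t' - t))) powr (t' - t)"
      using \<epsilon> t by (intro powr_mono2) (auto simp: \<epsilon>_def)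
    also have "\<dots> = q" using q t by (simp add: powr_powr)
    finally show ?thesis .
  qed
  show ?thesis
  proof (intro exI[of _ \<epsilon>] conjI \<epsilon> allI impI)
    fix a :: "complex \<Rightarrow> complex" and r :: "complex \<Rightarrow> real"
    assume ar: "\<forall>x\<in>S. 0 < r x \<and> r x \<le> \<epsilon> \<and> x \<in> cball (a x) (r x)"
    then have r01: "\<And>x. x \<in> S \<Longrightarrow> 0 < r x \<and> r x \<le> \<epsilon>" by blast
    obtain J where J: "countable J" "J \<subseteq> S"
      and pw: "pairwise (\<lambda>i j. disjnt (cball (a i) (r i)) (cball (a j) (r j))) J"
      and cov: "\<And>i. i \<in> S \<Longrightarrow> \<exists>j. j \<in> J \<and> \<not> disjnt (cball (a i) (r i)) (cball (a j) (r j)) \<and>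
          cball (a i) (r i) \<subseteq> ball (a j) (5 * r j)"
      by (rule Vitali_covering_lemma_cballs_balls[of S r \<epsilon> a]) (use r01 in blast)+
    have "\<exists>F\<subseteq>J. finite F \<and> c / 2 < (\<Sum>x\<in>F. (20 * r x) powr t')"
    proof (rule ccontr)
      assume "\<not> ?thesis"
      then have small: "(\<Sum>x\<in>F. (20 * r x) powr t') \<le> c / 2" if "F \<subseteq> J" "finite F" for F
        using that by (meson not_less)
      \<comment> \<open>The countable index set is transported to the naturals to form a sequence of
        covering sets; the remaining indices carry the empty set, which costs nothing.\<close>
      define N where "N = to_nat_on J ` J"
      define e where "e = from_nat_into J"
      define U where "U = (\<lambda>n. if n \<in> N then ball (a (e n)) (5 * r (e n)) else {})"
      have eto: "e (to_nat_on J x) = x" if "x \<in> J" for x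
        unfolding e_def using J(1) that by simp
      have eN: "e n \<in> J" if "n \<in> N" for n using that eto unfolding N_def by auto
      have einj: "inj_on e N" unfolding N_def by (rule inj_onI) (auto simp: eto)
      have diam: "sdiam (ball (a x) (5 * r x)) \<le> 20 * r x" if "x \<in> J" for x
      proof (rule sdiam_le)
        fix u v assume uv: "u \<in> ball (a x) (5 * r x)" "v \<in> ball (a x) (5 * r x)"
        have "chordal (Some u) (Some v) \<le> 2 * cmod (u - v)" by (rule chordal_Some_le)
        also have "cmod (u - v) \<le> dist (a x) u + dist (a x) v"
          using dist_triangle[of u v "a x"] by (simp add: dist_norm norm_minus_commute)
        finally show "chordal (Some u) (Some v) \<le> 20 * r x" using uv by simp
      qed (use r01 J that in force)
      have "S \<subseteq> (\<Union>n. U n)"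
      proof
        fix x assume x: "x \<in> S"
        then obtain j where j: "j \<in> J" "cball (a x) (r x) \<subseteq> ball (a j) (5 * r j)" using cov by blast
        have "x \<in> ball (a j) (5 * r j)" using j ar x by blast
        moreover have "to_nat_on J j \<in> N" using j by (simp add: N_def)
        ultimately have "x \<in> U (to_nat_on J j)" using eto[OF j(1)] by (simp add: U_def)
        then show "x \<in> (\<Union>n. U n)" by blast
      qed
      moreover have "sdiam (U n) \<le> \<delta>" for n
      proof (cases "n \<in> N")
        case True
        have "20 * r (e n) \<le> \<delta>" using r01[of "e n"] eN[OF True] J(2) \<epsilon>(2) by force
        then show ?thesis using diam[OF eN[OF True]] True by (simp add: U_def)
      qed (use \<delta> in \<open>simp add: U_def sdiam_def\<close>)
      ultimately have "hausdorff_pre t' \<delta> S \<le> (\<Sum>i. ennreal (hcost t' (U i)))"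
        unfolding hausdorff_pre_def by (intro INF_lower) auto
      also have "\<dots> = (SUP m. \<Sum>i<m. ennreal (hcost t' (U i)))" by (rule suminf_eq_SUP)
      also have "\<dots> \<le> ennreal (c / 2)"
      proof (rule SUP_least)
        fix m
        have "(\<Sum>i<m. ennreal (hcost t' (U i))) = ennreal (\<Sum>i<m. hcost t' (U i))"
          by (rule sum_ennreal) (rule hcost_nonneg)
        also have "(\<Sum>i<m. hcost t' (U i)) = (\<Sum>i\<in>{..<m} \<inter> N. hcost t' (U i))"
          by (rule sum.mono_neutral_right) (auto simp: U_def hcost_def)
        also have "\<dots> \<le> (\<Sum>i\<in>{..<m} \<inter> N. (20 * r (e i)) powr t')"
        proof (rule sum_mono)
          fix i assume "i \<in> {..<m} \<inter> N"
          then have i: "i \<in> N" by blast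
          show "hcost t' (U i) \<le> (20 * r (e i)) powr t'"
            unfolding hcost_pos[OF t'] using i diam[OF eN[OF i]] sdiam_nonneg t'
            by (intro powr_mono2) (auto simp: U_def)
        qed
        also have "\<dots> = (\<Sum>x\<in>e ` ({..<m} \<inter> N). (20 * r x) powr t')"
          by (rule sum.reindex_cong[symmetric, OF _ refl refl, of e, simplified]) (rule inj_on_subset[OF einj], blast)
        also have "\<dots> \<le> c / 2" using eN by (intro small) auto
        finally show "(\<Sum>i<m. ennreal (hcost t' (U i))) \<le> ennreal (c / 2)" by (simp add: ennreal_leI)
      qed
      finally have "ennreal c \<le> ennreal (c / 2)" using cpre by (rule order_trans[rotated])
      then show False using c by (simp add: ennreal_le_iff)
    qed
    then obtain F where F: "F \<subseteq> J" "finite F" and big: "c / 2 < (\<Sum>x\<in>F. (20 * r x) powr t')" by blast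
    have "(\<Sum>x\<in>F. (20 * r x) powr t') \<le> (\<Sum>x\<in>F. (20 powr t' * q) * r x powr t)"
    proof (rule sum_mono)
      fix x assume "x \<in> F"
      then have r: "0 < r x" "r x \<le> \<epsilon>" using F J r01 by blast+
      have "r x powr (t' - t) \<le> \<epsilon> powr (t' - t)" using r t by (intro powr_mono2) auto
      then have "r x powr (t' - t) \<le> q" using \<epsilon>q by linarith
      moreover have "r x powr t' = r x powr (t' - t) * r x powr t" by (simp add: powr_add[symmetric])
      ultimately have "r x powr t' \<le> q * r x powr t" by (simp add: mult_right_mono)
      then show "(20 * r x) powr t' \<le> (20 powr t' * q) * r x powr t"
        using r by (simp add: powr_mult mult.assoc)
    qed
    also have "\<dots> = (20 powr t' * q) * (\<Sum>x\<in>F. r x powr t)" by (simp add: sum_distrib_left)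
    also have "20 powr t' * q = c / (2 * M)" unfolding q_def using M by (simp add: field_simps)
    finally have "c / 2 < c / (2 * M) * (\<Sum>x\<in>F. r x powr t)" using big by linarith
    then have "M < (\<Sum>x\<in>F. r x powr t)" using c M by (simp add: field_simps)
    moreover have "pairwise (\<lambda>i j. disjnt (cball (a i) (r i)) (cball (a j) (r j))) F"
      using pw F(1) pairwise_subset by blast
    ultimately show "\<exists>F\<subseteq>S. finite F \<and> pairwise (\<lambda>i j. disjnt (cball (a i) (r i)) (cball (a j) (r j))) F \<and>
       M < (\<Sum>x\<in>F. r x powr t)"
      using F J(2) by blast
  qed
qed

lemma finite_separation:
  assumes fin: "finite F" and cpt: "\<And>i. i \<in> F \<Longrightarrow> compact (X i)"
    and disj: "\<And>i j. \<lbrakk>i \<in> F; j \<in> F; i \<noteq> j\<rbrakk> \<Longrightarrow> X i \<inter> X j = {}"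
  shows "\<exists>d>0. \<forall>i\<in>F. \<forall>j\<in>F. i \<noteq> j \<longrightarrow> (\<forall>x\<in>X i. \<forall>y\<in>X j. d \<le> dist x (y :: 'a :: heine_borel))"
proof -
  have "\<exists>d>0. \<forall>x\<in>X i. \<forall>y\<in>X j. d \<le> dist x y" if "i \<in> F" "j \<in> F" "i \<noteq> j" for i j
    using separate_compact_closed[OF cpt[OF that(1)] compact_imp_closed[OF cpt[OF that(2)]] disj[OF that]] by blast
  then have "\<exists>d. i \<in> F \<and> j \<in> F \<and> i \<noteq> j \<longrightarrow> d > 0 \<and> (\<forall>x\<in>X i. \<forall>y\<in>X j. d \<le> dist x y)" for i j
    by blast
  then obtain d where d: "\<And>i j. i \<in> F \<and> j \<in> F \<and> i \<noteq> j \<longrightarrow> d i j > 0 \<and> (\<forall>x\<in>X i. \<forall>y\<in>X j. d i j \<le> dist x y)"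
    by metis
  define P where "P = {(i, j). i \<in> F \<and> j \<in> F \<and> i \<noteq> j}"
  have finP: "finite P" by (rule finite_subset[of _ "F \<times> F"]) (use fin in \<open>auto simp: P_def\<close>)
  \<comment> \<open>The inserted \<open>1\<close> keeps the minimum defined when there are no two
    distinct indices.\<close>
  define m where "m = Min (insert 1 ((\<lambda>(i, j). d i j) ` P))"
  have "m > 0" unfolding m_def using finP d by (subst Min_gr_iff) (auto simp: P_def)
  moreover have "m \<le> d i j" if "i \<in> F" "j \<in> F" "i \<noteq> j" for i j
    unfolding m_def using finP that by (intro Min_le) (auto simp: P_def image_iff)
  ultimately show ?thesis using d by (meson order_trans)
qed

section \<open>From inverse branches to hyperbolic sets\<close>

context meromorphic_map
begin

text \<open>The pieces of \<open>K\<close> return after different times, so \<open>K\<close> must be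
  completed by the intermediate orbit points. A long orbit consists of complete returns, each of
  length at most \<open>m\<close> and expanding by \<open>2\<close>, and of two incomplete ends
  whose contraction is bounded below; hence one common iterate expands everywhere.\<close>

lemma hyperbolic_set_of_ifs:
  fixes \<phi> :: "'i \<Rightarrow> complex \<Rightarrow> complex" and n :: "'i \<Rightarrow> nat"
  assumes I: "finite I" "I \<noteq> {}" and K: "compact K" "K \<noteq> {}" "K = (\<Union>i\<in>I. \<phi> i ` K)"
    and cont: "\<And>i. i \<in> I \<Longrightarrow> continuous_on K (\<phi> i)"
    and n1: "\<And>i. i \<in> I \<Longrightarrow> 1 \<le> n i"
    and reg: "\<And>i x. \<lbrakk>i \<in> I; x \<in> K\<rbrakk> \<Longrightarrow> regular_upto f (n i) (\<phi> i x)"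
    and sec: "\<And>i x. \<lbrakk>i \<in> I; x \<in> K\<rbrakk> \<Longrightarrow> (f ^^ n i) (\<phi> i x) = x"
    and exp: "\<And>i x. \<lbrakk>i \<in> I; x \<in> K\<rbrakk> \<Longrightarrow> 2 \<le> cmod (deriv (f ^^ n i) (\<phi> i x))"
  shows "\<exists>K'. hyperbolic_set f K' \<and> K \<subseteq> K'"
proof -
  define K' where "K' = (\<Union>i\<in>I. \<Union>k<n i. (f ^^ k) ` (\<phi> i ` K))"
  have KK': "K \<subseteq> K'"
  proof
    fix x assume "x \<in> K"
    then obtain i y where i: "i \<in> I" "y \<in> K" "x = \<phi> i y" using K(3) by blast
    then have "x \<in> (f ^^ 0) ` (\<phi> i ` K)" by simp
    moreover have "0 < n i" using n1[OF i(1)] by simp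
    ultimately show "x \<in> K'" unfolding K'_def using i(1) by blast
  qed
  have cptK': "compact K'"
    unfolding K'_def
  proof (intro compact_UN I finite_lessThan compact_continuous_image cont K(1))
    fix i k assume i: "i \<in> I" and k: "k \<in> {..<n i}"
    show "continuous_on (\<phi> i ` K) (f ^^ k)"
    proof (intro holomorphic_on_imp_continuous_on holomorphic_regular)
      fix z assume "z \<in> \<phi> i ` K"
      then have "regular_upto f (n i) z" using reg[OF i] by blast
      then show "regular_upto f k z" by (rule regular_upto_mono) (use k in simp)
    qed
  qed
  have K'E: "\<exists>i w k. i \<in> I \<and> w \<in> K \<and> k < n i \<and> z = (f ^^ k) (\<phi> i w)" if "z \<in> K'" for z
    using that unfolding K'_def by blast
  have inv: "invariant_set K'"
    unfolding invariant_set_def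
  proof
    fix z assume "z \<in> K'"
    then obtain i w k where z: "i \<in> I" "w \<in> K" "k < n i" "z = (f ^^ k) (\<phi> i w)" using K'E by blast
    have "\<not> is_pole f z" using reg[OF z(1,2)] z(3,4) by (simp add: regular_upto_def)
    moreover have "f z \<in> K'"
    proof (cases "Suc k < n i")
      case True
      have "f z = (f ^^ Suc k) (\<phi> i w)" using z by simp
      then show ?thesis unfolding K'_def using True z(1,2) by blast
    next
      case False
      then have "n i = Suc k" using z(3) by simp
      then have "f z = w" using sec[OF z(1,2)] z(4) by simp
      then show ?thesis using z(2) KK' by blast
    qed
    ultimately show "\<not> is_pole f z \<and> f z \<in> K'" by blast
  qed
  have regK': "regular_upto f m z" if "z \<in> K'" for m z using invariant_regular[OF inv that] .
  have funK': "(f ^^ m) z \<in> K'" if "z \<in> K'" for m z using invariant_funpow[OF inv that] .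
  have chain: "deriv (f ^^ (p + m)) z = deriv (f ^^ m) ((f ^^ p) z) * deriv (f ^^ p) z" if "z \<in> K'" for p m z
    by (rule deriv_funpow_add) (rule regK'[OF that])
  \<comment> \<open>A critical point on an orbit segment would make the derivative of the whole
    return vanish.\<close>
  have dnz: "deriv f z \<noteq> 0" if zK': "z \<in> K'" for z
  proof
    assume d0: "deriv f z = 0"
    obtain i w k where z: "i \<in> I" "w \<in> K" "k < n i" "z = (f ^^ k) (\<phi> i w)" using K'E[OF zK'] by blast
    have p: "\<phi> i w \<in> K'" using z(1,2) K(3) KK' by blast
    have "deriv (f ^^ (k + (1 + (n i - Suc k)))) (\<phi> i w)
        = deriv (f ^^ (1 + (n i - Suc k))) z * deriv (f ^^ k) (\<phi> i w)"
      unfolding z(4) by (rule chain[OF p])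
    also have "deriv (f ^^ (1 + (n i - Suc k))) z = deriv (f ^^ (n i - Suc k)) ((f ^^ 1) z) * deriv (f ^^ 1) z"
      by (rule chain[OF zK'])
    also have "deriv (f ^^ 1) z = 0" using d0 by simp
    finally have "deriv (f ^^ n i) (\<phi> i w) = 0" using z(3) by simp
    then show False using exp[OF z(1,2)] by simp
  qed
  have K'ne: "K' \<noteq> {}" using KK' K(2) by blast
  have Ksub: "K' \<subseteq> {z. \<not> is_pole f z}" using inv by (auto simp: invariant_set_def)
  have holf: "f holomorphic_on {z. \<not> is_pole f z}"
    by (intro analytic_imp_holomorphic) (subst analytic_on_analytic_at, use analytic_off_poles in auto)
  have "continuous_on K' (\<lambda>z. cmod (deriv f z))"
    by (intro continuous_intros holomorphic_on_imp_continuous_on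
        holomorphic_on_subset[OF holomorphic_deriv[OF holf open_nonpoles] Ksub])
  then obtain z0 where z0: "z0 \<in> K'" "\<And>z. z \<in> K' \<Longrightarrow> cmod (deriv f z0) \<le> cmod (deriv f z)"
    using continuous_attains_inf[OF cptK' K'ne] by blast
  define c where "c = min 1 (cmod (deriv f z0))"
  have c: "0 < c" "c \<le> 1" "\<And>z. z \<in> K' \<Longrightarrow> c \<le> cmod (deriv f z)"
    using dnz[OF z0(1)] z0(2) unfolding c_def by (auto simp: min_le_iff_disj)
  have cpow: "c ^ m \<le> cmod (deriv (f ^^ m) z)" if "z \<in> K'" for m z
    using that
  proof (induction m)
    case (Suc m)
    have f1: "f ^^ 1 = f" by simp
    have "deriv (f ^^ Suc m) z = deriv f ((f ^^ m) z) * deriv (f ^^ m) z"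
      using chain[OF Suc.prems, of m 1] unfolding f1 by (simp only: Suc_eq_plus1)
    moreover have "c * c ^ m \<le> cmod (deriv f ((f ^^ m) z)) * cmod (deriv (f ^^ m) z)"
      using c(1) c(3)[OF funK'[OF Suc.prems]] Suc by (intro mult_mono) auto
    ultimately show ?case by (simp only: norm_mult power_Suc)
  qed (simp add: id_def)
  define m where "m = Max (n ` I)"
  have nm: "n i \<le> m" if "i \<in> I" for i unfolding m_def using I that by simp
  have m1: "m \<ge> 1" using I n1 nm by (meson all_not_in_conv order_trans)
  \<comment> \<open>Each return takes at most \<open>m\<close> steps, so \<open>N\<close> steps
    contain at least \<open>N div m\<close> of them; the factor \<open>c ^ m\<close> pays for the
    unfinished last one.\<close>
  have grow: "c ^ m * 2 ^ (N div m) \<le> cmod (deriv (f ^^ N) x)" if "x \<in> K" for N x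
    using that
  proof (induction N arbitrary: x rule: less_induct)
    case (less N)
    have xK': "x \<in> K'" using less.prems KK' by blast
    show ?case
    proof (cases "N < m")
      case True
      have "c ^ m \<le> c ^ N" using c True by (intro power_decreasing) auto
      also have "\<dots> \<le> cmod (deriv (f ^^ N) x)" by (rule cpow[OF xK'])
      finally show ?thesis using True by simp
    next
      case False
      obtain i w where i: "i \<in> I" "w \<in> K" "x = \<phi> i w" using less.prems K(3) by blast
      have ni: "n i \<le> N" "1 \<le> n i" using nm[OF i(1)] n1[OF i(1)] False by auto
      have "deriv (f ^^ (n i + (N - n i))) x = deriv (f ^^ (N - n i)) ((f ^^ n i) x) * deriv (f ^^ n i) x"
        by (rule chain[OF xK'])
      then have eq: "cmod (deriv (f ^^ N) x) = cmod (deriv (f ^^ (N - n i)) w) * cmod (deriv (f ^^ n i) x)"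
        using ni sec[OF i(1,2)] i(3) by (simp add: norm_mult)
      have "N div m = Suc ((N - m) div m)" using False m1 by (intro le_div_geq) auto
      also have "(N - m) div m \<le> (N - n i) div m" using nm[OF i(1)] by (intro div_le_mono) simp
      finally have "N div m \<le> Suc ((N - n i) div m)" by simp
      then have "c ^ m * 2 ^ (N div m) \<le> c ^ m * 2 ^ Suc ((N - n i) div m)"
        using c by (intro mult_left_mono power_increasing) auto
      also have "\<dots> = (c ^ m * 2 ^ ((N - n i) div m)) * 2" by simp
      also have "\<dots> \<le> cmod (deriv (f ^^ (N - n i)) w) * cmod (deriv (f ^^ n i) x)"
        using less.IH[of "N - n i" w] ni i exp[OF i(1,2)] c by (intro mult_mono) auto
      finally show ?thesis unfolding eq .
    qed
  qed
  obtain M where M: "\<And>z. z \<in> K' \<Longrightarrow> cmod z \<le> M"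
    using compact_imp_bounded[OF cptK'] bounded_iff by blast
  have M1: "1 + M\<^sup>2 > 0" by (simp add: add_pos_nonneg)
  \<comment> \<open>Two factors \<open>c ^ m\<close> compensate the incomplete ends, and
    \<open>1 + M\<^sup>2\<close> converts to the spherical derivative. The exponent
    \<open>m * Suc q\<close> leaves \<open>q\<close> full blocks after an initial segment of length
    at most \<open>m\<close>.\<close>
  obtain q where q: "2 ^ q > 2 * (1 + M\<^sup>2) / (c ^ m * c ^ m)" using real_arch_pow[of 2] by auto
  define N where "N = m * Suc q"
  have "sph_deriv f N z > 1" if z: "z \<in> K'" for z
  proof -
    obtain i w k where i: "i \<in> I" "w \<in> K" "k < n i" "z = (f ^^ k) (\<phi> i w)" using K'E[OF z] by blast
    define p where "p = n i - k"
    have p: "p \<le> m" "p + k = n i" using nm[OF i(1)] i(3) by (auto simp: p_def)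
    have pw: "(f ^^ p) z = w"
    proof -
      have "(f ^^ p) z = (f ^^ (p + k)) (\<phi> i w)" unfolding i(4) by (simp add: funpow_add)
      then show ?thesis using sec[OF i(1,2)] p by simp
    qed
    have "m \<le> N" using m1 by (simp add: N_def)
    then have pN: "p \<le> N" using p by simp
    have "deriv (f ^^ (p + (N - p))) z = deriv (f ^^ (N - p)) ((f ^^ p) z) * deriv (f ^^ p) z"
      by (rule chain[OF z])
    then have eq: "cmod (deriv (f ^^ N) z) = cmod (deriv (f ^^ (N - p)) w) * cmod (deriv (f ^^ p) z)"
      using pN pw by (simp add: norm_mult)
    have "q = (N - m) div m" using m1 by (simp add: N_def)
    also have "\<dots> \<le> (N - p) div m" using p by (intro div_le_mono) simp
    finally have "c ^ m * 2 ^ q \<le> c ^ m * 2 ^ ((N - p) div m)"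
      using c by (intro mult_left_mono power_increasing) auto
    also have "\<dots> \<le> cmod (deriv (f ^^ (N - p)) w)" by (rule grow[OF i(2)])
    finally have 1: "c ^ m * 2 ^ q \<le> cmod (deriv (f ^^ (N - p)) w)" .
    have "c ^ m \<le> c ^ p" using c p by (intro power_decreasing) auto
    also have "\<dots> \<le> cmod (deriv (f ^^ p) z)" by (rule cpow[OF z])
    finally have 2: "c ^ m \<le> cmod (deriv (f ^^ p) z)" .
    have "2 * (1 + M\<^sup>2) < 2 ^ q * (c ^ m * c ^ m)"
      using q c by (subst (asm) pos_divide_less_eq) auto
    also have "\<dots> = (c ^ m * 2 ^ q) * c ^ m" by simp
    also have "\<dots> \<le> cmod (deriv (f ^^ N) z)" unfolding eq using 1 2 c by (intro mult_mono) auto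
    finally have big: "2 * (1 + M\<^sup>2) < cmod (deriv (f ^^ N) z)" .
    have "1 + (cmod ((f ^^ N) z))\<^sup>2 \<le> 1 + M\<^sup>2"
      using M[OF funK'[OF z]] by (intro add_left_mono power_mono) auto
    also have "\<dots> < 2 * (1 + M\<^sup>2)" using mult_strict_right_mono[of 1 2, OF _ M1] by simp
    also have "\<dots> < cmod (deriv (f ^^ N) z)" by (rule big)
    also have "\<dots> \<le> cmod (deriv (f ^^ N) z) * (1 + (cmod z)\<^sup>2)" by (simp add: mult_le_cancel_left1)
    finally show ?thesis unfolding sph_deriv_def using one_plus_cmod_sq_pos by (subst pos_less_divide_eq) auto
  qed
  note expand = this
  have "\<exists>lam>1. \<forall>z\<in>K'. sph_deriv f N z > lam"
  proof -
    have "continuous_on K' (\<lambda>z. sph_deriv f N z)"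
      unfolding sph_deriv_def
    proof (intro continuous_intros)
      have KR: "K' \<subseteq> {z. regular_upto f N z}" using regK' by blast
      have hN: "(f ^^ N) holomorphic_on {z. regular_upto f N z}" by (rule holomorphic_regular) auto
      show "continuous_on K' (deriv (f ^^ N))"
        by (intro holomorphic_on_imp_continuous_on holomorphic_on_subset[OF holomorphic_deriv[OF hN open_regular] KR])
      show "continuous_on K' (f ^^ N)"
        by (intro holomorphic_on_imp_continuous_on holomorphic_on_subset[OF hN KR])
      show "\<forall>z\<in>K'. 1 + (cmod ((f ^^ N) z))\<^sup>2 \<noteq> 0" using one_plus_cmod_sq_pos by blast
    qed
    then obtain z1 where z1: "z1 \<in> K'" "\<And>z. z \<in> K' \<Longrightarrow> sph_deriv f N z1 \<le> sph_deriv f N z"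
      using continuous_attains_inf[OF cptK' K'ne] by blast
    have "1 < (1 + sph_deriv f N z1) / 2" "(1 + sph_deriv f N z1) / 2 < sph_deriv f N z1"
      using expand[OF z1(1)] by auto
    then show ?thesis using z1(2) by (meson less_le_trans)
  qed
  moreover have "N \<ge> 1" using m1 by (simp add: N_def)
  ultimately have "hyperbolic_set f K'"
    unfolding hyperbolic_set_def using cptK' inv unfolding invariant_set_def by blast
  then show ?thesis using KK' by blast
qed


definition univalent_branch :: "nat \<Rightarrow> (complex \<Rightarrow> complex) \<Rightarrow> complex set \<Rightarrow> bool" where
  "univalent_branch n \<phi> D \<longleftrightarrow> 1 \<le> n \<and> \<phi> holomorphic_on D \<and> inj_on \<phi> D \<and>
     (\<forall>w\<in>D. regular_upto f n (\<phi> w) \<and> (f ^^ n) (\<phi> w) = w)"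

text \<open>Vitali's lemma is applied to balls about \<open>\<phi> x w0\<close> large enough to
  contain both \<open>x\<close> and the image of \<open>X\<close>: they cover the non-null set, and
  their disjointness separates the pieces of the system.\<close>

lemma hyperbolic_set_of_branches:
  assumes t: "0 < t" "t < t'" and R: "R > 0"
    and nn: "\<And>\<eta>. \<eta> > 0 \<Longrightarrow> hausdorff_measure t' (S \<inter> ball w0 \<eta>) \<noteq> 0"
    and br: "\<And>x e. \<lbrakk>x \<in> S; e > 0\<rbrakk> \<Longrightarrow> \<exists>n \<phi>. univalent_branch n \<phi> (ball w0 R) \<and>
      cmod (x - \<phi> w0) \<le> C * cmod (deriv \<phi> w0) \<and> cmod (deriv \<phi> w0) < e"
  shows "\<exists>K. hyperbolic_set f K \<and> ereal t \<le> hausdorff_dim K"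
proof -
  define X where "X = cball w0 (R/8)"
  define S1 where "S1 = S \<inter> ball w0 (R/16)"
  define L where "L = dist_const"
  \<comment> \<open>One multiple of the derivative serves two purposes: \<open>C\<close> bounds the
    distance from \<open>x\<close> to the centre, and \<open>L * R\<close> the size of the image of
    \<open>X\<close>.\<close>
  define C2 where "C2 = \<bar>C\<bar> + L * R"
  have L: "L \<ge> 1" "L > 0" unfolding L_def using dist_const_ge by auto
  have C2: "C2 > 0" "C \<le> C2" "L * R \<le> C2"
  proof -
    have "L * R > 0" using L R by simp
    then show "C2 > 0" "C \<le> C2" "L * R \<le> C2" unfolding C2_def by linarith+
  qed
  have nnS1: "hausdorff_measure t' S1 \<noteq> 0" unfolding S1_def by (rule nn) (use R in simp)
  \<comment> \<open>The lower Lipschitz ratio of a branch will be its Vitali radius divided by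
    \<open>C2 * L\<close>, so this threshold makes the \<open>t\<close>-th powers of the ratios sum
    to more than \<open>1\<close>.\<close>
  have "(C2 * L) powr t > 0" using C2 L by simp
  from vitali_finite_subfamily[OF t nnS1 this] obtain \<epsilon> where \<epsilon>: "\<epsilon> > 0"
    and vit: "\<forall>(a :: complex \<Rightarrow> complex) r. (\<forall>x\<in>S1. 0 < r x \<and> r x \<le> \<epsilon> \<and> x \<in> cball (a x) (r x)) \<longrightarrow>
      (\<exists>F\<subseteq>S1. finite F \<and> pairwise (\<lambda>i j. disjnt (cball (a i) (r i)) (cball (a j) (r j))) F \<and>
       (C2 * L) powr t < (\<Sum>x\<in>F. r x powr t))"
    by (elim exE conjE)
  \<comment> \<open>The three bounds give radii small enough for Vitali, images inside
    \<open>X\<close> because \<open>R/16 + 2 * (R/32) = R/8\<close>, and contraction by at least one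
    half.\<close>
  define e where "e = min (\<epsilon> / C2) (min (R / (32 * C2)) (1 / (2 * L)))"
  have e: "e > 0" unfolding e_def using \<epsilon> C2 R L by simp
  have e1: "C2 * e \<le> \<epsilon>" and e2: "C2 * e \<le> R/32" and e3: "L * e \<le> 1/2"
  proof -
    have "e \<le> \<epsilon> / C2" "e \<le> R / (32 * C2)" "e \<le> 1 / (2 * L)" unfolding e_def by auto
    then show "C2 * e \<le> \<epsilon>" "C2 * e \<le> R/32" "L * e \<le> 1/2" using C2 L by (simp_all add: field_simps)
  qed
  have "\<forall>x\<in>S1. \<exists>p. univalent_branch (fst p) (snd p) (ball w0 R) \<and>
      cmod (x - snd p w0) \<le> C * cmod (deriv (snd p) w0) \<and> cmod (deriv (snd p) w0) < e"
    using br[OF _ e] unfolding S1_def by (auto simp: split_paired_Ex)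
  from bchoice[OF this] obtain p where p: "\<forall>x\<in>S1. univalent_branch (fst (p x)) (snd (p x)) (ball w0 R) \<and>
      cmod (x - snd (p x) w0) \<le> C * cmod (deriv (snd (p x)) w0) \<and> cmod (deriv (snd (p x)) w0) < e"
    by (elim exE)
  define n where "n = (\<lambda>x. fst (p x))"
  define \<phi> where "\<phi> = (\<lambda>x. snd (p x))"
  define s where "s = (\<lambda>x. cmod (deriv (\<phi> x) w0))"
  define r where "r = (\<lambda>x. C2 * s x)"
  have n1: "1 \<le> n x" and hol: "\<phi> x holomorphic_on ball w0 R" and inj: "inj_on (\<phi> x) (ball w0 R)"
    and reg: "w \<in> ball w0 R \<Longrightarrow> regular_upto f (n x) (\<phi> x w)"
    and sec: "w \<in> ball w0 R \<Longrightarrow> (f ^^ n x) (\<phi> x w) = w"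
    and near: "cmod (x - \<phi> x w0) \<le> C * s x" and se: "s x < e" if "x \<in> S1" for x w
    using p that unfolding n_def \<phi>_def s_def univalent_branch_def by blast+
  have w0R: "w0 \<in> ball w0 R" using R by simp
  have s0: "s x > 0" if "x \<in> S1" for x
    unfolding s_def using holomorphic_injective_imp_regular[OF hol[OF that] open_ball inj[OF that] w0R] by simp
  have r: "0 < r x" "r x \<le> \<epsilon>" "r x \<le> R/32" "cmod (x - \<phi> x w0) \<le> r x" if "x \<in> S1" for x
  proof -
    show "0 < r x" unfolding r_def using s0[OF that] C2 by simp
    have "r x \<le> C2 * e" unfolding r_def using se[OF that] C2 by (intro mult_left_mono) auto
    then show "r x \<le> \<epsilon>" "r x \<le> R/32" using e1 e2 by auto
    have "C * s x \<le> C2 * s x" using C2 s0[OF that] by (intro mult_right_mono) auto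
    then show "cmod (x - \<phi> x w0) \<le> r x" using near[OF that] by (simp add: r_def)
  qed
  have "\<exists>F\<subseteq>S1. finite F \<and> pairwise (\<lambda>i j. disjnt (cball (\<phi> i w0) (r i)) (cball (\<phi> j w0) (r j))) F \<and>
       (C2 * L) powr t < (\<Sum>x\<in>F. r x powr t)"
    by (rule vit[THEN spec, THEN spec, THEN mp]) (use r in \<open>auto simp: dist_norm norm_minus_commute\<close>)
  then obtain F where F: "F \<subseteq> S1" "finite F"
    and pw: "pairwise (\<lambda>i j. disjnt (cball (\<phi> i w0) (r i)) (cball (\<phi> j w0) (r j))) F"
    and big: "(C2 * L) powr t < (\<Sum>x\<in>F. r x powr t)"
    by (elim exE conjE)
  have XR: "X \<subseteq> ball w0 R" unfolding X_def using R by auto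
  have XR8: "dist w0 y \<le> R/8" if "y \<in> X" for y using that by (simp add: X_def)
  have img: "\<phi> x ` X \<subseteq> cball (\<phi> x w0) (r x)" if x: "x \<in> S1" for x
  proof safe
    fix y assume y: "y \<in> X"
    have "cmod (\<phi> x y - \<phi> x w0) \<le> dist_const * cmod (deriv (\<phi> x) w0) * cmod (y - w0)"
      using XR8[OF y] R by (intro univalent_lipschitz[OF hol[OF x] inj[OF x] R]) auto
    also have "\<dots> = L * cmod (y - w0) * s x" by (simp add: L_def s_def)
    also have "\<dots> \<le> L * R * s x"
      using XR8[OF y] R L s0[OF x] by (intro mult_left_mono mult_right_mono) (auto simp: dist_norm norm_minus_commute)
    also have "\<dots> \<le> C2 * s x" using C2 s0[OF x] by (intro mult_right_mono) auto
    finally show "\<phi> x y \<in> cball (\<phi> x w0) (r x)" by (simp add: r_def dist_norm norm_minus_commute)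
  qed
  have imgX: "\<phi> x ` X \<subseteq> X" if x: "x \<in> S1" for x
  proof safe
    fix y assume "y \<in> X"
    then have "dist (\<phi> x w0) (\<phi> x y) \<le> r x" using img[OF x] by auto
    moreover have "dist x (\<phi> x w0) \<le> r x" using r(4)[OF x] by (simp add: dist_norm)
    moreover have "dist w0 x < R/16" using x by (simp add: S1_def)
    moreover have "dist w0 (\<phi> x y) \<le> dist w0 x + dist x (\<phi> x w0) + dist (\<phi> x w0) (\<phi> x y)"
      using dist_triangle[of w0 "\<phi> x y" x] dist_triangle[of x "\<phi> x y" "\<phi> x w0"] by linarith
    ultimately show "\<phi> x y \<in> X" using r(3)[OF x] unfolding X_def by simp
  qed
  have expand: "2 \<le> cmod (deriv (f ^^ n x) (\<phi> x y))" if x: "x \<in> S1" and y: "y \<in> X" for x y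
  proof -
    have yR: "y \<in> ball w0 R" using XR y by blast
    have "deriv (f ^^ n x) (\<phi> x y) * deriv (\<phi> x) y = 1"
      by (rule deriv_section[OF hol[OF x] open_ball yR reg[OF x yR] sec[OF x]])
    then have one: "cmod (deriv (f ^^ n x) (\<phi> x y)) * cmod (deriv (\<phi> x) y) = 1"
      by (metis norm_mult norm_one)
    have "cmod (deriv (\<phi> x) y) \<le> 8 * koebe_const * s x"
      unfolding s_def using XR8[OF y] R by (intro univalent_deriv_le[OF hol[OF x] inj[OF x] R]) auto
    also have "\<dots> \<le> L * s x" unfolding L_def using dist_const_ge s0[OF x] by (intro mult_right_mono) auto
    also have "\<dots> \<le> L * e" using se[OF x] L by (intro mult_left_mono) auto
    also note e3
    finally have "cmod (deriv (f ^^ n x) (\<phi> x y)) * cmod (deriv (\<phi> x) y) \<le> cmod (deriv (f ^^ n x) (\<phi> x y)) * (1/2)"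
      by (intro mult_left_mono) auto
    then show ?thesis using one by simp
  qed
  define rat where "rat = (\<lambda>x. s x / L)"
  have rat0: "rat x > 0" if "x \<in> S1" for x unfolding rat_def using s0[OF that] L by simp
  have rat1: "rat x < 1" if "x \<in> S1" for x
  proof -
    have "s x < e" by (rule se[OF that])
    also have "e \<le> L * e" using L e by simp
    also have "\<dots> < L" using e3 L by linarith
    finally show ?thesis unfolding rat_def using L by simp
  qed
  have low: "rat x * cmod (y - y') \<le> cmod (\<phi> x y - \<phi> x y')" if x: "x \<in> S1" and "y \<in> X" "y' \<in> X" for x y y'
  proof -
    have "s x * cmod (y - y') \<le> L * cmod (\<phi> x y - \<phi> x y')"
      unfolding s_def L_def
      by (rule univalent_lower_lipschitz[OF hol[OF x] inj[OF x] R]) (use XR8 that in auto)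
    then show ?thesis unfolding rat_def using L by (simp add: field_simps)
  qed
  have sum: "1 < (\<Sum>x\<in>F. rat x powr t)"
  proof -
    have "rat x powr t = r x powr t / (C2 * L) powr t" if "x \<in> F" for x
    proof -
      have x: "x \<in> S1" using that F by blast
      have "rat x = r x / (C2 * L)" unfolding rat_def r_def using C2 by simp
      then show ?thesis using r(1)[OF x] C2 L by (simp add: powr_divide)
    qed
    then have "(\<Sum>x\<in>F. rat x powr t) = (\<Sum>x\<in>F. r x powr t) / (C2 * L) powr t"
      by (simp add: sum_divide_distrib)
    moreover have "1 < (\<Sum>x\<in>F. r x powr t) / (C2 * L) powr t"
      using big C2 L by (subst pos_less_divide_eq) auto
    ultimately show ?thesis by simp
  qed
  \<comment> \<open>Each ratio is below \<open>1\<close>, so a sum above \<open>1\<close> needs at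
    least two maps.\<close>
  have two: "2 \<le> card F"
  proof (rule ccontr)
    assume "\<not> 2 \<le> card F"
    then consider "card F = 0" | "card F = 1" by linarith
    then show False
    proof cases
      case 1
      then have "F = {}" using F by simp
      then show False using sum by simp
    next
      case 2
      then obtain x where x: "F = {x}" by (rule card_1_singletonE)
      then have "x \<in> S1" using F by blast
      then have "rat x powr t \<le> 1" using rat0[of x] rat1[of x] t by (intro powr_le1) auto
      then show False using sum x by simp
    qed
  qed
  have cdisj: "cball (\<phi> i w0) (r i) \<inter> cball (\<phi> j w0) (r j) = {}" if "i \<in> F" "j \<in> F" "i \<noteq> j" for i j
    using pw that unfolding pairwise_def disjnt_def by blast
  obtain d where d: "d > 0" and sepd: "\<forall>i\<in>F. \<forall>j\<in>F. i \<noteq> j \<longrightarrow>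
      (\<forall>x\<in>cball (\<phi> i w0) (r i). \<forall>y\<in>cball (\<phi> j w0) (r j). d \<le> dist x y)"
    using finite_separation[OF F(2), of "\<lambda>i. cball (\<phi> i w0) (r i)"] cdisj by auto
  have F0: "F \<noteq> {}" using two by auto
  have FS: "i \<in> S1" if "i \<in> F" for i using that F by blast
  have contX: "continuous_on X (\<phi> i)" if "i \<in> F" for i
    using holomorphic_on_imp_continuous_on[OF hol[OF FS[OF that]]] XR continuous_on_subset by blast
  have "\<exists>K. compact K \<and> K \<noteq> {} \<and> K \<subseteq> X \<and> K = (\<Union>i\<in>F. \<phi> i ` K)"
  proof (rule ifs_limit_set)
    show "compact X" "X \<noteq> {}" unfolding X_def using R by auto
    show "inj_on (\<phi> i) X" if "i \<in> F" for i using inj[OF FS[OF that]] XR by (rule inj_on_subset)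
    show "\<phi> i ` X \<subseteq> X" if "i \<in> F" for i by (rule imgX[OF FS[OF that]])
    show "\<phi> i ` X \<inter> \<phi> j ` X = {}" if "i \<in> F" "j \<in> F" "i \<noteq> j" for i j
      using img[OF FS[OF that(1)]] img[OF FS[OF that(2)]] cdisj[OF that] by blast
  qed (use F F0 contX in auto)
  then obtain K where K: "compact K" "K \<noteq> {}" "K \<subseteq> X" "K = (\<Union>i\<in>F. \<phi> i ` K)" by (elim exE conjE)
  have KX: "y \<in> X" if "y \<in> K" for y using K(3) that by blast
  have "hausdorff_measure t K \<noteq> 0"
  proof (rule ifs_not_hausdorff_null[OF K(1) F(2) two K(2) K(4) _ _ _ d t(1) less_imp_le[OF sum]])
    show "d \<le> cmod (x - y)" if "i \<in> F" "j \<in> F" "i \<noteq> j" "x \<in> \<phi> i ` K" "y \<in> \<phi> j ` K" for i j x y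
    proof -
      have "x \<in> cball (\<phi> i w0) (r i)" "y \<in> cball (\<phi> j w0) (r j)"
        using img[OF FS[OF that(1)]] img[OF FS[OF that(2)]] that(4,5) K(3) by blast+
      then show ?thesis using sepd that(1-3) by (simp add: dist_norm)
    qed
    show "0 < rat i" if "i \<in> F" for i by (rule rat0[OF FS[OF that]])
    show "rat i * cmod (x - y) \<le> cmod (\<phi> i x - \<phi> i y)" if "i \<in> F" "x \<in> K" "y \<in> K" for i x y
      by (rule low[OF FS[OF that(1)] KX[OF that(2)] KX[OF that(3)]])
  qed
  then have dimK: "ereal t \<le> hausdorff_dim K" by (rule hausdorff_dim_geI[OF t(1)])
  have "\<exists>K'. hyperbolic_set f K' \<and> K \<subseteq> K'"
  proof (rule hyperbolic_set_of_ifs[OF F(2) F0 K(1) K(2) K(4), of n])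
    show "continuous_on K (\<phi> i)" if "i \<in> F" for i using contX[OF that] K(3) by (rule continuous_on_subset)
    show "1 \<le> n i" if "i \<in> F" for i by (rule n1[OF FS[OF that]])
    fix i x assume i: "i \<in> F" and x: "x \<in> K"
    have xR: "x \<in> ball w0 R" using KX[OF x] XR by blast
    show "regular_upto f (n i) (\<phi> i x)" by (rule reg[OF FS[OF i] xR])
    show "(f ^^ n i) (\<phi> i x) = x" by (rule sec[OF FS[OF i] xR])
    show "2 \<le> cmod (deriv (f ^^ n i) (\<phi> i x))" by (rule expand[OF FS[OF i] KX[OF x]])
  qed
  then obtain K' where "hyperbolic_set f K'" "K \<subseteq> K'" by blast
  then show ?thesis using dimK hausdorff_dim_mono by (meson order_trans)
qed

end

subsection \<open>Pullbacks along radial orbits\<close>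

definition chart :: "bool \<Rightarrow> complex \<Rightarrow> complex" where
  "chart i u = (if i then inverse u else u)"

text \<open>The true involution of the sphere. \<open>chart\<close> agrees with it only away from
  \<open>0\<close>, where the convention \<open>inverse 0 = 0\<close> replaces the value
  infinity.\<close>

definition sph_chart :: "bool \<Rightarrow> complex option \<Rightarrow> complex option" where
  "sph_chart i q = (if i then (case q of None \<Rightarrow> Some 0 | Some a \<Rightarrow> if a = 0 then None else Some (inverse a)) else q)"

lemma chart_chart [simp]: "chart i (chart i u) = u"
  by (simp add: chart_def)

lemma sph_chart_sph_chart [simp]: "sph_chart i (sph_chart i q) = q"
  by (auto simp: sph_chart_def split: option.splits)

lemma sph_chart_Some: "u \<noteq> 0 \<Longrightarrow> sph_chart i (Some u) = Some (chart i u)"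
  by (simp add: sph_chart_def chart_def)

text \<open>Inversion is a half turn of the sphere.\<close>
lemma stereo_sph_chart: "stereo (sph_chart True q) = (cnj (fst (stereo q)), - snd (stereo q))"
proof (cases q)
  case None
  then show ?thesis by (simp add: sph_chart_def)
next
  case (Some a)
  show ?thesis
  proof (cases "a = 0")
    case True
    then show ?thesis using Some by (simp add: sph_chart_def)
  next
    case False
    define A where "A = (cmod a)\<^sup>2"
    have A: "A > 0" using False by (simp add: A_def)
    have nA: "(cmod (inverse a))\<^sup>2 = 1 / A" 
      unfolding norm_inverse power_inverse A_def by (simp add: inverse_eq_divide)
    have "a * cnj a = of_real A" unfolding A_def by (rule complex_norm_square[symmetric])
    then have ia: "inverse a = cnj a / of_real A" using False A by (simp add: field_simps)
    have A1: "1 + 1 / A = (1 + A) / A" using A by (simp add: field_simps)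
    have "2 * inverse a / of_real (1 + 1 / A) = cnj (2 * a / of_real (1 + A))"
    proof -
      have nz: "complex_of_real A \<noteq> 0" using A by simp
      have "2 * inverse a / of_real (1 + 1 / A) = 2 * (cnj a / of_real A) / (of_real (1 + A) / of_real A)"
        unfolding A1 ia of_real_divide by simp
      also have "\<dots> = 2 * cnj a / of_real (1 + A)" using nz by simp
      finally show ?thesis by simp
    qed
    moreover have "(1 / A - 1) / (1 + 1 / A) = - ((A - 1) / (1 + A))"
    proof -
      have "(1 / A - 1) = (1 - A) / A" using A by (simp add: field_simps)
      then have "(1 / A - 1) / (1 + 1 / A) = (1 - A) / (1 + A)" unfolding A1 using A by simp
      then show ?thesis by (simp add: minus_divide_left)
    qed
    ultimately show ?thesis using False unfolding Some by (simp add: sph_chart_def nA A_def[symmetric])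
  qed
qed

lemma chordal_sph_chart: "chordal (sph_chart i p) (sph_chart i q) = chordal p q"
proof (cases i)
  case True
  have "dist (cnj x) (cnj y) = dist x y" for x y
    by (metis complex_cnj_diff complex_mod_cnj dist_norm)
  moreover have "dist (- s) (- s') = dist s s'" for s s' :: real by (simp add: dist_real_def)
  moreover have "i = True" using True by simp
  ultimately show ?thesis by (simp add: chordal_eq_dist stereo_sph_chart dist_prod_def)
qed (simp add: sph_chart_def)

lemma chordal_nbhd_finite:
  assumes e: "e > 0"
  shows "\<exists>d>0. \<forall>q. chordal q (Some c) < d \<longrightarrow> (\<exists>u. q = Some u \<and> cmod (u - c) < e)"
proof -
  define t where "t = sqrt (1 + (cmod c)\<^sup>2)"
  have t: "t > 0" unfolding t_def using one_plus_cmod_sq_pos by simp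
  have ct: "cmod c \<le> 2 * t"
  proof -
    have "cmod c \<le> t" unfolding t_def by (rule real_le_rsqrt) simp
    then show ?thesis using t by linarith
  qed
  define B where "B = 1 + (2 * t)\<^sup>2"
  have B: "B > 0" unfolding B_def by (simp add: add_pos_nonneg)
  define d where "d = min (1 / t) (2 * e / B)"
  have "d > 0" unfolding d_def using t e B by simp
  moreover have "\<exists>u. q = Some u \<and> cmod (u - c) < e" if q: "chordal q (Some c) < d" for q
  proof -
    have "chordal q (Some c) < 1 / sqrt (1 + (cmod c)\<^sup>2)" using q unfolding d_def t_def by simp
    then obtain u where u: "q = Some u" "cmod u \<le> 2 * t"
      using chordal_near_finite[OF order_refl] unfolding t_def by blast
    have "2 * cmod (u - c) \<le> B * chordal (Some u) (Some c)"
      unfolding B_def by (rule cmod_diff_le_chordal) (use u ct in auto)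
    also have "\<dots> < B * (2 * e / B)" using q u B unfolding d_def by (intro mult_strict_left_mono) auto
    also have "\<dots> = 2 * e" using B by simp
    finally show ?thesis using u by simp
  qed
  ultimately show ?thesis by blast
qed

section \<open>Iterates as maps into the sphere\<close>

context meromorphic_map
begin

text \<open>At a pole, the chordal distance from \<open>ext_val f w\<close> to infinity is at most
  \<open>2 / cmod (f w)\<close> nearby, which tends to \<open>0\<close>.\<close>

lemma isCont_stereo_ext: "isCont (\<lambda>w. stereo (ext_val f w)) z"
proof (cases "is_pole f z")
  case False
  have "isCont f z" using analytic_off_poles[OF False] analytic_at_imp_isCont by blast
  then have "isCont (\<lambda>w. stereo (Some (f w))) z" using isCont_stereo_Some by (rule isCont_o2)
  moreover have "eventually (\<lambda>w. stereo (ext_val f w) = stereo (Some (f w))) (nhds z)"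
  proof -
    have "eventually (\<lambda>w. w \<in> {w. \<not> is_pole f w}) (nhds z)"
      by (rule eventually_nhds_in_open[OF open_nonpoles]) (use False in simp)
    then show ?thesis by eventually_elim (simp add: ext_val_def)
  qed
  ultimately show ?thesis
    using isCont_cong[of "\<lambda>w. stereo (ext_val f w)" "\<lambda>w. stereo (Some (f w))" z] by simp
next
  case True
  have "((\<lambda>w. stereo (ext_val f w)) \<longlongrightarrow> stereo None) (at z)"
  proof (rule metric_tendsto_imp_tendsto)
    have lim: "filterlim f at_infinity (at z)" using True by (simp add: is_pole_def)
    have "((\<lambda>w. inverse (f w)) \<longlongrightarrow> 0) (at z)" by (rule filterlim_compose[OF tendsto_inverse_0 lim])
    then show "((\<lambda>w. 2 * inverse (f w)) \<longlongrightarrow> 0) (at z)" by (rule tendsto_mult_right_zero)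
    have "eventually (\<lambda>w. f w \<noteq> 0) (at z)" using lim by (rule filterlim_at_infinity_imp_eventually_ne)
    then show "eventually (\<lambda>w. dist (stereo (ext_val f w)) (stereo None) \<le> dist (2 * inverse (f w)) 0) (at z)"
    proof (rule eventually_mono)
      fix w assume fw: "f w \<noteq> 0"
      show "dist (stereo (ext_val f w)) (stereo None) \<le> dist (2 * inverse (f w)) 0"
      proof (cases "is_pole f w")
        case True
        then show ?thesis by (simp add: ext_val_def)
      next
        case False
        have "cmod (f w) \<le> sqrt (1 + (cmod (f w))\<^sup>2)" by (rule real_le_rsqrt) simp
        then have "2 / sqrt (1 + (cmod (f w))\<^sup>2) \<le> 2 / cmod (f w)" using fw by (intro frac_le) auto
        moreover have "dist (stereo (ext_val f w)) (stereo None) = 2 / sqrt (1 + (cmod (f w))\<^sup>2)"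
          unfolding chordal_eq_dist[symmetric] ext_val_def using False by (simp add: chordal.simps)
        ultimately show ?thesis by (simp add: norm_mult norm_inverse divide_inverse)
      qed
    qed
  qed
  moreover have "ext_val f z = None" using True by (simp add: ext_val_def)
  ultimately show ?thesis unfolding isCont_def by simp
qed

lemma open_iter_dom: "open (iter_dom f n)"
proof (cases n)
  case (Suc m)
  have "iter_dom f n = {z. regular_upto f m z}" unfolding Suc using iter_dom_iff by blast
  then show ?thesis using open_regular by simp
qed simp

lemma iter_val_eventually_near:
  assumes w: "w \<in> iter_dom f n" and e: "e > 0"
  shows "eventually (\<lambda>x. x \<in> iter_dom f n \<and> chordal (iter_val f n x) (iter_val f n w) < e) (nhds w)"
proof -
  have "isCont (\<lambda>x. stereo (iter_val f n x)) w"
  proof (cases n)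
    case 0
    show ?thesis unfolding 0 iter_val_def using isCont_stereo_Some by simp
  next
    case (Suc m)
    have "regular_upto f m w" using w unfolding Suc iter_dom_iff .
    then have "isCont (f ^^ m) w" using analytic_at_regular analytic_at_imp_isCont by blast
    then have "isCont (\<lambda>x. stereo (ext_val f ((f ^^ m) x))) w" using isCont_stereo_ext by (rule isCont_o2)
    then show ?thesis unfolding Suc iter_val_def by simp
  qed
  then have "((\<lambda>x. stereo (iter_val f n x)) \<longlongrightarrow> stereo (iter_val f n w)) (nhds w)"
    by (rule tendsto_at_iff_tendsto_nhds[THEN iffD1, OF isContD])
  then have "eventually (\<lambda>x. dist (stereo (iter_val f n x)) (stereo (iter_val f n w)) < e) (nhds w)"
    using e by (rule tendstoD)
  moreover have "eventually (\<lambda>x. x \<in> iter_dom f n) (nhds w)"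
    using eventually_nhds_in_open[OF open_iter_dom w] .
  ultimately show ?thesis unfolding chordal_eq_dist by eventually_elim blast
qed

text \<open>In the chart at infinity the origin stands for the value infinity, which
  \<open>f ^^ n\<close> cannot express as a complex number. The origin is exempted in both charts to
  treat them alike.\<close>

definition branch :: "bool \<Rightarrow> complex \<Rightarrow> real \<Rightarrow> nat \<Rightarrow> (complex \<Rightarrow> complex) \<Rightarrow> bool" where
  "branch i b R n \<Phi> \<longleftrightarrow> \<Phi> holomorphic_on ball b R \<and> inj_on \<Phi> (ball b R) \<and>
     (\<forall>u\<in>ball b R. u \<noteq> 0 \<longrightarrow> regular_upto f n (\<Phi> u) \<and> (f ^^ n) (\<Phi> u) = chart i u)"

lemma openI_eventually: "(\<And>x. x \<in> S \<Longrightarrow> eventually (\<lambda>y. y \<in> S) (nhds x)) \<Longrightarrow> open S"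
  by (subst open_subopen) (metis eventually_nhds subsetI)

text \<open>\<open>\<Phi>\<close> is the inverse of \<open>f ^^ n\<close> read in the chart,
  restricted to the part \<open>V'\<close> of the component lying over the ball; at points sent to
  infinity, holomorphy comes from the derivative clause of \<open>conformal_pullback\<close>. The
  last two conclusions feed the normality argument in \<open>pullbacks_shrink\<close>.\<close>

lemma conformal_pullback_branch:
  assumes cp: "conformal_pullback f n z \<delta>" and reg: "regular_upto f n z"
    and v: "v \<in> ball b R" "sph_chart i (Some v) = Some ((f ^^ n) z)"
    and near: "\<And>u. u \<in> ball b R \<Longrightarrow> chordal (sph_chart i (Some u)) (Some ((f ^^ n) z)) < \<delta>"
  shows "\<exists>\<Phi>. branch i b R n \<Phi> \<and> \<Phi> v = z \<and> \<Phi> ` ball b R \<subseteq> iter_dom f n \<and> inj_on (iter_val f n) (\<Phi> ` ball b R)"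
proof -
  define c where "c = (f ^^ n) z"
  have ivz: "iter_val f n z = Some c" unfolding c_def by (rule iter_val_regular[OF reg])
  have zdom: "z \<in> iter_dom f n"
    using reg by (cases n) (auto simp: iter_dom_iff intro: regular_upto_mono)
  define D where "D = {q. chordal q (Some c) < \<delta>}"
  define S where "S = {w \<in> iter_dom f n. iter_val f n w \<in> D}"
  define V where "V = connected_component_set S z"
  have bij: "bij_betw (iter_val f n) V D"
    and dNone: "\<And>w. \<lbrakk>w \<in> V; iter_val f n w = None\<rbrakk> \<Longrightarrow>
        \<exists>d. ((\<lambda>u. inv_chart (iter_val f n u)) has_field_derivative d) (at w)"
    using cp unfolding conformal_pullback_def Let_def ivz D_def[symmetric] S_def[symmetric] V_def[symmetric] by blast+
  have VS: "V \<subseteq> S" unfolding V_def by (rule connected_component_subset)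
  have "open S"
  proof (rule openI_eventually)
    fix w assume w: "w \<in> S"
    then have "w \<in> iter_dom f n" "\<delta> - chordal (iter_val f n w) (Some c) > 0" by (auto simp: S_def D_def)
    from iter_val_eventually_near[OF this] show "eventually (\<lambda>y. y \<in> S) (nhds w)"
    proof (rule eventually_mono, elim conjE)
      fix x assume x: "x \<in> iter_dom f n" "chordal (iter_val f n x) (iter_val f n w) < \<delta> - chordal (iter_val f n w) (Some c)"
      then show "x \<in> S" unfolding S_def D_def
        using chordal_triangle[of "iter_val f n x" "Some c" "iter_val f n w"] by simp
    qed
  qed
  then have openV: "open V" unfolding V_def by (rule open_connected_component)
  define P where "P = (\<lambda>u. sph_chart i (Some u))"
  have PD: "P u \<in> D" if "u \<in> ball b R" for u using near[OF that] unfolding P_def D_def c_def by simp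
  define V' where "V' = {w \<in> V. iter_val f n w \<in> P ` ball b R}"
  \<comment> \<open>The value \<open>0\<close> is the coordinate of infinity in the inverted chart;
    in the other chart infinity does not occur on \<open>V'\<close>.\<close>
  define h where "h = (\<lambda>w. case iter_val f n w of None \<Rightarrow> 0 | Some a \<Rightarrow> chart i a)"
  have hP: "h w = u" if "iter_val f n w = P u" for w u
    using that unfolding h_def P_def by (auto simp: sph_chart_def chart_def split: if_splits)
  have "open V'"
  proof (rule openI_eventually)
    fix w assume w: "w \<in> V'"
    then obtain u where u: "u \<in> ball b R" "iter_val f n w = P u" unfolding V'_def by blast
    have "R - dist b u > 0" using u by simp
    from chordal_nbhd_finite[OF this, of u] obtain d where d: "d > 0"
      and dd: "\<forall>q. chordal q (Some u) < d \<longrightarrow> (\<exists>u'. q = Some u' \<and> cmod (u' - u) < R - dist b u)" by blast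
    have "w \<in> iter_dom f n" using w VS unfolding V'_def S_def by blast
    from iter_val_eventually_near[OF this d]
    have ev: "eventually (\<lambda>x. x \<in> iter_dom f n \<and> chordal (iter_val f n x) (iter_val f n w) < d) (nhds w)" .
    have evV: "eventually (\<lambda>x. x \<in> V) (nhds w)" using w by (intro eventually_nhds_in_open openV) (simp add: V'_def)
    show "eventually (\<lambda>y. y \<in> V') (nhds w)"
      using ev evV
    proof eventually_elim
      case (elim x)
      have "chordal (sph_chart i (iter_val f n x)) (Some u) = chordal (iter_val f n x) (P u)"
        using chordal_sph_chart[of i "iter_val f n x" "P u"] by (simp add: P_def)
      then have "chordal (sph_chart i (iter_val f n x)) (Some u) < d" using elim u by simp
      then obtain u' where u': "sph_chart i (iter_val f n x) = Some u'" "cmod (u' - u) < R - dist b u" using dd by blast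
      have "dist b u' < R" using u'(2) dist_triangle[of b u' u] by (simp add: dist_norm norm_minus_commute)
      moreover have "iter_val f n x = P u'" unfolding P_def u'(1)[symmetric] by simp
      ultimately show ?case using elim unfolding V'_def by auto
    qed
  qed
  have holh: "h holomorphic_on V'"
  proof (rule holomorphic_onI)
    fix w assume w: "w \<in> V'"
    then have wV: "w \<in> V" and wdom: "w \<in> iter_dom f n" using VS by (auto simp: V'_def S_def)
    have "h field_differentiable (at w)"
    proof (cases "iter_val f n w")
      case None
      obtain u where u: "iter_val f n w = P u" using w unfolding V'_def by blast
      then have i: i using None unfolding P_def by (auto simp: sph_chart_def split: if_splits)
      have "h = (\<lambda>u. inv_chart (iter_val f n u))"
        unfolding h_def using i by (auto simp: fun_eq_iff chart_def split: option.splits)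
      then show ?thesis using dNone[OF wV None] unfolding field_differentiable_def by blast
    next
      case (Some a)
      have r: "regular_upto f n w" "(f ^^ n) w = a" using regular_of_iter_val[OF wdom Some] by auto
      obtain u where u: "iter_val f n w = P u" using w unfolding V'_def by blast
      have a0: "a \<noteq> 0" if i using u Some that unfolding P_def by (auto simp: sph_chart_def split: if_splits)
      have "(f ^^ n) field_differentiable at w"
        using differentiable_regular[OF r(1)] unfolding field_differentiable_def by blast
      then have "(\<lambda>x. chart i ((f ^^ n) x)) field_differentiable at w"
        unfolding chart_def using a0 r(2) by (cases i) (auto intro!: field_differentiable_inverse)
      then obtain d where d: "((\<lambda>x. chart i ((f ^^ n) x)) has_field_derivative d) (at w)"
        unfolding field_differentiable_def by blast
      have "(h has_field_derivative d) (at w)"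
        by (rule has_field_derivative_transform_within_open[OF d open_regular[of n]])
           (use r in \<open>auto simp: h_def iter_val_regular\<close>)
      then show ?thesis unfolding field_differentiable_def by blast
    qed
    then show "h field_differentiable (at w within V')" by (rule field_differentiable_at_within)
  qed
  have injV: "inj_on (iter_val f n) V" using bij by (rule bij_betw_imp_inj_on)
  have injh: "inj_on h V'"
  proof (rule inj_onI)
    fix w w' assume w: "w \<in> V'" "w' \<in> V'" "h w = h w'"
    then obtain u u' where u: "iter_val f n w = P u" "iter_val f n w' = P u'" unfolding V'_def by blast
    then have "u = u'" using hP w(3) by metis
    then have "iter_val f n w = iter_val f n w'" using u by simp
    then show "w = w'" using w injV unfolding V'_def by (auto dest: inj_onD)
  qed
  have himg: "\<exists>w\<in>V'. h w = u \<and> iter_val f n w = P u" if u: "u \<in> ball b R" for u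
  proof -
    have "P u \<in> iter_val f n ` V" using PD[OF u] bij unfolding bij_betw_def by simp
    then obtain w where w: "w \<in> V" "iter_val f n w = P u" by (metis imageE)
    then have "w \<in> V'" unfolding V'_def using u by blast
    then show ?thesis using hP[OF w(2)] w(2) by blast
  qed
  have "h ` V' = ball b R"
  proof
    show "h ` V' \<subseteq> ball b R"
    proof
      fix y assume "y \<in> h ` V'"
      then obtain w u where "w \<in> V'" "y = h w" "u \<in> ball b R" "iter_val f n w = P u" unfolding V'_def by blast
      then show "y \<in> ball b R" using hP by metis
    qed
    show "ball b R \<subseteq> h ` V'" using himg by blast
  qed
  then obtain \<Phi> where \<Phi>: "\<Phi> holomorphic_on ball b R" "\<And>w. w \<in> V' \<Longrightarrow> \<Phi> (h w) = w"
    using holomorphic_has_inverse[OF holh \<open>open V'\<close> injh] by metis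
  have \<Phi>u: "\<Phi> u \<in> V' \<and> h (\<Phi> u) = u \<and> iter_val f n (\<Phi> u) = P u" if "u \<in> ball b R" for u
    using himg[OF that] \<Phi>(2) by metis
  have "branch i b R n \<Phi>"
    unfolding branch_def
  proof (intro conjI ballI impI \<Phi>(1))
    show "inj_on \<Phi> (ball b R)" using \<Phi>u by (metis inj_onI)
    fix u assume u: "u \<in> ball b R" "u \<noteq> 0"
    have iv: "iter_val f n (\<Phi> u) = Some (chart i u)" using \<Phi>u[OF u(1)] sph_chart_Some[OF u(2)] by (simp add: P_def)
    have dom: "\<Phi> u \<in> iter_dom f n" using \<Phi>u[OF u(1)] VS by (auto simp: V'_def S_def)
    show "regular_upto f n (\<Phi> u)" "(f ^^ n) (\<Phi> u) = chart i u" using regular_of_iter_val[OF dom iv] by auto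
  qed
  moreover have "\<Phi> v = z"
  proof -
    have "chordal (Some c) (Some c) < \<delta>" using near[OF v(1)] unfolding v(2) c_def .
    then have zS: "z \<in> S" unfolding S_def D_def using zdom ivz by simp
    then have "z \<in> V" unfolding V_def by (simp add: connected_component_refl)
    moreover have "iter_val f n z = P v" using ivz v(2) by (simp add: P_def c_def)
    ultimately have "z \<in> V'" unfolding V'_def using v(1) by blast
    then show ?thesis using \<Phi>(2) hP[OF \<open>iter_val f n z = P v\<close>] by blast
  qed
  moreover have sub: "\<Phi> ` ball b R \<subseteq> V" using \<Phi>u unfolding V'_def by blast
  have "\<Phi> ` ball b R \<subseteq> iter_dom f n" using sub VS unfolding S_def by blast
  moreover have "inj_on (iter_val f n) (\<Phi> ` ball b R)" by (rule inj_on_subset[OF injV sub])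
  ultimately show ?thesis by blast
qed

text \<open>The radius \<open>R/32\<close> is an eighth of \<open>R/4\<close>: distortion bounds
  still hold for a map that is univalent only on \<open>ball b (R/4)\<close>. Arbitrarily late
  \<open>n\<close> make it possible to split off a fixed earlier iterate.\<close>

definition recurrent_set :: "bool \<Rightarrow> complex \<Rightarrow> real \<Rightarrow> complex set" where
  "recurrent_set i b R = {z. \<forall>\<epsilon>>0. \<forall>m. \<exists>n\<ge>m. \<exists>\<Phi>. branch i b R n \<Phi> \<and> z \<in> \<Phi> ` ball b (R/32) \<and> cmod (deriv \<Phi> b) < \<epsilon>}"

text \<open>If the derivatives of the branches do not tend to zero, Koebe's theorem yields a disk around \<open>z\<close>
  on which all iterates are univalent.\<close>
lemma pullbacks_shrink:
  assumes R: "R > 0" and N: "infinite N"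
    and br: "\<And>n. n \<in> N \<Longrightarrow> \<exists>\<Phi> v. branch i b R n \<Phi> \<and> v \<in> ball b (R/32) \<and> \<Phi> v = z \<and>
      \<Phi> ` ball b R \<subseteq> iter_dom f n \<and> inj_on (iter_val f n) (\<Phi> ` ball b R)"
    and jul: "z \<in> julia f" and nonlin: "\<not> (\<exists>a b. \<forall>z. f z = a * z + b)"
  shows "z \<in> recurrent_set i b R"
  unfolding recurrent_set_def
proof (intro CollectI allI impI, rule ccontr)
  fix \<epsilon> :: real and m assume \<epsilon>: "\<epsilon> > 0"
    and neg: "\<not> (\<exists>n\<ge>m. \<exists>\<Phi>. branch i b R n \<Phi> \<and> z \<in> \<Phi> ` ball b (R/32) \<and> cmod (deriv \<Phi> b) < \<epsilon>)"
  have large: "\<epsilon> \<le> cmod (deriv \<Phi> b)" if "n \<ge> m" "branch i b R n \<Phi>" "z \<in> \<Phi> ` ball b (R/32)" for n \<Phi>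
  proof (rule ccontr)
    assume "\<not> \<epsilon> \<le> cmod (deriv \<Phi> b)"
    then have "cmod (deriv \<Phi> b) < \<epsilon>" by simp
    then show False using neg that by blast
  qed
  \<comment> \<open>The distortion bound gives a derivative at least
    \<open>\<epsilon> / (8 * koebe_const)\<close> at \<open>v\<close>, and the quarter theorem on
    \<open>ball v (R/2)\<close> turns it into this radius.\<close>
  define \<kappa> where "\<kappa> = \<epsilon> * R / (64 * koebe_const * koebe_const)"
  have k1: "koebe_const > 0" using koebe_const_ge_1 by linarith
  have \<kappa>: "\<kappa> > 0" unfolding \<kappa>_def using \<epsilon> R k1 by simp
  have disk: "\<exists>U. ball z \<kappa> \<subseteq> U \<and> U \<subseteq> iter_dom f n \<and> inj_on (iter_val f n) U" if n: "n \<in> N" "n \<ge> m" for n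
  proof -
    obtain \<Phi> v where \<Phi>: "branch i b R n \<Phi>" "v \<in> ball b (R/32)" "\<Phi> v = z"
      "\<Phi> ` ball b R \<subseteq> iter_dom f n" "inj_on (iter_val f n) (\<Phi> ` ball b R)" using br[OF n(1)] by blast
    have hol: "\<Phi> holomorphic_on ball b R" and inj: "inj_on \<Phi> (ball b R)" using \<Phi>(1) by (auto simp: branch_def)
    have "\<epsilon> \<le> cmod (deriv \<Phi> b)" using large[OF n(2) \<Phi>(1)] \<Phi>(2,3) by blast
    also have "\<dots> \<le> 8 * koebe_const * cmod (deriv \<Phi> v)"
      by (rule univalent_deriv_ge[OF hol inj R]) (use \<Phi>(2) R in simp)
    finally have dv: "\<epsilon> \<le> 8 * koebe_const * cmod (deriv \<Phi> v)" .
    have sub: "ball v (R/2) \<subseteq> ball b R"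
    proof
      fix y assume "y \<in> ball v (R/2)"
      then show "y \<in> ball b R" using \<Phi>(2) R dist_triangle[of b y v] by simp
    qed
    have "ball (\<Phi> v) (cmod (deriv \<Phi> v) * (R/2) / (4 * koebe_const)) \<subseteq> \<Phi> ` ball v (R/2)"
      by (rule koebe_quarter_weak) (use holomorphic_on_subset[OF hol sub] inj_on_subset[OF inj sub] R in auto)
    moreover have "\<kappa> \<le> cmod (deriv \<Phi> v) * (R/2) / (4 * koebe_const)"
    proof -
      have "\<kappa> \<le> (8 * koebe_const * cmod (deriv \<Phi> v)) * R / (64 * koebe_const * koebe_const)"
        unfolding \<kappa>_def using dv R k1 by (intro divide_right_mono mult_right_mono) auto
      also have "\<dots> = cmod (deriv \<Phi> v) * (R/2) / (4 * koebe_const)" using k1 by (simp add: field_simps)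
      finally show ?thesis .
    qed
    ultimately have "ball z \<kappa> \<subseteq> \<Phi> ` ball b R" using sub \<Phi>(3) by (meson image_mono order_trans subset_ball)
    then show ?thesis using \<Phi>(4,5) by blast
  qed
  have bigN: "\<exists>n\<in>N. k \<le> n" for k using N by (meson infinite_nat_iff_unbounded_le)
  have reg: "regular_upto f j w" if "w \<in> ball z \<kappa>" for j w
  proof -
    obtain n where n: "n \<in> N" "max m (Suc j) \<le> n" using bigN by blast
    then obtain k where k: "n = Suc k" "j \<le> k" by (cases n) auto
    have "w \<in> iter_dom f n" using disk[OF n(1)] n(2) that by auto
    then have "regular_upto f k w" unfolding k(1) iter_dom_iff .
    then show ?thesis using k(2) by (rule regular_upto_mono)
  qed
  have "fatou_point f z"
  proof (rule univalent_iterates_imp_fatou[OF \<kappa> reg _ nonlin])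
    fix j
    obtain n where n: "n \<in> N" "max m j \<le> n" using bigN by blast
    obtain U where U: "ball z \<kappa> \<subseteq> U" "inj_on (iter_val f n) U" using disk[OF n(1)] n(2) by auto
    \<comment> \<open>Univalence is known only for infinitely many times, but a later injective
      iterate factors through \<open>f ^^ j\<close>.\<close>
    show "inj_on (f ^^ j) (ball z \<kappa>)"
    proof (rule inj_onI)
      fix x y assume xy: "x \<in> ball z \<kappa>" "y \<in> ball z \<kappa>" "(f ^^ j) x = (f ^^ j) y"
      have "(f ^^ n) = (f ^^ (n - j)) \<circ> (f ^^ j)" using n(2) by (simp add: funpow_add[symmetric])
      then have "(f ^^ n) x = (f ^^ n) y" using xy(3) by simp
      then have "iter_val f n x = iter_val f n y" using iter_val_regular reg xy by simp
      then show "x = y" using U xy by (meson inj_onD subsetD)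
    qed
  qed
  then show False using jul by (simp add: julia_def)
qed

text \<open>In the chart where its modulus is at most \<open>1\<close>, every orbit value lies in a
  compact disk covered by finitely many small balls with centres in \<open>E\<close>. By pigeonhole
  one chart and one centre serve infinitely many of the pullback times, with a single
  radius.\<close>

lemma radial_julia_in_recurrent_sets:
  assumes nonlin: "\<not> (\<exists>a b. \<forall>z. f z = a * z + b)" and z: "z \<in> radial_julia f"
    and dense: "\<And>X. open X \<Longrightarrow> X \<noteq> {} \<Longrightarrow> \<exists>d\<in>E. d \<in> X"
  shows "\<exists>i. \<exists>b\<in>E. \<exists>k. z \<in> recurrent_set i b (1 / Suc k)"
proof -
  have jul: "z \<in> julia f" and dom: "\<And>n. z \<in> iter_dom f n" using z by (auto simp: radial_julia_def)
  obtain \<delta> where \<delta>: "\<delta> > 0" and inf: "\<exists>\<^sub>\<infinity>n. conformal_pullback f n z \<delta>" using z by (auto simp: radial_julia_def)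
  have reg: "regular_upto f n z" for n using dom[of "Suc n"] iter_dom_iff by blast
  \<comment> \<open>A quarter of \<open>\<delta>\<close> suffices: points of \<open>ball b R\<close>
    lie within \<open>R + R/32\<close> of \<open>v n\<close>, and chordal distance at most doubles
    Euclidean distance.\<close>
  obtain k where k: "1 / Suc k < \<delta> / 4" using nat_approx_posE[of "\<delta>/4"] \<delta> by (metis divide_pos_pos zero_less_numeral)
  define R where "R = 1 / real (Suc k)"
  have R: "R > 0" "4 * R < \<delta>" using k by (auto simp: R_def)
  define c where "c = (\<lambda>n. (f ^^ n) z)"
  define i where "i = (\<lambda>n. cmod (c n) > 1)"
  define v where "v = (\<lambda>n. chart (i n) (c n))"
  have v1: "v n \<in> cball 0 1" for n
    by (auto simp: v_def i_def chart_def norm_inverse inverse_le_1_iff)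
  have vc: "sph_chart (i n) (Some (v n)) = Some (c n)" for n
  proof (cases "i n")
    case True
    then have "c n \<noteq> 0" by (auto simp: i_def)
    then show ?thesis using True by (simp add: sph_chart_def v_def chart_def)
  qed (simp add: sph_chart_def v_def chart_def)
  have cover: "cball 0 1 \<subseteq> (\<Union>b\<in>E. ball b (R/32))"
  proof
    fix x :: complex
    have "\<exists>d\<in>E. d \<in> ball x (R/32)" by (rule dense) (use R in auto)
    then show "x \<in> (\<Union>b\<in>E. ball b (R/32))" by (auto simp: dist_commute)
  qed
  obtain E' where E': "E' \<subseteq> E" "finite E'" "cball 0 1 \<subseteq> (\<Union>b\<in>E'. ball b (R/32))"
    by (rule compactE_image[OF compact_cball _ cover]) auto
  have "\<forall>n. \<exists>b. b \<in> E' \<and> v n \<in> ball b (R/32)" using v1 E'(3) by blast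
  from choice[OF this] obtain \<beta> where \<beta>: "\<And>n. \<beta> n \<in> E'" "\<And>n. v n \<in> ball (\<beta> n) (R/32)" by blast
  define N where "N = {n. conformal_pullback f n z \<delta>}"
  have infN: "infinite N" using inf by (simp add: N_def Inf_many_def)
  have "finite ((\<lambda>n. (i n, \<beta> n)) ` N)"
    by (rule finite_subset[of _ "UNIV \<times> E'"]) (use \<beta>(1) E'(2) in auto)
  from pigeonhole_infinite[OF infN this] obtain n0 where
    n0: "infinite {a \<in> N. (i a, \<beta> a) = (i n0, \<beta> n0)}" by blast
  have "z \<in> recurrent_set (i n0) (\<beta> n0) R"
  proof (rule pullbacks_shrink[OF R(1) n0 _ jul nonlin])
    fix n assume "n \<in> {a \<in> N. (i a, \<beta> a) = (i n0, \<beta> n0)}"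
    then have n: "conformal_pullback f n z \<delta>" "i n = i n0" "\<beta> n = \<beta> n0" by (auto simp: N_def)
    have vb: "v n \<in> ball (\<beta> n0) (R/32)" using \<beta>(2)[of n] n by simp
    have "\<exists>\<Phi>. branch (i n0) (\<beta> n0) R n \<Phi> \<and> \<Phi> (v n) = z \<and> \<Phi> ` ball (\<beta> n0) R \<subseteq> iter_dom f n \<and>
        inj_on (iter_val f n) (\<Phi> ` ball (\<beta> n0) R)"
    proof (rule conformal_pullback_branch[OF n(1) reg])
      show "v n \<in> ball (\<beta> n0) R" using vb R by simp
      show "sph_chart (i n0) (Some (v n)) = Some ((f ^^ n) z)" using vc[of n] n by (simp add: c_def)
      fix u assume u: "u \<in> ball (\<beta> n0) R"
      have "chordal (sph_chart (i n0) (Some u)) (Some ((f ^^ n) z)) = chordal (Some u) (Some (v n))"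
        using vc[of n] n chordal_sph_chart[of "i n0" "Some u" "Some (v n)"] by (simp add: c_def)
      also have "\<dots> \<le> 2 * cmod (u - v n)" by (rule chordal_Some_le)
      also have "\<dots> < \<delta>"
        using u vb dist_triangle[of u "v n" "\<beta> n0"] R by (simp add: dist_norm norm_minus_commute)
      finally show "chordal (sph_chart (i n0) (Some u)) (Some ((f ^^ n) z)) < \<delta>" .
    qed
    then show "\<exists>\<Phi> v. branch (i n0) (\<beta> n0) R n \<Phi> \<and> v \<in> ball (\<beta> n0) (R/32) \<and> \<Phi> v = z \<and>
      \<Phi> ` ball (\<beta> n0) R \<subseteq> iter_dom f n \<and> inj_on (iter_val f n) (\<Phi> ` ball (\<beta> n0) R)" using vb by blast
  qed
  then show ?thesis using \<beta>(1) E'(1) unfolding R_def by blast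
qed


lemma recurrent_setD:
  "\<lbrakk>z \<in> recurrent_set i b R; \<epsilon> > 0\<rbrakk> \<Longrightarrow>
    \<exists>n\<ge>m. \<exists>\<Phi>. branch i b R n \<Phi> \<and> z \<in> \<Phi> ` ball b (R/32) \<and> cmod (deriv \<Phi> b) < \<epsilon>"
  unfolding recurrent_set_def by blast

text \<open>A non-null recurrent set is moved by a univalent iterate into the disk that carries its branches.\<close>
lemma recurrent_set_hyperbolic:
  assumes t: "0 < t" "t < t'" and R: "R > 0" and nn: "hausdorff_measure t' (recurrent_set i b R) \<noteq> 0"
  shows "\<exists>K. hyperbolic_set f K \<and> ereal t \<le> hausdorff_dim K"
proof -
  have t': "t' > 0" using t by simp
  define A where "A = recurrent_set i b R"
  obtain z0 where z0: "z0 \<in> A" and z0nn: "\<forall>\<eta>>0. hausdorff_measure t' (A \<inter> ball z0 \<eta>) \<noteq> 0"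
    using non_null_at_point[OF t' nn] unfolding A_def by blast
  have "\<exists>n\<ge>0. \<exists>\<Phi>. branch i b R n \<Phi> \<and> z0 \<in> \<Phi> ` ball b (R/32) \<and> cmod (deriv \<Phi> b) < 1"
    using z0 unfolding A_def by (rule recurrent_setD) simp
  then obtain n \<Phi> where br: "branch i b R n \<Phi>" and z0\<Phi>: "z0 \<in> \<Phi> ` ball b (R/32)" by blast
  have hol: "\<Phi> holomorphic_on ball b R" and inj: "inj_on \<Phi> (ball b R)"
    and brn: "\<And>u. \<lbrakk>u \<in> ball b R; u \<noteq> 0\<rbrakk> \<Longrightarrow> regular_upto f n (\<Phi> u) \<and> (f ^^ n) (\<Phi> u) = chart i u"
    using br by (auto simp: branch_def)
  define B where "B = ball b (R/32)"
  have BR: "B \<subseteq> ball b R" unfolding B_def using R by auto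
  have openimg: "open (\<Phi> ` U)" if "open U" "U \<subseteq> ball b R" for U
    by (rule open_mapping_thm3[OF holomorphic_on_subset[OF hol that(2)] that(1) inj_on_subset[OF inj that(2)]])
  \<comment> \<open>The exempted origin contributes one point to the image, and a point is null for
    positive exponents.\<close>
  define S where "S = {u \<in> B. u \<noteq> 0 \<and> \<Phi> u \<in> A}"
  have Snn: "hausdorff_measure t' S \<noteq> 0"
  proof
    assume null: "hausdorff_measure t' S = 0"
    have "hausdorff_measure t' (\<Phi> ` S) = 0"
    proof (rule hausdorff_null_lipschitz[OF t' null])
      show "cmod (\<Phi> x - \<Phi> y) \<le> (dist_const * cmod (deriv \<Phi> b)) * cmod (x - y)" if "x \<in> S" "y \<in> S" for x y
        by (rule univalent_lipschitz[OF hol inj R]) (use that R in \<open>auto simp: S_def B_def\<close>)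
      show "bounded S" by (rule bounded_subset[of B]) (auto simp: S_def B_def)
    qed
    then have "hausdorff_measure t' (\<Phi> ` S \<union> {\<Phi> 0}) = 0"
      by (rule hausdorff_null_Un[OF t' _ hausdorff_null_singleton[OF t']])
    moreover obtain \<eta> where \<eta>: "\<eta> > 0" "ball z0 \<eta> \<subseteq> \<Phi> ` B"
      using openimg[OF _ BR] z0\<Phi> unfolding B_def by (meson open_ball open_contains_ball)
    moreover have "A \<inter> ball z0 \<eta> \<subseteq> \<Phi> ` S \<union> {\<Phi> 0}"
    proof
      fix x assume x: "x \<in> A \<inter> ball z0 \<eta>"
      then obtain u where "u \<in> B" "x = \<Phi> u" using \<eta>(2) by blast
      then show "x \<in> \<Phi> ` S \<union> {\<Phi> 0}" using x unfolding S_def by (cases "u = 0") auto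
    qed
    ultimately have "hausdorff_measure t' (A \<inter> ball z0 \<eta>) = 0" using hausdorff_null_mono by blast
    then show False using z0nn \<eta>(1) by blast
  qed
  obtain u0 where u0: "u0 \<in> S" and u0nn: "\<forall>\<eta>>0. hausdorff_measure t' (S \<inter> ball u0 \<eta>) \<noteq> 0"
    using non_null_at_point[OF t' Snn] by blast
  have u00: "u0 \<noteq> 0" "u0 \<in> B" using u0 by (auto simp: S_def)
  define w0 where "w0 = chart i u0"
  have w00: "w0 \<noteq> 0" using u00 by (simp add: w0_def chart_def)
  have holchart: "chart i holomorphic_on (- {0})"
    unfolding chart_def by (cases i) (auto intro!: holomorphic_intros)
  have injchart: "inj (chart i)" by (metis chart_chart injI)
  have chart0: "chart i u = 0 \<longleftrightarrow> u = 0" for u by (simp add: chart_def)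
  have contchart: "continuous_on (- {0}) (chart i)" by (rule holomorphic_on_imp_continuous_on[OF holchart])
  have pre: "open (- {0} \<inter> chart i -` U)" if "open U" for U
    by (rule continuous_open_preimage[OF contchart _ that]) auto
  have "w0 \<in> - {0} \<inter> chart i -` B" using w00 u00 by (simp add: w0_def)
  then obtain R1 where R1: "R1 > 0" "ball w0 R1 \<subseteq> - {0} \<inter> chart i -` B"
    using pre[of B] unfolding B_def by (meson open_ball open_contains_ball)
  have chB: "chart i w \<in> B" "w \<noteq> 0" if "w \<in> ball w0 R1" for w using R1(2) that by auto
  have holc1: "chart i holomorphic_on ball w0 R1" using R1(2) by (intro holomorphic_on_subset[OF holchart]) auto
  have injc1: "inj_on (chart i) (ball w0 R1)" using injchart inj_on_subset by blast
  \<comment> \<open>On \<open>S\<close> the composition of \<open>f ^^ n\<close> with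
    \<open>\<Phi>\<close> is \<open>chart i\<close>, so this is the image under
    \<open>f ^^ n\<close> of a piece of \<open>A\<close>. Since \<open>chart i\<close> is its own
    inverse, its Lipschitz bound carries nullity back to \<open>S\<close>.\<close>
  define S' where "S' = chart i ` S"
  have S'nn: "hausdorff_measure t' (S' \<inter> ball w0 \<eta>) \<noteq> 0" if \<eta>: "\<eta> > 0" for \<eta>
  proof
    assume null: "hausdorff_measure t' (S' \<inter> ball w0 \<eta>) = 0"
    define \<eta>1 where "\<eta>1 = min \<eta> (R1/4)"
    have \<eta>1: "\<eta>1 > 0" "\<eta>1 \<le> \<eta>" "\<eta>1 \<le> R1/4" using \<eta> R1 by (auto simp: \<eta>1_def)
    have null1: "hausdorff_measure t' (S' \<inter> ball w0 \<eta>1) = 0"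
      by (rule hausdorff_null_mono[OF _ null]) (use \<eta>1 in auto)
    have "hausdorff_measure t' (chart i ` (S' \<inter> ball w0 \<eta>1)) = 0"
    proof (rule hausdorff_null_lipschitz[OF t' null1])
      show "cmod (chart i x - chart i y) \<le> (dist_const * cmod (deriv (chart i) w0)) * cmod (x - y)"
        if "x \<in> S' \<inter> ball w0 \<eta>1" "y \<in> S' \<inter> ball w0 \<eta>1" for x y
        by (rule univalent_lipschitz[OF holc1 injc1 R1(1)]) (use that \<eta>1 in auto)
      show "bounded (S' \<inter> ball w0 \<eta>1)" by (rule bounded_subset[OF bounded_ball]) blast
    qed
    moreover have "u0 \<in> - {0} \<inter> chart i -` ball w0 \<eta>1" using u00 \<eta>1 by (simp add: w0_def)
    then obtain \<eta>2 where \<eta>2: "\<eta>2 > 0" "ball u0 \<eta>2 \<subseteq> - {0} \<inter> chart i -` ball w0 \<eta>1"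
      using pre[of "ball w0 \<eta>1"] by (meson open_ball open_contains_ball)
    moreover have "S \<inter> ball u0 \<eta>2 \<subseteq> chart i ` (S' \<inter> ball w0 \<eta>1)"
    proof
      fix u assume u: "u \<in> S \<inter> ball u0 \<eta>2"
      then have "chart i u \<in> S' \<inter> ball w0 \<eta>1" using \<eta>2(2) unfolding S'_def by blast
      then show "u \<in> chart i ` (S' \<inter> ball w0 \<eta>1)" by (intro image_eqI[of _ _ "chart i u"]) auto
    qed
    ultimately have "hausdorff_measure t' (S \<inter> ball u0 \<eta>2) = 0" using hausdorff_null_mono by blast
    then show False using u0nn \<eta>2(1) by blast
  qed
  define L where "L = dist_const"
  have L: "L \<ge> 1" unfolding L_def by (rule dist_const_ge)
  define dc where "dc = cmod (deriv (chart i) w0)"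
  have dc: "dc > 0"
    unfolding dc_def using holomorphic_injective_imp_regular[OF holc1 open_ball injc1, of w0] R1(1) by simp
  have k1: "koebe_const \<ge> 1" by (rule koebe_const_ge_1)
  \<comment> \<open>Distortion of \<open>G\<close> between \<open>u0\<close> and
    \<open>\<zeta>\<close> costs \<open>L * (8 * koebe_const) * R\<close>; dividing by
    \<open>dc\<close> passes from the derivative of \<open>G\<close> at \<open>u0\<close> to that of
    \<open>\<phi>\<close> at \<open>w0\<close>.\<close>
  define C where "C = L * (8 * koebe_const) * R / dc"
  show ?thesis
  proof (rule hyperbolic_set_of_branches[OF t R1(1) S'nn, of C])
    fix x and e :: real assume x: "x \<in> S'" and e: "e > 0"
    obtain u where u: "u \<in> S" "x = chart i u" using x unfolding S'_def by blast
    have uB: "u \<in> B" "u \<noteq> 0" "u \<in> ball b R" and zA: "\<Phi> u \<in> A" using u(1) BR by (auto simp: S_def)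
    define z where "z = \<Phi> u"
    have fnz: "(f ^^ n) z = x" using brn[OF uB(3,2)] u(2) by (simp add: z_def)
    let ?W = "\<Phi> ` (ball b R - {0})"
    have "open ?W" by (rule openimg) auto
    moreover have "z \<in> ?W" unfolding z_def using uB by blast
    ultimately obtain e1 where e1: "e1 > 0" "cball z e1 \<subseteq> ?W" by (meson open_contains_cball)
    have regW: "regular_upto f n y" if "y \<in> ?W" for y using that brn by blast
    have injW: "inj_on (f ^^ n) ?W"
    proof (rule inj_onI)
      fix y y' assume y: "y \<in> ?W" "y' \<in> ?W" "(f ^^ n) y = (f ^^ n) y'"
      then obtain p p' where p: "p \<in> ball b R" "p \<noteq> 0" "y = \<Phi> p" "p' \<in> ball b R" "p' \<noteq> 0" "y' = \<Phi> p'" by blast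
      then have "chart i p = chart i p'" using brn y(3) by metis
      then show "y = y'" using injD[OF injchart] p(3,6) by blast
    qed
    have holW: "(f ^^ n) holomorphic_on ?W" by (rule holomorphic_regular) (rule regW)
    have "continuous_on (cball z e1) (deriv (f ^^ n))"
      by (intro holomorphic_on_imp_continuous_on
          holomorphic_on_subset[OF holomorphic_deriv[OF holW \<open>open ?W\<close>] e1(2)])
    then have "compact (deriv (f ^^ n) ` cball z e1)" by (rule compact_continuous_image) simp
    then obtain Lz where Lz: "\<And>y. y \<in> cball z e1 \<Longrightarrow> cmod (deriv (f ^^ n) y) \<le> Lz"
      using compact_imp_bounded bounded_iff by (metis image_eqI)
    have Lz0: "Lz \<ge> 0" by (rule order_trans[OF norm_ge_zero Lz[of z]]) (use e1(1) in simp)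
    \<comment> \<open>The first bound confines the image of \<open>\<Psi>\<close> on
      \<open>ball b (R/4)\<close> to the disk where \<open>f ^^ n\<close> is injective; the second
      makes the derivative of the final branch smaller than \<open>e\<close>.\<close>
    define \<epsilon>1 where "\<epsilon>1 = min (e1 / (L * R)) (e / ((Lz + 1) * L * dc))"
    have LR: "L * R > 0" and Ld: "(Lz + 1) * L * dc > 0" using L R Lz0 dc by auto
    have \<epsilon>1: "\<epsilon>1 > 0" unfolding \<epsilon>1_def using e1 e LR Ld by simp
    have \<epsilon>1a: "L * R * \<epsilon>1 \<le> e1" and \<epsilon>1b: "(Lz + 1) * L * dc * \<epsilon>1 \<le> e"
    proof -
      have "\<epsilon>1 \<le> e1 / (L * R)" "\<epsilon>1 \<le> e / ((Lz + 1) * L * dc)" unfolding \<epsilon>1_def by auto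
      then show "L * R * \<epsilon>1 \<le> e1" "(Lz + 1) * L * dc * \<epsilon>1 \<le> e"
        using LR Ld by (simp_all add: pos_le_divide_eq mult.commute)
    qed
    \<comment> \<open>Taking \<open>n'\<close> beyond \<open>n\<close> leaves at least one iteration
      in \<open>n' - n\<close>.\<close>
    have "\<exists>n'\<ge>Suc n. \<exists>\<Psi>. branch i b R n' \<Psi> \<and> z \<in> \<Psi> ` ball b (R/32) \<and> cmod (deriv \<Psi> b) < \<epsilon>1"
      using zA unfolding A_def z_def by (rule recurrent_setD) (rule \<epsilon>1)
    then obtain n' \<Psi> where n': "Suc n \<le> n'" and br': "branch i b R n' \<Psi>"
      and z\<Psi>: "z \<in> \<Psi> ` B" and d\<Psi>: "cmod (deriv \<Psi> b) < \<epsilon>1" unfolding B_def by blast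
    have hol': "\<Psi> holomorphic_on ball b R" and inj': "inj_on \<Psi> (ball b R)"
      and brn': "\<And>u. \<lbrakk>u \<in> ball b R; u \<noteq> 0\<rbrakk> \<Longrightarrow> regular_upto f n' (\<Psi> u) \<and> (f ^^ n') (\<Psi> u) = chart i u"
      using br' by (auto simp: branch_def)
    obtain \<zeta> where \<zeta>: "\<zeta> \<in> B" "z = \<Psi> \<zeta>" using z\<Psi> by blast
    define Q where "Q = ball b (R/4)"
    have QR: "Q \<subseteq> ball b R" and BQ: "B \<subseteq> Q" unfolding Q_def B_def using R by auto
    have \<Psi>Q: "\<Psi> y \<in> cball z e1" if y: "y \<in> Q" for y
    proof -
      have "cmod (\<Psi> y - \<Psi> \<zeta>) \<le> L * cmod (deriv \<Psi> b) * cmod (y - \<zeta>)"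
        unfolding L_def by (rule univalent_lipschitz[OF hol' inj' R]) (use y \<zeta> R in \<open>auto simp: Q_def B_def\<close>)
      also have "\<dots> \<le> L * \<epsilon>1 * R"
      proof (intro mult_mono)
        have "dist y \<zeta> \<le> dist b y + dist b \<zeta>" using dist_triangle[of y \<zeta> b] by (simp add: dist_commute)
        then show "cmod (y - \<zeta>) \<le> R" using y \<zeta> R by (simp add: Q_def B_def dist_norm)
      qed (use L d\<Psi> \<epsilon>1 in auto)
      also have "\<dots> = L * R * \<epsilon>1" by simp
      also note \<epsilon>1a
      finally show ?thesis using \<zeta>(2) by (simp add: dist_norm norm_minus_commute)
    qed
    have \<Psi>W: "\<Psi> ` Q \<subseteq> ?W" using \<Psi>Q e1(2) by blast
    \<comment> \<open>Following \<open>\<Psi>\<close> by \<open>f ^^ n\<close> moves its small image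
      from near \<open>z\<close> to near \<open>x\<close>. Precomposed with the chart, the result
      inverts \<open>f ^^ (n' - n)\<close> on a disk about \<open>w0\<close>.\<close>
    define G where "G = (f ^^ n) \<circ> \<Psi>"
    have holG: "G holomorphic_on ball b (R/4)" unfolding G_def Q_def[symmetric]
      by (rule holomorphic_on_compose_gen[OF holomorphic_on_subset[OF hol' QR] holW]) (use \<Psi>W in blast)
    have injG: "inj_on G (ball b (R/4))" unfolding G_def Q_def[symmetric]
      by (rule comp_inj_on[OF inj_on_subset[OF inj' QR] inj_on_subset[OF injW \<Psi>W]])
    have R4: "R/4 > 0" using R by simp
    define \<phi> where "\<phi> = (\<lambda>w. G (chart i w))"
    have w0b: "w0 \<in> ball w0 R1" using R1 by simp
    have cw0: "chart i w0 = u0" by (simp add: w0_def)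
    have hol\<phi>: "\<phi> holomorphic_on ball w0 R1"
    proof -
      have "G \<circ> chart i holomorphic_on ball w0 R1"
        by (rule holomorphic_on_compose_gen[OF holc1 holG]) (use chB BQ in \<open>auto simp: Q_def\<close>)
      then show ?thesis by (simp add: \<phi>_def o_def)
    qed
    have inj\<phi>: "inj_on \<phi> (ball w0 R1)"
    proof (rule inj_onI)
      fix w w' assume w: "w \<in> ball w0 R1" "w' \<in> ball w0 R1" "\<phi> w = \<phi> w'"
      then have "chart i w = chart i w'"
        using injG chB BQ unfolding \<phi>_def Q_def by (meson inj_onD subsetD)
      then show "w = w'" using injchart by (auto dest: injD)
    qed
    have sec\<phi>: "regular_upto f (n' - n) (\<phi> w) \<and> (f ^^ (n' - n)) (\<phi> w) = w" if w: "w \<in> ball w0 R1" for w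
    proof -
      have nz: "chart i w \<noteq> 0" using chB(2)[OF w] chart0 by simp
      have cb: "chart i w \<in> ball b R" using chB(1)[OF w] BR by blast
      have eq: "n' = n + (n' - n)" using n' by simp
      have 1: "regular_upto f (n + (n' - n)) (\<Psi> (chart i w))" "(f ^^ n') (\<Psi> (chart i w)) = w"
        using brn'[OF cb nz] eq by auto
      have "(f ^^ n') = (f ^^ (n' - n)) \<circ> (f ^^ n)" using n' by (simp add: funpow_add[symmetric])
      then have "(f ^^ (n' - n)) (\<phi> w) = w" using 1(2) by (simp add: \<phi>_def G_def)
      moreover have "regular_upto f (n' - n) (\<phi> w)" using 1(1) unfolding regular_upto_add by (simp add: \<phi>_def G_def)
      ultimately show ?thesis by blast
    qed
    have d\<phi>: "deriv \<phi> w0 = deriv G u0 * deriv (chart i) w0"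
    proof -
      have dG: "(G has_field_derivative deriv G u0) (at (chart i w0))"
        unfolding cw0 by (rule holomorphic_derivI[OF holG open_ball]) (use u00 BQ in \<open>auto simp: Q_def\<close>)
      have dC: "(chart i has_field_derivative deriv (chart i) w0) (at w0)"
        by (rule holomorphic_derivI[OF holc1 open_ball w0b])
      from DERIV_chain2[OF dG dC] show ?thesis unfolding \<phi>_def by (rule DERIV_imp_deriv)
    qed
    have "cmod (x - \<phi> w0) \<le> C * cmod (deriv \<phi> w0)"
    proof -
      have "x - \<phi> w0 = G \<zeta> - G u0" using fnz \<zeta>(2) by (simp add: \<phi>_def cw0 G_def)
      also have "cmod (G \<zeta> - G u0) \<le> L * cmod (deriv G b) * cmod (\<zeta> - u0)"
        unfolding L_def by (rule univalent_lipschitz[OF holG injG R4]) (use \<zeta> u00 R in \<open>auto simp: B_def\<close>)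
      also have "\<dots> \<le> L * (8 * koebe_const * cmod (deriv G u0)) * R"
      proof (intro mult_mono)
        show "cmod (deriv G b) \<le> 8 * koebe_const * cmod (deriv G u0)"
          by (rule univalent_deriv_ge[OF holG injG R4]) (use u00 in \<open>simp add: B_def\<close>)
        have "dist \<zeta> u0 \<le> dist b \<zeta> + dist b u0" using dist_triangle[of \<zeta> u0 b] by (simp add: dist_commute)
        then show "cmod (\<zeta> - u0) \<le> R" using \<zeta> u00 R by (simp add: B_def dist_norm)
      qed (use L k1 in auto)
      also have "\<dots> = C * cmod (deriv \<phi> w0)"
        unfolding d\<phi> norm_mult C_def dc_def[symmetric] using dc by simp
      finally show ?thesis .
    qed
    moreover have "cmod (deriv \<phi> w0) < e"
    proof -
      have u0Q: "u0 \<in> Q" using u00 BQ by blast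
      have d1: "(\<Psi> has_field_derivative deriv \<Psi> u0) (at u0)"
        by (rule holomorphic_derivI[OF hol' open_ball]) (use u0Q QR in blast)
      have "\<Psi> u0 \<in> ?W" using \<Psi>W u0Q by blast
      then have d2: "((f ^^ n) has_field_derivative deriv (f ^^ n) (\<Psi> u0)) (at (\<Psi> u0))"
        by (intro differentiable_regular regW)
      have dG: "deriv G u0 = deriv (f ^^ n) (\<Psi> u0) * deriv \<Psi> u0"
        unfolding G_def by (rule DERIV_imp_deriv[OF DERIV_chain[OF d2 d1]])
      have 1: "cmod (deriv (f ^^ n) (\<Psi> u0)) \<le> Lz + 1" using Lz[OF \<Psi>Q[OF u0Q]] by simp
      have "cmod (deriv \<Psi> u0) \<le> 8 * koebe_const * cmod (deriv \<Psi> b)"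
        by (rule univalent_deriv_le[OF hol' inj' R]) (use u0Q in \<open>simp add: Q_def\<close>)
      also have "\<dots> \<le> L * cmod (deriv \<Psi> b)"
        unfolding L_def using dist_const_ge by (intro mult_right_mono) auto
      also have "\<dots> < L * \<epsilon>1" using d\<Psi> L by (intro mult_strict_left_mono) auto
      finally have 2: "cmod (deriv \<Psi> u0) < L * \<epsilon>1" .
      have "cmod (deriv \<phi> w0) = cmod (deriv (f ^^ n) (\<Psi> u0)) * cmod (deriv \<Psi> u0) * dc"
        unfolding d\<phi> dG norm_mult dc_def by simp
      also have "\<dots> \<le> (Lz + 1) * cmod (deriv \<Psi> u0) * dc"
        using 1 dc by (intro mult_right_mono) auto
      also have "\<dots> < (Lz + 1) * (L * \<epsilon>1) * dc"
        using 2 Lz0 dc by (intro mult_strict_right_mono mult_strict_left_mono) auto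
      also have "\<dots> = (Lz + 1) * L * dc * \<epsilon>1" by simp
      also note \<epsilon>1b
      finally show ?thesis .
    qed
    moreover have "1 \<le> n' - n" using n' by simp
    ultimately show "\<exists>n \<phi>. univalent_branch n \<phi> (ball w0 R1) \<and>
      cmod (x - \<phi> w0) \<le> C * cmod (deriv \<phi> w0) \<and> cmod (deriv \<phi> w0) < e"
      unfolding univalent_branch_def using hol\<phi> inj\<phi> sec\<phi> by blast
  qed
qed

text \<open>An exponent \<open>t'\<close> between \<open>t\<close> and the dimension supplies the
  gap for Vitali's lemma. Dense centres and radii \<open>1 / Suc k\<close> give only countably many
  recurrent sets, so one of them is not null for \<open>t'\<close>.\<close>

lemma hyperbolic_set_near_radial_dim:
  assumes nonlin: "\<not> (\<exists>a b. \<forall>z. f z = a * z + b)" and t: "0 < t" "ereal t < hausdorff_dim (radial_julia f)"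
  shows "\<exists>K. hyperbolic_set f K \<and> ereal t \<le> hausdorff_dim K"
proof -
  obtain t' where t': "t < t'" "ereal t' < hausdorff_dim (radial_julia f)"
    using ereal_dense2[OF t(2)] by auto
  have t'0: "t' > 0" using t t' by simp
  have nn: "hausdorff_measure t' (radial_julia f) \<noteq> 0" using not_null_below_dim[of t'] t' t'0 by simp
  obtain E :: "complex set" where E: "countable E" "\<And>X. open X \<Longrightarrow> X \<noteq> {} \<Longrightarrow> \<exists>d\<in>E. d \<in> X"
    using countable_dense_exists by blast
  define I where "I = (UNIV :: bool set) \<times> E \<times> (UNIV :: nat set)"
  define A where "A = (\<lambda>(i, b, k). recurrent_set i b (1 / real (Suc k)))"
  have "countable I" unfolding I_def using E(1) by (intro countable_SIGMA) auto
  have "\<exists>j\<in>I. hausdorff_measure t' (A j) \<noteq> 0"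
  proof (rule ccontr)
    assume "\<not> ?thesis"
    then have "hausdorff_measure t' (\<Union>j\<in>I. A j) = 0"
      by (intro hausdorff_null_countable_UN[OF t'0 \<open>countable I\<close>]) blast
    moreover have "radial_julia f \<subseteq> (\<Union>j\<in>I. A j)"
    proof
      fix z assume "z \<in> radial_julia f"
      from radial_julia_in_recurrent_sets[OF nonlin this E(2)] obtain i b k
        where "b \<in> E" "z \<in> recurrent_set i b (1 / real (Suc k))" by blast
      then have "(i, b, k) \<in> I" "z \<in> A (i, b, k)" by (auto simp: I_def A_def)
      then show "z \<in> (\<Union>j\<in>I. A j)" by blast
    qed
    ultimately show False using nn hausdorff_null_mono by blast
  qed
  then obtain i b k where "hausdorff_measure t' (recurrent_set i b (1 / real (Suc k))) \<noteq> 0"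
    unfolding I_def A_def by auto
  then show ?thesis by (intro recurrent_set_hyperbolic[OF t(1) t'(1)]) auto
qed

end

theorem theorem1p1:
  fixes f :: "complex \<Rightarrow> complex"
  assumes "f nicely_meromorphic_on UNIV"
    and "\<not> (\<exists>c. \<forall>z. f z = c)"
    and "\<not> (\<exists>a b. \<forall>z. f z = a * z + b)"
  shows "hyp_dim f = hausdorff_dim (radial_julia f)"
proof (rule antisym)
  interpret meromorphic_map f by (unfold_locales) (rule assms(1))
  show "hyp_dim f \<le> hausdorff_dim (radial_julia f)"
    unfolding hyp_dim_def
    by (intro SUP_least hausdorff_dim_mono hyperbolic_subset_radial) simp
  show "hausdorff_dim (radial_julia f) \<le> hyp_dim f"
  proof (rule dense_le)
    fix x assume x: "x < hausdorff_dim (radial_julia f)"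
    \<comment> \<open>The empty set counts as hyperbolic, so the supremum is nonnegative and only
      positive exponents remain to be treated.\<close>
    have "hyperbolic_set f {}" by (auto simp: hyperbolic_set_def intro!: exI[of _ 1] exI[of _ 2])
    then have "hausdorff_dim {} \<le> hyp_dim f" unfolding hyp_dim_def by (intro SUP_upper) simp
    then have hyp0: "0 \<le> hyp_dim f" using hausdorff_dim_nonneg order_trans by blast
    show "x \<le> hyp_dim f"
    proof (cases "x \<le> 0")
      case True
      then show ?thesis using hyp0 by (rule order_trans)
    next
      case False
      obtain t where t: "x < ereal t" "ereal t < hausdorff_dim (radial_julia f)" using ereal_dense2[OF x] by blast
      have "0 < ereal t" using False t(1) by (meson less_trans not_le)
      then have "0 < t" by simp
      from hyperbolic_set_near_radial_dim[OF assms(3) this t(2)] obtain K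
        where "hyperbolic_set f K" "ereal t \<le> hausdorff_dim K" by blast
      moreover from this have "hausdorff_dim K \<le> hyp_dim f" unfolding hyp_dim_def by (intro SUP_upper) simp
      ultimately show ?thesis using t(1) by (meson less_imp_le order_trans)
    qed
  qed
qed

end
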